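(* Let $q=p^n$ be a prime power, and let $S$ and $S'$ be linear Singer groups of $\mathcal{S}\cong\mathcal{P}(q)$ and $\mathcal{S}'\cong\mathcal{P}(q)$ respectively, arising from elements of the sets $\mathbf{B}(\ell)$, with $T=S/\mathbb{S}$ and $T'=S'/\mathbb{S}$; suppose that $S$ and $S'$ are not both among the classical examples (that is, abelian or isomorphic to the Heisenberg group $\mathbf{H}_1(q)$). Then the hypothesis of Essert's construction is satisfied for $(\mathcal{S},S)$ and $(\mathcal{S}',S')$, i.e. there exist bijections $\lambda:J\to\mathcal{L}$ and $\lambda':J\to\mathcal{L}'$ with $$S_{\lambda(j)}\cong S'_{\lambda'(j)}\quad\text{for all } j\in J,$$ if and only if $S$ and $S'$ agree on $\nu(\cdot)_0$, i.e. $\dim\nu(T)_0=\dim\nu(T')_0$. Here $J=\{0,1,\dots,q+1\}$, and $\mathcal{L}$, $\mathcal{L}'$ are the sets of lines of $\mathcal{S}$, $\mathcal{S}'$ through a fixed point of $\mathcal{S}$, $\mathcal{S}'$ respectively.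
   Context: $\mathbf{W}(q)$ is the symplectic generalized quadrangle of order $q$, $x$ a fixed point of it, and $\mathbb{S}$ the group (of order $q$) of all symmetries with center $x$ (automorphisms fixing every point of $x^\perp$). $\mathcal{P}(q)$, a generalized quadrangle of order $(q-1,q+1)$, is the Payne-derived quadrangle: its points are the points of $\mathbf{W}(q)$ not collinear with $x$; its lines are the lines of $\mathbf{W}(q)$ not through $x$ together with the sets $\{x,r\}^{\perp\perp}\setminus\{x\}$, $r\not\sim x$. A Singer group is a group of automorphisms acting sharply transitively on the points; it is linear if induced by a subgroup of $\mathbf{PGSp}_4(q)_x$ (with which it is identified). $S_M$ is the stabilizer of the line $M$ in $S$. $\Pi(x)$ is the affine plane of order $q$ with points the sets $\{x,z\}^\perp$, $z\not\sim x$, and lines the elements of $x^\perp\setminus\{x\}$; $\mathrm{Aut}(\Pi(x))\cong\mathrm{Aut}(\mathbf{W}(q))_x/\mathbb{S}$. For a point $\ell$ on the line at infinity $[\infty]$ of $\Pi(x)$, $A$ is the translation group of $\Pi(x)$ (elations of the projective completion with axis $[\infty]$), $B$ is the group of all elations with center $\ell$, $H(\ell)=\langle A,B\rangle$, $Z(H(\ell))=A\cap B$; $\mathbf{B}(\ell)$ is the set of subgroups of order $q$ of $H(\ell)/Z(H(\ell))$ meeting $B/Z(H(\ell))$ trivially. The Singer group arising from $U\in\mathbf{B}(\ell)$ is the one induced by the full preimage in $\mathrm{Aut}(\mathbf{W}(q))_x$ of $T$, where $T\le H(\ell)$ is the full preimage of $U$; so $\mathbb{S}\le S$ and $S/\mathbb{S}=T$.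 $\nu(T)_0$ is the projective space over $\mathbb{F}_p$ of the $\mathbb{F}_p$-vector space $(T\cap A)/(A\cap B)$ (of projective dimension $-1$ if trivial). Essert's construction takes two finite generalized quadrangles with Singer groups $S,S'$ and bijective enumerations $\lambda,\lambda'$ of the lines through a point with $S_{\lambda(j)}\cong S'_{\lambda'(j)}$ for all $j$, and produces uniform panel-regular lattices in buildings of type $\widetilde{\mathbf{C}_2}$. *)

theory Defs
  imports
    "HOL-Analysis.Cartesian_Space"
    "HOL-Algebra.Bij"
    "HOL-Algebra.Coset"
    "HOL-Algebra.Generated_Groups"
    "HOL-Algebra.FiniteProduct"
    "HOL-Computational_Algebra.Primes"
begin

section \<open>Point-line geometries and their automorphisms\<close>

text \<open>Lines are identified with their point rows. This loses nothing for the geometries used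
  here, since each of their lines has at least two points and is determined by any two of them.\<close>

record 'a geometry =
  pts :: "'a set"
  lns :: "'a set set"

definition geometry_iso :: "'a geometry \<Rightarrow> 'b geometry \<Rightarrow> ('a \<Rightarrow> 'b) set" where
  "geometry_iso G G' = {f. bij_betw f (pts G) (pts G') \<and> (\<lambda>L. f ` L) ` lns G = lns G'}"

definition aut :: "'a geometry \<Rightarrow> ('a \<Rightarrow> 'a) set" where
  "aut G = {g \<in> Bij (pts G). (\<lambda>L. g ` L) ` lns G = lns G}"

abbreviation perm_group :: "'a geometry \<Rightarrow> ('a \<Rightarrow> 'a) set \<Rightarrow> ('a \<Rightarrow> 'a) monoid" where
  "perm_group G S \<equiv> (BijGroup (pts G)) \<lparr> carrier := S \<rparr>"

abbreviation aut_group :: "'a geometry \<Rightarrow> ('a \<Rightarrow> 'a) monoid" where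
  "aut_group G \<equiv> perm_group G (aut G)"

definition lines_through :: "'a geometry \<Rightarrow> 'a \<Rightarrow> 'a set set" where
  "lines_through G z = {L \<in> lns G. z \<in> L}"

definition line_stabilizer :: "('a \<Rightarrow> 'a) set \<Rightarrow> 'a set \<Rightarrow> ('a \<Rightarrow> 'a) set" where
  "line_stabilizer S M = {g \<in> S. g ` M = M}"

definition singer_group :: "'a geometry \<Rightarrow> ('a \<Rightarrow> 'a) set \<Rightarrow> bool" where
  "singer_group G S \<longleftrightarrow>
     subgroup S (aut_group G) \<and> (\<forall>a \<in> pts G. \<forall>b \<in> pts G. \<exists>!g. g \<in> S \<and> g a = b)"

definition collin :: "'a geometry \<Rightarrow> 'a \<Rightarrow> 'a \<Rightarrow> bool" where
  "collin G a b \<longleftrightarrow> (\<exists>L \<in> lns G. a \<in> L \<and> b \<in> L)"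

definition perp :: "'a geometry \<Rightarrow> 'a set \<Rightarrow> 'a set" where
  "perp G X = {b \<in> pts G. \<forall>a \<in> X. collin G a b}"

section \<open>The quadrangle W(q)\<close>

definition symp_form :: "'k::field ^ 4 \<Rightarrow> 'k ^ 4 \<Rightarrow> 'k" where
  "symp_form u v = u $ 1 * v $ 2 - u $ 2 * v $ 1 + u $ 3 * v $ 4 - u $ 4 * v $ 3"

text \<open>A point of the quadrangle is a one-dimensional subspace of the 4-dimensional vector space;
  a line is the set of points contained in a totally isotropic two-dimensional subspace.\<close>

definition W_points :: "('k::field ^ 4) set set" where
  "W_points = {P. vec.subspace P \<and> vec.dim P = 1}"

definition W_quadrangle :: "('k::field ^ 4) set geometry" where
  "W_quadrangle =
     \<lparr> pts = W_points,
       lns = {{P \<in> W_points. P \<subseteq> V} | V.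
                vec.subspace V \<and> vec.dim V = 2 \<and> (\<forall>u \<in> V. \<forall>v \<in> V. symp_form u v = 0)} \<rparr>"

text \<open>The permutations of the points induced by the similitudes of the form.\<close>

definition PGSp4 :: "(('k::field ^ 4) set \<Rightarrow> ('k ^ 4) set) set" where
  "PGSp4 = {restrict (\<lambda>P. (\<lambda>v. M *v v) ` P) W_points | M.
              invertible M \<and>
              (\<exists>c. c \<noteq> 0 \<and> (\<forall>u v. symp_form (M *v u) (M *v v) = c * symp_form u v))}"

section \<open>Payne derivation\<close>

text \<open>A line of the quadrangle not through \<open>x\<close> is cut down to its points not collinear with
  \<open>x\<close>, in accordance with the identification of lines with point rows.\<close>

definition payne :: "'a geometry \<Rightarrow> 'a \<Rightarrow> 'a geometry" where
  "payne G x =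
     \<lparr> pts = pts G - perp G {x},
       lns = {L - perp G {x} | L. L \<in> lns G \<and> x \<notin> L}
           \<union> {perp G (perp G {x, r}) - {x} | r. r \<in> pts G \<and> \<not> collin G x r} \<rparr>"

text \<open>The permutation of the points of \<open>\<S>\<close> which \<open>g\<close>, an automorphism of \<open>G\<close> fixing \<open>x\<close>,
  induces via an isomorphism \<open>\<phi>\<close> from the Payne-derived quadrangle onto \<open>\<S>\<close>.\<close>

definition induced :: "'a geometry \<Rightarrow> 'a \<Rightarrow> ('a \<Rightarrow> 's) \<Rightarrow> 's geometry \<Rightarrow> ('a \<Rightarrow> 'a) \<Rightarrow> ('s \<Rightarrow> 's)"
  where
  "induced G x \<phi> \<S> g = (\<lambda>s \<in> pts \<S>. \<phi> (g (inv_into (pts (payne G x)) \<phi> s)))"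

definition linear_singer_group ::
    "('k::field ^ 4) set \<Rightarrow> (('k ^ 4) set \<Rightarrow> 's) \<Rightarrow> 's geometry \<Rightarrow> ('s \<Rightarrow> 's) set \<Rightarrow> bool" where
  "linear_singer_group x \<phi> \<S> S \<longleftrightarrow>
     singer_group \<S> S \<and>
     (\<exists>K. subgroup K (aut_group W_quadrangle) \<and> K \<subseteq> {g \<in> PGSp4. g x = x} \<and>
          S = induced W_quadrangle x \<phi> \<S> ` K)"

section \<open>Affine planes and elations of their projective completions\<close>

text \<open>The affine plane whose points are the sets \<open>{x,z}\<^sup>\<bottom>\<close> and whose lines are the points
  \<open>y \<noteq> x\<close> collinear with \<open>x\<close>, where \<open>y\<close> is incident with the points containing it.\<close>

definition plane :: "'a geometry \<Rightarrow> 'a \<Rightarrow> 'a set geometry" where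
  "plane G x =
     (let P = {perp G {x, z} | z. z \<in> pts G \<and> \<not> collin G x z}
      in \<lparr> pts = P, lns = {{X \<in> P. y \<in> X} | y. y \<in> perp G {x} - {x}} \<rparr>)"

definition plane_action :: "'a geometry \<Rightarrow> 'a \<Rightarrow> ('a \<Rightarrow> 'a) \<Rightarrow> ('a set \<Rightarrow> 'a set)" where
  "plane_action G x g = (\<lambda>X \<in> pts (plane G x). g ` X)"

definition parallel_class :: "'b geometry \<Rightarrow> 'b set \<Rightarrow> 'b set set" where
  "parallel_class E L = {M \<in> lns E. M = L \<or> M \<inter> L = {}}"

text \<open>Points at infinity are the parallel classes.\<close>

definition points_at_infinity :: "'b geometry \<Rightarrow> 'b set set set" where
  "points_at_infinity E = parallel_class E ` lns E"

definition line_at_infinity :: "'b geometry \<Rightarrow> ('b + 'b set set) set" where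
  "line_at_infinity E = Inr ` points_at_infinity E"

definition completion :: "'b geometry \<Rightarrow> ('b + 'b set set) geometry" where
  "completion E =
     \<lparr> pts = Inl ` pts E \<union> Inr ` points_at_infinity E,
       lns = insert (line_at_infinity E)
               ((\<lambda>L. insert (Inr (parallel_class E L)) (Inl ` L)) ` lns E) \<rparr>"

definition extension :: "'b geometry \<Rightarrow> ('b \<Rightarrow> 'b) \<Rightarrow> ('b + 'b set set) \<Rightarrow> ('b + 'b set set)" where
  "extension E g =
     (\<lambda>z \<in> pts (completion E). case z of Inl a \<Rightarrow> Inl (g a) | Inr C \<Rightarrow> Inr ((\<lambda>L. g ` L) ` C))"

text \<open>The identity counts as an elation.\<close>

definition elation :: "'c geometry \<Rightarrow> 'c \<Rightarrow> 'c set \<Rightarrow> ('c \<Rightarrow> 'c) \<Rightarrow> bool" where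
  "elation P c a h \<longleftrightarrow>
     h \<in> aut P \<and> a \<in> lns P \<and> c \<in> a \<and> (\<forall>z \<in> a. h z = z) \<and> (\<forall>L \<in> lns P. c \<in> L \<longrightarrow> h ` L = L)"

definition translation_set :: "'b geometry \<Rightarrow> ('b \<Rightarrow> 'b) set" where
  "translation_set E = {g \<in> aut E. \<exists>c. elation (completion E) c (line_at_infinity E) (extension E g)}"

text \<open>An elation whose center is at infinity fixes the line at infinity, hence is the extension
  of an automorphism of the affine plane.\<close>

definition central_elation_set :: "'b geometry \<Rightarrow> 'b set set \<Rightarrow> ('b \<Rightarrow> 'b) set" where
  "central_elation_set E l = {g \<in> aut E. \<exists>a. elation (completion E) (Inr l) a (extension E g)}"

section \<open>The groups H(l) and the Singer groups arising from them\<close>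

definition center :: "('a, 'm) monoid_scheme \<Rightarrow> 'a set" where
  "center G = {z \<in> carrier G. \<forall>g \<in> carrier G. g \<otimes>\<^bsub>G\<^esub> z = z \<otimes>\<^bsub>G\<^esub> g}"

definition H_group :: "'b geometry \<Rightarrow> 'b set set \<Rightarrow> ('b \<Rightarrow> 'b) monoid" where
  "H_group E l =
     perm_group E (generate (aut_group E) (translation_set E \<union> central_elation_set E l))"

definition BB :: "nat \<Rightarrow> 'b geometry \<Rightarrow> 'b set set \<Rightarrow> ('b \<Rightarrow> 'b) set set set" where
  "BB q E l =
     (let H = H_group E l; Z = center H
      in {U. subgroup U (H Mod Z) \<and> card U = q \<and>
             U \<inter> (\<lambda>b. Z #>\<^bsub>H\<^esub> b) ` central_elation_set E l = {\<one>\<^bsub>H Mod Z\<^esub>}})"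

definition H_preimage :: "'b geometry \<Rightarrow> 'b set set \<Rightarrow> ('b \<Rightarrow> 'b) set set \<Rightarrow> ('b \<Rightarrow> 'b) set" where
  "H_preimage E l U =
     (let H = H_group E l in {h \<in> carrier H. center H #>\<^bsub>H\<^esub> h \<in> U})"

text \<open>The full preimage of \<open>T\<close> under the action of the stabilizer of \<open>x\<close> on the plane; the kernel
  of this action is the group of symmetries with center \<open>x\<close>, so that the quotient of the preimage
  by the symmetries is identified with \<open>T\<close>.\<close>

definition aut_preimage :: "'a geometry \<Rightarrow> 'a \<Rightarrow> ('a set \<Rightarrow> 'a set) set \<Rightarrow> ('a \<Rightarrow> 'a) set" where
  "aut_preimage G x T = {g \<in> aut G. g x = x \<and> plane_action G x g \<in> T}"

section \<open>Classical examples\<close>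

text \<open>The triple \<open>(a, b, c)\<close> stands for the unitriangular \<open>3 \<times> 3\<close> matrix with entries \<open>a\<close>, \<open>b\<close>
  next to the diagonal and \<open>c\<close> in the corner.\<close>

definition heisenberg_group :: "('k::field \<times> 'k \<times> 'k) monoid" where
  "heisenberg_group =
     \<lparr> carrier = UNIV,
       monoid.mult = (\<lambda>(a, b, c) (a', b', c'). (a + a', b + b', c + c' + a * b')),
       monoid.one = (0, 0, 0) \<rparr>"

definition classical :: "'k::field itself \<Rightarrow> 'g monoid \<Rightarrow> bool" where
  "classical _ G \<longleftrightarrow> comm_group G \<or> G \<cong> (heisenberg_group :: ('k \<times> 'k \<times> 'k) monoid)"

section \<open>The projective space of an elementary abelian quotient\<close>

text \<open>Bases and dimension of an elementary abelian \<open>p\<close>-group, written multiplicatively, as a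
  vector space over the field of order \<open>p\<close>: scalars act by powers, and every element is a unique
  linear combination of the elements of a basis.\<close>

definition Fp_basis :: "nat \<Rightarrow> 'v monoid \<Rightarrow> 'v set \<Rightarrow> bool" where
  "Fp_basis p V X \<longleftrightarrow>
     finite X \<and> X \<subseteq> carrier V \<and>
     bij_betw (\<lambda>e. finprod V (\<lambda>v. v [^]\<^bsub>V\<^esub> (e v :: nat)) X) (X \<rightarrow>\<^sub>E {..<p}) (carrier V)"

definition Fp_dim :: "nat \<Rightarrow> 'v monoid \<Rightarrow> nat" where
  "Fp_dim p V = (THE d. \<exists>X. Fp_basis p V X \<and> card X = d)"

definition nu0_space :: "'b geometry \<Rightarrow> 'b set set \<Rightarrow> ('b \<Rightarrow> 'b) set \<Rightarrow> ('b \<Rightarrow> 'b) set monoid" where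
  "nu0_space E l T =
     perm_group E (T \<inter> translation_set E) Mod (translation_set E \<inter> central_elation_set E l)"

text \<open>The dimension of the projective space of this vector space; it is \<open>-1\<close> in the trivial
  case.\<close>

definition nu0_dim :: "nat \<Rightarrow> 'b geometry \<Rightarrow> 'b set set \<Rightarrow> ('b \<Rightarrow> 'b) set \<Rightarrow> int" where
  "nu0_dim p E l T = int (Fp_dim p (nu0_space E l T)) - 1"

end

theory Submission
  imports Defs "HOL-Number_Theory.Cong"
begin

text \<open>Choose a symplectic frame \<open>e, f, u, w\<close> such that \<open>e\<close> spans \<open>x\<close>, \<open>f\<close> spans the point of the
  Payne derivation corresponding to \<open>z\<close>, and \<open>w\<close> spans a line of the plane in the class \<open>l\<close>.
  The points of the Payne derivation are then \<open>(s, a, b) = \<langle>f + s e + a u + b w\<rangle>\<close>, those of the plane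
  are the \<open>(a, b)\<close>, and \<open>H(l)\<close> consists of the maps \<open>(a, b) \<mapsto> (a + \<alpha>, b + c a + d)\<close>. An element of
  \<open>\<^bold>B(l)\<close> is the graph of an additive function \<open>\<alpha> \<mapsto> c = g \<alpha>\<close>, and \<open>\<nu>(T)\<^sub>0\<close> is the projective space
  of \<open>ker g\<close>. Explicit symplectic lifts of the elements of \<open>T\<close> already act transitively, so by
  sharp transitivity they exhaust \<open>S\<close>. The line stabilizers in \<open>S\<close> are then computed directly: of the
  \<open>q + 2\<close> lines through \<open>z\<close>, two have a stabilizer isomorphic to the additive group of the
  field and the other \<open>q\<close> have one isomorphic to \<open>ker g\<close>. All of them are elementary abelian, so
  they are determined by their orders, and summing the orders over the lines through \<open>z\<close> recovers
  \<open>|ker g|\<close>.\<close>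

section \<open>Finite elementary abelian groups\<close>

text \<open>The set \<open>aut_preimage\<close> ranges over all automorphisms of the quadrangle
  fixing \<open>x\<close>, semilinear ones included, and describing it directly would require the
  full automorphism group. It is therefore only bounded from below, by \<open>q^3\<close> explicit
  maps; being a Singer group supplies the upper bound. \<open>H_group\<close>, by contrast, has to
  be known exactly, because its center, the sets in \<open>BB\<close> and the intersections in
  \<open>nu0_space\<close> all depend on it. Hence translations and central elations are determined
  from their definition through the projective completion. The kernel of \<open>g\<close> enters
  through one term: if a map sends the origin to a point of the line of slope \<open>m\<close>, it
  shifts the point of that line with parameter \<open>a\<close> by
  \<open>a * \<alpha> * g \<alpha>\<close> in the direction of \<open>e\<close>. The frame is built
  separately for each of the two given quadrangles, so no homogeneity of W(q) or of its planes is
  invoked. Orders are summed rather than compared line by line because the enumerations need not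
  respect the kinds of lines: only the total is independent of them.\<close>

locale elementary_abelian = comm_group G for G :: "'a monoid" (structure) +
  fixes p :: nat
  assumes fin: "finite (carrier G)"
    and prime_p: "prime p"
    and exponent: "v \<in> carrier G \<Longrightarrow> v [^] p = \<one>"
begin

text \<open>Exponents are arbitrary naturals, so that combinations are multiplied by adding
  exponents; the reduced exponents demanded by \<open>Fp_basis\<close> are recovered afterwards by
  \<open>comb_mod\<close>.\<close>

definition comb :: "'a set \<Rightarrow> ('a \<Rightarrow> nat) \<Rightarrow> 'a" where
  "comb X e = (\<Otimes>v\<in>X. v [^] e v)"

lemma comb_closed [simp]: "X \<subseteq> carrier G \<Longrightarrow> comb X e \<in> carrier G"
  unfolding comb_def by (rule finprod_closed) auto

lemma comb_cong:
  assumes "X \<subseteq> carrier G" "\<And>v. v \<in> X \<Longrightarrow> e v = e' v"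
  shows "comb X e = comb X e'"
  unfolding comb_def using assms by (intro finprod_cong') auto

lemma comb_add:
  assumes "X \<subseteq> carrier G"
  shows "comb X e \<otimes> comb X e' = comb X (\<lambda>v. e v + e' v)"
proof -
  have "comb X (\<lambda>v. e v + e' v) = (\<Otimes>v\<in>X. v [^] e v \<otimes> v [^] e' v)"
    unfolding comb_def using assms by (intro finprod_cong') (auto simp: nat_pow_mult subset_iff)
  also have "\<dots> = comb X e \<otimes> comb X e'"
    unfolding comb_def using assms by (intro finprod_multf) auto
  finally show ?thesis ..
qed

lemma comb_insert:
  assumes "X \<subseteq> carrier G" "v \<in> carrier G" "v \<notin> X"
  shows "comb (insert v X) e = v [^] e v \<otimes> comb X e"
  unfolding comb_def using assms fin
  by (intro finprod_insert) (auto intro: finite_subset)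

lemma pow_mod: "v \<in> carrier G \<Longrightarrow> v [^] (m mod p) = v [^] m"
proof -
  assume v: "v \<in> carrier G"
  have "v [^] m = v [^] (p * (m div p) + m mod p)" by simp
  also have "\<dots> = (v [^] p) [^] (m div p) \<otimes> v [^] (m mod p)"
    using v by (simp add: nat_pow_mult nat_pow_pow)
  finally show ?thesis using v exponent by simp
qed

lemma comb_mod:
  assumes "X \<subseteq> carrier G"
  shows "comb X (\<lambda>v\<in>X. e v mod p) = comb X e"
  unfolding comb_def using assms by (intro finprod_cong') (auto simp: pow_mod subset_iff)

lemma comb_image: "X \<subseteq> carrier G \<Longrightarrow> comb X ` (X \<rightarrow>\<^sub>E {..<p}) = range (comb X)"
proof -
  assume X: "X \<subseteq> carrier G"
  have "comb X e \<in> comb X ` (X \<rightarrow>\<^sub>E {..<p})" for e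
    using comb_mod[OF X, of e] prime_gt_0_nat[OF prime_p]
    by (intro image_eqI[of _ _ "\<lambda>v\<in>X. e v mod p"]) auto
  then show ?thesis by auto
qed

lemma comb_zero: "X \<subseteq> carrier G \<Longrightarrow> comb X (\<lambda>_. 0) = \<one>"
  unfolding comb_def by (rule finprod_one_eqI) simp

lemma comb_pow: "X \<subseteq> carrier G \<Longrightarrow> comb X e [^] (m::nat) = comb X (\<lambda>v. m * e v)"
  by (induction m) (auto simp: comb_zero comb_add algebra_simps)

text \<open>Scalars are natural numbers, so \<open>p - 1\<close> has to serve as the scalar -1; this
  is what makes differences of combinations available.\<close>

lemma inv_eq_pow: "v \<in> carrier G \<Longrightarrow> inv v = v [^] (p - 1)"
proof -
  assume v: "v \<in> carrier G"
  have "v [^] (p - 1) \<otimes> v = v [^] p"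
    using prime_gt_0_nat[OF prime_p] by (metis Suc_diff_1 nat_pow_Suc)
  then show ?thesis using v exponent inv_equality by auto
qed

lemma mem_range_comb: "X \<subseteq> carrier G \<Longrightarrow> v \<in> X \<Longrightarrow> v \<in> range (comb X)"
proof -
  assume X: "X \<subseteq> carrier G" and v: "v \<in> X"
  have "finite X" using X fin finite_subset by blast
  have "comb X (\<lambda>w. if v = w then 1 else 0) = (\<Otimes>w\<in>X. if v = w then w else \<one>)"
    unfolding comb_def using X by (intro finprod_cong') auto
  also have "\<dots> = v" using finprod_singleton[OF v \<open>finite X\<close>, of "\<lambda>w. w"] X by auto
  finally show ?thesis by (metis rangeI)
qed

text \<open>A nonzero scalar \<open>m\<close> is invertible modulo the prime \<open>p\<close>, so
  \<open>v\<close> is in turn a power of \<open>v [^] m\<close>, and the span is closed under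
  powers.\<close>

lemma pow_mem_range_comb_imp:
  assumes X: "X \<subseteq> carrier G" and v: "v \<in> carrier G"
    and m: "0 < m" "m < p" and mem: "v [^] m \<in> range (comb X)"
  shows "v \<in> range (comb X)"
proof -
  have "coprime m p"
    using prime_p m by (metis coprime_commute nat_dvd_not_less prime_imp_coprime)
  then obtain r where "[m * r = Suc 0] (mod p)"
    using cong_solve_coprime_nat by blast
  then have "v [^] (m * r) = v"
    using pow_mod[OF v, of "m * r"] pow_mod[OF v, of 1] v by (simp add: cong_def)
  then have "v = (v [^] m) [^] r" using v by (simp add: nat_pow_pow)
  then show ?thesis using mem comb_pow[OF X] by auto
qed

text \<open>Linear independence is encoded as injectivity on reduced exponents. Two equal
  combinations with different coefficients at \<open>v\<close> would put a nonzero multiple of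
  \<open>v\<close> into the span of \<open>X\<close>; by symmetry it is enough to exclude one of the
  two strict inequalities.\<close>

lemma inj_on_comb_insert:
  assumes X: "X \<subseteq> carrier G" and inj: "inj_on (comb X) (X \<rightarrow>\<^sub>E {..<p})"
    and v: "v \<in> carrier G" and nmem: "v \<notin> range (comb X)"
  shows "inj_on (comb (insert v X)) (insert v X \<rightarrow>\<^sub>E {..<p})"
proof -
  have vX: "v \<notin> X" using mem_range_comb[OF X] nmem by blast
  have le: "e' v \<le> e v"
    if e: "e \<in> insert v X \<rightarrow>\<^sub>E {..<p}" "e' \<in> insert v X \<rightarrow>\<^sub>E {..<p}"
      and eq: "comb (insert v X) e = comb (insert v X) e'" for e e'
  proof (rule ccontr)
    assume "\<not> ?thesis"
    then have lt: "e v < e' v" by simp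
    define m where "m = e' v - e v"
    have m: "0 < m" "m < p" using lt PiE_mem[OF e(2), of v] by (auto simp: m_def)
    have "v [^] e v \<otimes> comb X e = v [^] e' v \<otimes> comb X e'"
      using eq comb_insert[OF X v vX] by simp
    also have "v [^] e' v = v [^] e v \<otimes> v [^] m"
      using v lt by (simp add: nat_pow_mult m_def)
    finally have "v [^] m \<otimes> comb X e' = comb X e"
      using v X by (simp add: m_assoc)
    then have "v [^] m = comb X e \<otimes> inv (comb X e')"
      using v X by (metis comb_closed inv_solve_right nat_pow_closed)
    also have "\<dots> = comb X e \<otimes> comb X (\<lambda>w. (p - 1) * e' w)"
      using X by (simp add: inv_eq_pow comb_pow)
    finally have "v [^] m \<in> range (comb X)" using comb_add[OF X] by auto
    with pow_mem_range_comb_imp[OF X v m] nmem show False by blast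
  qed
  show ?thesis
  proof (rule inj_onI)
    fix e e' assume e: "e \<in> insert v X \<rightarrow>\<^sub>E {..<p}" "e' \<in> insert v X \<rightarrow>\<^sub>E {..<p}"
      and eq: "comb (insert v X) e = comb (insert v X) e'"
    have ev: "e v = e' v" using le[OF e eq] le[OF e(2,1) eq[symmetric]] by simp
    have "comb X e = comb X e'"
      using eq ev comb_insert[OF X v vX] v X by simp
    then have "comb X (restrict e X) = comb X (restrict e' X)"
      using comb_cong[OF X, of e "restrict e X"] comb_cong[OF X, of e' "restrict e' X"] by simp
    moreover have "restrict e X \<in> X \<rightarrow>\<^sub>E {..<p}" "restrict e' X \<in> X \<rightarrow>\<^sub>E {..<p}"
      using e by auto
    ultimately have *: "restrict e X = restrict e' X" using inj by (meson inj_onD)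
    show "e = e'"
    proof
      fix w
      consider "w = v" | "w \<in> X" | "w \<notin> insert v X" by blast
      then show "e w = e' w"
        using ev fun_cong[OF *, of w] e by cases (auto simp: PiE_def extensional_def)
    qed
  qed
qed

text \<open>A maximal independent set spans, since any vector outside its span could be added to it.
  The empty set starts the argument: over it there is a single exponent function.\<close>

lemma ex_Fp_basis: "\<exists>X. Fp_basis p G X"
proof -
  define \<A> where "\<A> = {X. X \<subseteq> carrier G \<and> inj_on (comb X) (X \<rightarrow>\<^sub>E {..<p})}"
  have "finite \<A>" using fin by (simp add: \<A>_def)
  moreover have "{} \<in> \<A>" by (simp add: \<A>_def)
  ultimately obtain X where "X \<in> \<A>" and max: "\<And>Y. Y \<in> \<A> \<Longrightarrow> X \<subseteq> Y \<Longrightarrow> X = Y"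
    using finite_has_maximal[of \<A>] by (metis empty_iff)
  then have X: "X \<subseteq> carrier G" "inj_on (comb X) (X \<rightarrow>\<^sub>E {..<p})" by (simp_all add: \<A>_def)
  have "carrier G \<subseteq> range (comb X)"
  proof (rule subsetI, rule ccontr)
    fix v assume v: "v \<in> carrier G" "v \<notin> range (comb X)"
    then have "insert v X \<in> \<A>" using inj_on_comb_insert[OF X v] X by (simp add: \<A>_def)
    then have "v \<in> X" using max by blast
    then show False using mem_range_comb X v by blast
  qed
  then have "bij_betw (comb X) (X \<rightarrow>\<^sub>E {..<p}) (carrier G)"
    using X comb_image[of X] comb_closed[of X] by (auto simp: bij_betw_def)
  then show ?thesis
    using X fin finite_subset unfolding Fp_basis_def comb_def by blast
qed

lemma Fp_basis_card: "Fp_basis p G X \<Longrightarrow> card (carrier G) = p ^ card X"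
  unfolding Fp_basis_def using bij_betw_same_card[of _ "X \<rightarrow>\<^sub>E {..<p}" "carrier G"]
  by (auto simp: card_funcsetE)

text \<open>\<open>Fp_dim\<close> is a definite description; it is well defined because every basis
  \<open>X\<close> gives the order of the group as \<open>p ^ card X\<close>, and powers of
  \<open>p\<close> determine their exponents.\<close>

lemma card_carrier: "card (carrier G) = p ^ Fp_dim p G"
proof -
  obtain X where X: "Fp_basis p G X" using ex_Fp_basis by blast
  have "Fp_dim p G = card X"
    unfolding Fp_dim_def
  proof (rule the_equality)
    show "\<exists>Y. Fp_basis p G Y \<and> card Y = card X" using X by blast
    fix d assume "\<exists>Y. Fp_basis p G Y \<and> card Y = d"
    then have "p ^ d = p ^ card X" using Fp_basis_card[OF X] Fp_basis_card by metis
    then show "d = card X" using power_inject_exp[OF prime_gt_1_nat[OF prime_p]] by blast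
  qed
  then show ?thesis using Fp_basis_card[OF X] by simp
qed

end

text \<open>Equal orders give bases of equal size; \<open>\<beta>\<close> matches them and
  \<open>h\<close> carries coordinates across. Injectivity suffices, since the two carriers are
  finite of the same size.\<close>

lemma elementary_abelian_iso:
  assumes "elementary_abelian G p" "elementary_abelian G' p" "card (carrier G) = card (carrier G')"
  shows "G \<cong> G'"
proof -
  interpret G: elementary_abelian G p by fact
  interpret G': elementary_abelian G' p by fact
  obtain X where X: "Fp_basis p G X" using G.ex_Fp_basis by blast
  obtain X' where X': "Fp_basis p G' X'" using G'.ex_Fp_basis by blast
  have sub: "X \<subseteq> carrier G" "X' \<subseteq> carrier G'" and finX: "finite X" "finite X'"
    using X X' by (auto simp: Fp_basis_def)
  have p1: "p > 1" using G.prime_p prime_gt_1_nat by blast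
  have "card X = card X'"
    using G.Fp_basis_card[OF X] G'.Fp_basis_card[OF X'] assms(3) p1 by simp
  then obtain \<beta> where \<beta>: "bij_betw \<beta> X' X"
    using finX finite_same_card_bij[of X' X] by auto
  have \<beta>X: "\<beta> v \<in> X" if "v \<in> X'" for v using that \<beta> bij_betwE by blast
  have bij: "bij_betw (G.comb X) (X \<rightarrow>\<^sub>E {..<p}) (carrier G)"
    "bij_betw (G'.comb X') (X' \<rightarrow>\<^sub>E {..<p}) (carrier G')"
    using X X' by (simp_all add: Fp_basis_def G.comb_def[abs_def] G'.comb_def[abs_def])
  define c where "c = inv_into (X \<rightarrow>\<^sub>E {..<p}) (G.comb X)"
  have c: "c y \<in> X \<rightarrow>\<^sub>E {..<p}" "G.comb X (c y) = y" if "y \<in> carrier G" for y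
    using that bij(1) unfolding c_def bij_betw_def by (metis inv_into_into, metis f_inv_into_f)
  have c_unique: "c y = e" if "e \<in> X \<rightarrow>\<^sub>E {..<p}" "G.comb X e = y" for e y
    using that bij(1) unfolding c_def by (metis bij_betw_inv_into_left)
  define h where "h y = G'.comb X' (\<lambda>v. c y (\<beta> v))" for y
  have "h \<in> hom G G'"
  proof (rule homI)
    fix y assume "y \<in> carrier G"
    then show "h y \<in> carrier G'" using sub by (simp add: h_def)
  next
    fix y y' assume y: "y \<in> carrier G" "y' \<in> carrier G"
    \<comment> \<open>The sum of two reduced coordinate functions need not be reduced. Reduction
      modulo \<open>p\<close> does not change the combination, and uniqueness of reduced coordinates
      then identifies it with \<open>c\<close> of the product.\<close>
    have "G.comb X (\<lambda>v\<in>X. (c y v + c y' v) mod p) = y \<otimes>\<^bsub>G\<^esub> y'"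
      using G.comb_mod[OF sub(1)] G.comb_add[OF sub(1), of "c y" "c y'"] c(2) y by simp
    then have ce: "c (y \<otimes>\<^bsub>G\<^esub> y') = (\<lambda>v\<in>X. (c y v + c y' v) mod p)"
      using p1 by (intro c_unique) auto
    have "h (y \<otimes>\<^bsub>G\<^esub> y') = G'.comb X' (\<lambda>v\<in>X'. (c y (\<beta> v) + c y' (\<beta> v)) mod p)"
      unfolding h_def ce using sub \<beta>X by (intro G'.comb_cong) auto
    then show "h (y \<otimes>\<^bsub>G\<^esub> y') = h y \<otimes>\<^bsub>G'\<^esub> h y'"
      using G'.comb_mod[OF sub(2)] G'.comb_add[OF sub(2)] by (simp add: h_def)
  qed
  moreover have "inj_on h (carrier G)"
  proof (rule inj_onI)
    fix y y' assume y: "y \<in> carrier G" "y' \<in> carrier G" and eq: "h y = h y'"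
    have r: "(\<lambda>v\<in>X'. c z (\<beta> v)) \<in> X' \<rightarrow>\<^sub>E {..<p}" "h z = G'.comb X' (\<lambda>v\<in>X'. c z (\<beta> v))"
      if "z \<in> carrier G" for z
      using c(1)[OF that] \<beta>X sub unfolding h_def by (auto intro!: G'.comb_cong)
    have *: "(\<lambda>v\<in>X'. c y (\<beta> v)) = (\<lambda>v\<in>X'. c y' (\<beta> v))"
      using bij(2) eq r y by (metis bij_betw_imp_inj_on inj_onD)
    have "c y v = c y' v" for v
    proof (cases "v \<in> X")
      case True
      then obtain w where "w \<in> X'" "v = \<beta> w" using \<beta> by (auto simp: bij_betw_def)
      then show ?thesis using fun_cong[OF *, of w] by simp
    next
      case False
      then show ?thesis using PiE_arb[OF c(1)[OF y(1)]] PiE_arb[OF c(1)[OF y(2)]] by simp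
    qed
    then have "c y = c y'" by blast
    then have "G.comb X (c y) = G.comb X (c y')" by (rule arg_cong)
    then show "y = y'" unfolding c(2)[OF y(1)] c(2)[OF y(2)] .
  qed
  moreover have "h ` carrier G = carrier G'"
    using calculation assms(3) G'.fin hom_carrier[of h G G'] card_image[of h "carrier G"]
    by (intro card_subset_eq) auto
  ultimately show ?thesis by (intro is_isoI) (auto simp: iso_def bij_betw_def)
qed

text \<open>Intended for \<open>nu0_space\<close>: its group structure and exponent are inherited
  from an additive subgroup of the field, and only the monoid laws have to be verified in the
  quotient itself.\<close>

lemma elementary_abelian_cong:
  assumes "elementary_abelian G p" "G \<cong> G'" "monoid G'"
  shows "elementary_abelian G' p"
proof -
  interpret G: elementary_abelian G p by fact
  interpret G': comm_group G' by (rule G.iso_imp_comm_group[OF assms(2,3)])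
  obtain h where h: "h \<in> iso G G'" using assms(2) unfolding is_iso_def by blast
  interpret h: group_hom G G' h
    using h by unfold_locales (auto simp: iso_def)
  have surj: "h ` carrier G = carrier G'" using h by (simp add: iso_def bij_betw_def)
  show ?thesis
  proof unfold_locales
    show "finite (carrier G')" using surj G.fin by (metis finite_imageI)
    show "prime p" by (rule G.prime_p)
    fix v assume "v \<in> carrier G'"
    then obtain w where "w \<in> carrier G" "v = h w" using surj by blast
    then show "v [^]\<^bsub>G'\<^esub> p = \<one>\<^bsub>G'\<^esub>"
      using G.exponent by (metis h.hom_nat_pow h.hom_one)
  qed
qed

lemma Fp_dim_iso_eq:
  assumes "elementary_abelian G p" "elementary_abelian G' p"
  shows "Fp_dim p G = Fp_dim p G' \<longleftrightarrow> card (carrier G) = card (carrier G')"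
  using elementary_abelian.card_carrier[OF assms(1)] elementary_abelian.card_carrier[OF assms(2)]
    prime_gt_1_nat[OF elementary_abelian.prime_p[OF assms(1)]] by simp

section \<open>Additive subgroups of a finite field\<close>

definition additive_subgroup :: "'k::ab_group_add set \<Rightarrow> bool" where
  "additive_subgroup A \<longleftrightarrow> 0 \<in> A \<and> (\<forall>a\<in>A. \<forall>b\<in>A. a - b \<in> A)"

definition add_group :: "'k::ab_group_add set \<Rightarrow> 'k monoid" where
  "add_group A = \<lparr>carrier = A, monoid.mult = (+), one = 0\<rparr>"

lemma add_group_simps [simp]:
  "carrier (add_group A) = A" "monoid.mult (add_group A) = (+)" "one (add_group A) = 0"
  by (simp_all add: add_group_def)

lemma additive_subgroup_add:
  assumes "additive_subgroup A" "a \<in> A" "b \<in> A"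
  shows "a + b \<in> A"
proof -
  have "a - (0 - b) \<in> A" using assms unfolding additive_subgroup_def by blast
  then show ?thesis by simp
qed

lemma comm_group_add_group:
  fixes A :: "'k::ab_group_add set"
  assumes "additive_subgroup A"
  shows "comm_group (add_group A)"
proof (rule comm_groupI)
  fix a assume "a \<in> carrier (add_group A)"
  then have "- a \<in> A" using assms unfolding additive_subgroup_def by (metis add_group_simps(1) diff_0)
  then show "\<exists>b\<in>carrier (add_group A). b \<otimes>\<^bsub>add_group A\<^esub> a = \<one>\<^bsub>add_group A\<^esub>"
    by (intro bexI[of _ "- a"]) auto
qed (use assms additive_subgroup_add in \<open>auto simp: additive_subgroup_def algebra_simps\<close>)

text \<open>Translation by 1 permutes the field, so the sum of all elements equals itself plus the
  order of the field times 1. That multiple of 1 is thus zero, and since a field has no nilpotent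
  elements, \<open>p\<close> times 1 is zero already.\<close>

lemma of_nat_char_zero:
  assumes "CARD('k::{field,finite}) = p ^ n"
  shows "(of_nat p :: 'k) = 0"
proof -
  have "(\<Sum>a\<in>(UNIV::'k set). a + 1) = (\<Sum>a\<in>(UNIV::'k set). a)"
    by (rule sum.reindex_bij_witness[of _ "\<lambda>a. a - 1" "\<lambda>a. a + 1"]) auto
  then have "(of_nat (CARD('k)) :: 'k) = 0" by (simp add: sum.distrib)
  then show ?thesis using assms by (auto simp: of_nat_power)
qed

lemma elementary_abelian_add_group:
  fixes A :: "'k::{field,finite} set"
  assumes "additive_subgroup A" "prime p" "CARD('k) = p ^ n"
  shows "elementary_abelian (add_group A) p"
proof -
  interpret comm_group "add_group A" by (rule comm_group_add_group[OF assms(1)])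
  have pow: "v [^]\<^bsub>add_group A\<^esub> (m::nat) = of_nat m * v" for v m
    by (induction m) (auto simp: algebra_simps)
  show ?thesis
    by unfold_locales (use assms pow of_nat_char_zero[OF assms(3)] in auto)
qed

section \<open>Automorphisms of geometries and of completed affine planes\<close>

lemma perm_group_mult:
  "g \<in> Bij (pts G) \<Longrightarrow> h \<in> Bij (pts G) \<Longrightarrow> g \<otimes>\<^bsub>perm_group G S\<^esub> h = compose (pts G) g h"
  by (simp add: BijGroup_def)

lemma aut_subset_Bij: "aut G \<subseteq> Bij (pts G)"
  by (auto simp: aut_def)

lemma aut_line: "g \<in> aut G \<Longrightarrow> L \<in> lns G \<Longrightarrow> g ` L \<in> lns G"
  by (auto simp: aut_def)

lemma aut_line_ex: "g \<in> aut G \<Longrightarrow> L \<in> lns G \<Longrightarrow> \<exists>M\<in>lns G. L = g ` M"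
  by (simp add: aut_def) (metis imageE)

lemma aut_inj_on: "g \<in> aut G \<Longrightarrow> inj_on g (pts G)"
  by (auto simp: aut_def Bij_def bij_betw_def)

lemma aut_point: "g \<in> aut G \<Longrightarrow> a \<in> pts G \<Longrightarrow> g a \<in> pts G"
  by (auto simp: aut_def Bij_def bij_betw_def)

lemma aut_extensional: "g \<in> aut G \<Longrightarrow> g \<in> extensional (pts G)"
  by (auto simp: aut_def Bij_def)

text \<open>An explicit inverse \<open>h\<close> that preserves lines also shows that every line is
  an image: a line \<open>L\<close> is the image under \<open>g\<close> of its image under
  \<open>h\<close>.\<close>

lemma autI:
  assumes sub: "lns G \<subseteq> Pow (pts G)" and "g \<in> extensional (pts G)"
    and gh: "\<And>a. a \<in> pts G \<Longrightarrow> g a \<in> pts G" "\<And>a. a \<in> pts G \<Longrightarrow> h a \<in> pts G"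
      "\<And>a. a \<in> pts G \<Longrightarrow> h (g a) = a" "\<And>a. a \<in> pts G \<Longrightarrow> g (h a) = a"
    and gl: "\<And>L. L \<in> lns G \<Longrightarrow> g ` L \<in> lns G" and hl: "\<And>L. L \<in> lns G \<Longrightarrow> h ` L \<in> lns G"
  shows "g \<in> aut G"
proof -
  have "bij_betw g (pts G) (pts G)"
    by (rule bij_betw_byWitness[where f' = h]) (use gh in auto)
  moreover have "L \<in> (\<lambda>L. g ` L) ` lns G" if "L \<in> lns G" for L
  proof -
    have "g ` h ` L = (\<lambda>a. a) ` L"
      unfolding image_image using sub that gh(4) by (intro image_cong) auto
    then show ?thesis using hl[OF that] by (metis image_eqI image_ident)
  qed
  ultimately show ?thesis using assms by (auto simp: aut_def Bij_def)
qed

lemma restrict_inv_aut: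
  assumes sub: "lns G \<subseteq> Pow (pts G)" and g: "g \<in> aut G"
  shows "restrict (inv_into (pts G) g) (pts G) \<in> aut G"
proof -
  let ?h = "restrict (inv_into (pts G) g) (pts G)"
  have bij: "bij_betw g (pts G) (pts G)" using g by (simp add: aut_def Bij_def)
  show ?thesis
  proof (rule autI[OF sub, where h = g])
    fix a assume a: "a \<in> pts G"
    show "?h a \<in> pts G" using a bij by (simp add: bij_betw_def inv_into_into)
    show "g a \<in> pts G" by (rule aut_point[OF g a])
    show "g (?h a) = a" using a bij by (simp add: bij_betw_inv_into_right)
    show "?h (g a) = a" using a bij aut_point[OF g a] by (simp add: bij_betw_inv_into_left)
  next
    fix L assume "L \<in> lns G"
    then show "g ` L \<in> lns G" by (rule aut_line[OF g])
  next
    fix L assume "L \<in> lns G"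
    then obtain M where M: "M \<in> lns G" "L = g ` M" using aut_line_ex[OF g] by blast
    have "?h ` L = (\<lambda>a. a) ` M"
      unfolding M(2) image_image
      using M(1) sub bij aut_point[OF g]
      by (intro image_cong) (auto simp: bij_betw_inv_into_left subset_iff)
    then show "?h ` L \<in> lns G" using M(1) by simp
  qed simp
qed

lemma group_aut_group:
  assumes sub: "lns G \<subseteq> Pow (pts G)"
  shows "group (aut_group G)"
proof -
  have "subgroup (aut G) (BijGroup (pts G))"
  proof (rule group.subgroupI[OF group_BijGroup])
    show "aut G \<subseteq> carrier (BijGroup (pts G))" using aut_subset_Bij by (simp add: BijGroup_def)
    have "(\<lambda>a\<in>pts G. a) ` L = (\<lambda>a. a) ` L" if "L \<in> lns G" for L
      using that sub by (intro image_cong) auto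
    then have "(\<lambda>a\<in>pts G. a) \<in> aut G"
      by (intro autI[OF sub, where h = "\<lambda>a. a"]) simp_all
    then show "aut G \<noteq> {}" by blast
    fix g assume g: "g \<in> aut G"
    let ?h = "restrict (inv_into (pts G) g) (pts G)"
    have h: "?h \<in> aut G" by (rule restrict_inv_aut[OF sub g])
    have Bij: "g \<in> Bij (pts G)" "?h \<in> Bij (pts G)" using g h aut_subset_Bij by blast+
    have "?h \<otimes>\<^bsub>BijGroup (pts G)\<^esub> g = \<one>\<^bsub>BijGroup (pts G)\<^esub>"
      using Bij Bij_compose_restrict_eq[OF Bij(1)] by (simp add: BijGroup_def)
    then have "inv\<^bsub>BijGroup (pts G)\<^esub> g = ?h"
      using Bij by (intro group.inv_equality[OF group_BijGroup]) (auto simp: BijGroup_def)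
    then show "inv\<^bsub>BijGroup (pts G)\<^esub> g \<in> aut G" using h by simp
  next
    fix g h assume g: "g \<in> aut G" and h: "h \<in> aut G"
    have Bij: "g \<in> Bij (pts G)" "h \<in> Bij (pts G)" using g h aut_subset_Bij by blast+
    have "compose (pts G) g h ` L = g ` h ` L" if "L \<in> lns G" for L
      unfolding image_image using that sub by (intro image_cong) (auto simp: compose_def)
    then have "(\<lambda>L. compose (pts G) g h ` L) ` lns G = (\<lambda>L. g ` L) ` (\<lambda>L. h ` L) ` lns G"
      by (auto simp: image_image)
    then show "g \<otimes>\<^bsub>BijGroup (pts G)\<^esub> h \<in> aut G"
      using Bij g h compose_Bij[OF Bij] by (auto simp: aut_def BijGroup_def)
  qed
  then show ?thesis
    by (metis group.subgroup_imp_group group_BijGroup)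
qed

lemma image_parallel_class:
  assumes sub: "lns E \<subseteq> Pow (pts E)" and g: "g \<in> aut E" and L: "L \<in> lns E"
  shows "(\<lambda>L. g ` L) ` parallel_class E L = parallel_class E (g ` L)"
proof -
  have iff: "g ` M \<inter> g ` L = {} \<longleftrightarrow> M \<inter> L = {}" "g ` M = g ` L \<longleftrightarrow> M = L" if "M \<in> lns E" for M
  proof -
    have sub': "M \<subseteq> pts E" "L \<subseteq> pts E" using sub L that by blast+
    show "g ` M \<inter> g ` L = {} \<longleftrightarrow> M \<inter> L = {}"
      unfolding inj_on_image_Int[OF aut_inj_on[OF g] sub', symmetric] by (rule image_is_empty)
    show "g ` M = g ` L \<longleftrightarrow> M = L"
      by (rule inj_on_image_eq_iff[OF aut_inj_on[OF g] sub'])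
  qed
  show ?thesis
  proof (intro equalityI subsetI)
    fix N assume "N \<in> (\<lambda>L. g ` L) ` parallel_class E L"
    then show "N \<in> parallel_class E (g ` L)"
      using iff aut_line[OF g] by (auto simp: parallel_class_def)
  next
    fix N assume N: "N \<in> parallel_class E (g ` L)"
    then have "N \<in> lns E" using aut_line[OF g L] by (auto simp: parallel_class_def)
    then obtain M where "M \<in> lns E" "N = g ` M"
      using aut_line_ex[OF g] by blast
    then show "N \<in> (\<lambda>L. g ` L) ` parallel_class E L"
      using N iff by (auto simp: parallel_class_def)
  qed
qed

lemma image_points_at_infinity:
  assumes "lns E \<subseteq> Pow (pts E)" and "g \<in> aut E"
  shows "(\<lambda>C. (\<lambda>L. g ` L) ` C) ` points_at_infinity E = points_at_infinity E"
proof -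
  have "(\<lambda>C. (\<lambda>L. g ` L) ` C) ` points_at_infinity E = (\<lambda>L. parallel_class E (g ` L)) ` lns E"
    unfolding points_at_infinity_def image_image
    using image_parallel_class[OF assms] by (intro image_cong) (auto simp: image_image)
  also have "\<dots> = parallel_class E ` (\<lambda>L. g ` L) ` lns E" by (simp add: image_image)
  finally show ?thesis using assms(2) by (simp add: aut_def points_at_infinity_def)
qed

section \<open>Elations of the completion in terms of affine lines and parallel classes\<close>

definition completed_line :: "'b geometry \<Rightarrow> 'b set \<Rightarrow> ('b + 'b set set) set" where
  "completed_line E L = insert (Inr (parallel_class E L)) (Inl ` L)"

lemma lns_completion: "lns (completion E) = insert (line_at_infinity E) (completed_line E ` lns E)"
  by (simp add: completion_def completed_line_def[abs_def])

lemma pts_completion: "pts (completion E) = Inl ` pts E \<union> Inr ` points_at_infinity E"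
  by (simp add: completion_def)

lemma extension_Inl [simp]: "a \<in> pts E \<Longrightarrow> extension E g (Inl a) = Inl (g a)"
  by (simp add: extension_def pts_completion)

lemma extension_Inr [simp]:
  "C \<in> points_at_infinity E \<Longrightarrow> extension E g (Inr C) = Inr ((\<lambda>L. g ` L) ` C)"
  by (simp add: extension_def pts_completion)

lemma extension_completed_line:
  assumes "lns E \<subseteq> Pow (pts E)" "g \<in> aut E" "L \<in> lns E"
  shows "extension E g ` completed_line E L = completed_line E (g ` L)"
proof -
  have "L \<subseteq> pts E" using assms by blast
  then have "extension E g ` Inl ` L = Inl ` g ` L"
    unfolding image_image by (intro image_cong) auto
  moreover have "parallel_class E L \<in> points_at_infinity E"
    using assms by (auto simp: points_at_infinity_def)
  ultimately show ?thesis
    using image_parallel_class[OF assms] by (simp add: completed_line_def)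
qed

lemma extension_line_at_infinity:
  assumes "lns E \<subseteq> Pow (pts E)" "g \<in> aut E"
  shows "extension E g ` line_at_infinity E = line_at_infinity E"
proof -
  have "extension E g ` line_at_infinity E = Inr ` (\<lambda>C. (\<lambda>L. g ` L) ` C) ` points_at_infinity E"
    unfolding line_at_infinity_def image_image by (intro image_cong) auto
  then show ?thesis
    using image_points_at_infinity[OF assms] by (simp add: line_at_infinity_def)
qed

text \<open>The inverse of the extension is the extension of the inverse. At infinity the two cancel
  because the members of a parallel class are sets of affine points.\<close>

lemma extension_aut:
  assumes sub: "lns E \<subseteq> Pow (pts E)" and g: "g \<in> aut E"
  shows "extension E g \<in> aut (completion E)"
proof -
  let ?h = "restrict (inv_into (pts E) g) (pts E)"
  have h: "?h \<in> aut E" by (rule restrict_inv_aut[OF sub g])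
  have bij: "bij_betw g (pts E) (pts E)" using g by (simp add: aut_def Bij_def)
  have hg: "?h (g a) = a" "g (?h a) = a" if "a \<in> pts E" for a
    using that bij aut_point[OF g that]
    by (simp_all add: bij_betw_inv_into_left bij_betw_inv_into_right)
  have PI: "(\<lambda>L. f ` L) ` C \<in> points_at_infinity E" if "C \<in> points_at_infinity E" "f \<in> aut E" for C f
    using image_points_at_infinity[OF sub that(2)] that(1) by blast
  have inv: "(\<lambda>L. f ` L) ` (\<lambda>L. f' ` L) ` C = C"
    if "C \<in> points_at_infinity E" and ff: "\<And>a. a \<in> pts E \<Longrightarrow> f (f' a) = a" for C f f'
  proof -
    have "f ` f' ` L = L" if "L \<in> C" for L
    proof -
      have "L \<subseteq> pts E"
        using \<open>C \<in> _\<close> \<open>L \<in> C\<close> sub by (auto simp: points_at_infinity_def parallel_class_def)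
      then have "f ` f' ` L = (\<lambda>a. a) ` L"
        unfolding image_image using ff by (intro image_cong) auto
      then show ?thesis by simp
    qed
    then show ?thesis by (simp add: image_image)
  qed
  show ?thesis
  proof (rule autI[where h = "extension E ?h"])
    show "lns (completion E) \<subseteq> Pow (pts (completion E))"
      using sub by (auto simp: lns_completion pts_completion completed_line_def line_at_infinity_def
          points_at_infinity_def)
    show "extension E g \<in> extensional (pts (completion E))" by (simp add: extension_def)
    fix z assume z: "z \<in> pts (completion E)"
    show "extension E g z \<in> pts (completion E)"
      using z aut_point[OF g] PI[OF _ g] by (auto simp: pts_completion)
    show "extension E ?h z \<in> pts (completion E)"
      using z aut_point[OF h] PI[OF _ h] by (auto simp: pts_completion simp del: restrict_apply)
    show "extension E ?h (extension E g z) = z"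
      using z aut_point[OF g] PI[OF _ g] inv[of _ ?h g] hg
      by (auto simp: pts_completion simp del: restrict_apply)
    show "extension E g (extension E ?h z) = z"
      using z aut_point[OF h] PI[OF _ h] inv[of _ g ?h] hg
      by (auto simp: pts_completion simp del: restrict_apply)
  next
    fix L assume "L \<in> lns (completion E)"
    then show "extension E g ` L \<in> lns (completion E)" "extension E ?h ` L \<in> lns (completion E)"
      using extension_completed_line[OF sub g] extension_completed_line[OF sub h]
        extension_line_at_infinity[OF sub g] extension_line_at_infinity[OF sub h]
        aut_line[OF g] aut_line[OF h]
      by (auto simp: lns_completion simp del: restrict_apply image_restrict_eq)
  qed
qed

lemma completed_line_eq_iff: "completed_line E L = completed_line E M \<longleftrightarrow> L = M"
proof
  assume eq: "completed_line E L = completed_line E M"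
  have "L = {a. Inl a \<in> completed_line E L}" "M = {a. Inl a \<in> completed_line E M}"
    by (auto simp: completed_line_def)
  then show "L = M" using eq by metis
qed simp

text \<open>The line at infinity drops out of the condition: every extension stabilizes it.\<close>

lemma center_condition_iff:
  assumes sub: "lns E \<subseteq> Pow (pts E)" and g: "g \<in> aut E"
  shows "(\<forall>M\<in>lns (completion E). Inr C \<in> M \<longrightarrow> extension E g ` M = M) \<longleftrightarrow>
         (\<forall>L\<in>lns E. parallel_class E L = C \<longrightarrow> g ` L = L)"
proof -
  have "Inr C \<in> completed_line E L \<longleftrightarrow> parallel_class E L = C" for L
    by (auto simp: completed_line_def)
  then show ?thesis
    using extension_completed_line[OF sub g] extension_line_at_infinity[OF sub g]
    by (auto simp: lns_completion completed_line_eq_iff)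
qed

lemma fixes_line_at_infinity_iff:
  "(\<forall>z\<in>line_at_infinity E. extension E g z = z) \<longleftrightarrow>
   (\<forall>D\<in>points_at_infinity E. (\<lambda>L. g ` L) ` D = D)"
  by (auto simp: line_at_infinity_def)

text \<open>The completion disappears from the description: a center lying on the line at infinity
  is a parallel class \<open>C\<close>, and the remaining lines through it are the completed lines
  of that class.\<close>

lemma translation_set_iff:
  assumes sub: "lns E \<subseteq> Pow (pts E)"
  shows "g \<in> translation_set E \<longleftrightarrow>
    g \<in> aut E \<and> (\<forall>D\<in>points_at_infinity E. (\<lambda>L. g ` L) ` D = D) \<and>
    (\<exists>C\<in>points_at_infinity E. \<forall>L\<in>lns E. parallel_class E L = C \<longrightarrow> g ` L = L)"
proof -
  have "(\<exists>c. elation (completion E) c (line_at_infinity E) (extension E g)) \<longleftrightarrow>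
      (\<exists>C\<in>points_at_infinity E. elation (completion E) (Inr C) (line_at_infinity E) (extension E g))"
    by (auto simp: elation_def line_at_infinity_def)
  moreover have "elation (completion E) (Inr C) (line_at_infinity E) (extension E g) \<longleftrightarrow>
      (\<forall>D\<in>points_at_infinity E. (\<lambda>L. g ` L) ` D = D) \<and>
      (\<forall>L\<in>lns E. parallel_class E L = C \<longrightarrow> g ` L = L)"
    if "g \<in> aut E" "C \<in> points_at_infinity E" for C
    unfolding elation_def center_condition_iff[OF sub that(1)] fixes_line_at_infinity_iff
    using extension_aut[OF sub that(1)] that(2) by (simp add: lns_completion line_at_infinity_def)
  ultimately show ?thesis unfolding translation_set_def mem_Collect_eq by (metis (no_types, lifting))
qed

text \<open>The axis passes through the center, so it is either the line at infinity or the
  completion of a line in the class \<open>C\<close>; these are the two alternatives on the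
  right.\<close>

lemma central_elation_set_iff:
  assumes sub: "lns E \<subseteq> Pow (pts E)" and C: "C \<in> points_at_infinity E"
  shows "g \<in> central_elation_set E C \<longleftrightarrow>
    g \<in> aut E \<and> (\<forall>L\<in>lns E. parallel_class E L = C \<longrightarrow> g ` L = L) \<and>
    ((\<forall>D\<in>points_at_infinity E. (\<lambda>L. g ` L) ` D = D) \<or>
     (\<exists>L\<in>lns E. parallel_class E L = C \<and> (\<forall>a\<in>L. g a = a)))"
  (is "_ \<longleftrightarrow> _ \<and> ?center \<and> (?inf \<or> ?aff)")
proof -
  have *: "(\<exists>a. elation (completion E) (Inr C) a (extension E g)) \<longleftrightarrow> ?center \<and> (?inf \<or> ?aff)"
    if g: "g \<in> aut E"
  proof
    assume "\<exists>a. elation (completion E) (Inr C) a (extension E g)"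
    then obtain a where a: "a \<in> lns (completion E)" "Inr C \<in> a" "\<forall>z\<in>a. extension E g z = z"
      and cen: ?center
      unfolding elation_def center_condition_iff[OF sub g, symmetric] by blast
    have ?aff if aff: "a \<noteq> line_at_infinity E"
    proof -
      obtain L where L: "L \<in> lns E" "a = completed_line E L"
        using a(1) aff by (auto simp: lns_completion)
      then have "g b = b" if "b \<in> L" for b
        using a(3) that sub L(1) unfolding completed_line_def
        by (metis Pow_iff extension_Inl image_eqI insertI2 subset_iff sum.inject(1))
      then show ?thesis using L a(2) by (auto simp: completed_line_def)
    qed
    then show "?center \<and> (?inf \<or> ?aff)" using cen a(3) fixes_line_at_infinity_iff by metis
  next
    assume h: "?center \<and> (?inf \<or> ?aff)"
    from h show "\<exists>a. elation (completion E) (Inr C) a (extension E g)"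
    proof (elim conjE disjE)
      assume ?inf
      then have "elation (completion E) (Inr C) (line_at_infinity E) (extension E g)"
        using h extension_aut[OF sub g] C
        unfolding elation_def center_condition_iff[OF sub g] fixes_line_at_infinity_iff
        by (simp add: lns_completion line_at_infinity_def)
      then show ?thesis by blast
    next
      assume ?aff
      then obtain L where L: "L \<in> lns E" "parallel_class E L = C" "\<forall>a\<in>L. g a = a" by blast
      \<comment> \<open>The axis also contains its point at infinity, which is the center
        \<open>C\<close>. It is fixed because \<open>g\<close> stabilizes the line \<open>L\<close>
        of that class.\<close>
      have "(\<lambda>M. g ` M) ` C = C"
        using image_parallel_class[OF sub g L(1)] h L(1,2) by simp
      moreover have "L \<subseteq> pts E" using L(1) sub by blast
      ultimately have "\<forall>z\<in>completed_line E L. extension E g z = z"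
        using L(2,3) C by (auto simp: completed_line_def subset_iff)
      moreover have on_line: "completed_line E L \<in> lns (completion E)" "Inr C \<in> completed_line E L"
        using L(1,2) by (simp_all add: lns_completion) (simp add: completed_line_def)
      ultimately have "elation (completion E) (Inr C) (completed_line E L) (extension E g)"
        using conjunct1[OF h] extension_aut[OF sub g] on_line
        unfolding elation_def center_condition_iff[OF sub g] by simp
      then show ?thesis by blast
    qed
  qed
  show ?thesis
    unfolding central_elation_set_def mem_Collect_eq by (rule conj_cong[OF refl *])
qed

section \<open>Coordinates on the affine plane\<close>

text \<open>The desarguesian plane with labelled points, detached from the quadrangle. Nothing is
  assumed about what the points are, so the computation of H(l) depends on the labels alone; the
  vertical class will be the distinguished \<open>l\<close>.\<close>

locale coordinatized_plane =
  fixes E :: "'b geometry" and P :: "'k::{field,finite} \<Rightarrow> 'k \<Rightarrow> 'b"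
  assumes P_eq_iff [simp]: "P a b = P a' b' \<longleftrightarrow> a = a' \<and> b = b'"
    and pts_E: "pts E = {P a b | a b. True}"
    and lns_E: "lns E = {range (P a) | a. True} \<union> {range (\<lambda>a. P a (m * a + k)) | m k. True}"
begin

definition vline :: "'k \<Rightarrow> 'b set" where
  "vline a = range (P a)"

definition sline :: "'k \<Rightarrow> 'k \<Rightarrow> 'b set" where
  "sline m k = range (\<lambda>a. P a (m * a + k))"

lemma P_pts [simp]: "P a b \<in> pts E"
  by (auto simp: pts_E)

lemma lns_eq: "lns E = range vline \<union> {sline m k | m k. True}"
  by (auto simp: lns_E vline_def sline_def)

lemma lns_sub: "lns E \<subseteq> Pow (pts E)"
  by (auto simp: lns_E)

lemma P_mem_vline [simp]: "P a b \<in> vline a' \<longleftrightarrow> a = a'"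
  by (auto simp: vline_def)

lemma P_mem_sline [simp]: "P a b \<in> sline m k \<longleftrightarrow> b = m * a + k"
  by (auto simp: sline_def)

lemma in_ptsE: "X \<in> pts E \<Longrightarrow> (\<And>a b. X = P a b \<Longrightarrow> thesis) \<Longrightarrow> thesis"
  by (auto simp: pts_E)

lemma ball_lns: "(\<forall>L\<in>lns E. Q L) \<longleftrightarrow> (\<forall>a. Q (vline a)) \<and> (\<forall>m k. Q (sline m k))"
  by (auto simp: lns_eq)

lemma sline_sub: "sline m k \<subseteq> pts E"
  by (auto simp: sline_def)

lemma in_vlineE: "X \<in> vline a \<Longrightarrow> (\<And>b. X = P a b \<Longrightarrow> thesis) \<Longrightarrow> thesis"
  by (auto simp: vline_def)

lemma in_slineE: "X \<in> sline m k \<Longrightarrow> (\<And>a. X = P a (m * a + k) \<Longrightarrow> thesis) \<Longrightarrow> thesis"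
  by (auto simp: sline_def)

lemma vline_eq_iff [simp]: "vline a = vline a' \<longleftrightarrow> a = a'"
  by (metis P_mem_vline)

lemma sline_eq_iff [simp]: "sline m k = sline m' k' \<longleftrightarrow> m = m' \<and> k = k'"
proof
  assume eq: "sline m k = sline m' k'"
  have "k = k'" using eq P_mem_sline[of 0 k m k] P_mem_sline[of 0 k m' k'] by simp
  moreover have "m + k = m' + k'"
    using eq P_mem_sline[of 1 "m + k" m k] P_mem_sline[of 1 "m + k" m' k'] by simp
  ultimately show "m = m' \<and> k = k'" by simp
qed simp

lemma vline_neq_sline [simp]: "vline a \<noteq> sline m k" "sline m k \<noteq> vline a"
proof -
  have "P (a + 1) (m * (a + 1) + k) \<in> sline m k" "P (a + 1) (m * (a + 1) + k) \<notin> vline a" by simp_all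
  then show "vline a \<noteq> sline m k" "sline m k \<noteq> vline a" by metis+
qed

lemma vline_disjoint: "vline a \<inter> vline a' = {} \<longleftrightarrow> a \<noteq> a'"
  by (auto simp: vline_def)

lemma vline_meets_sline: "vline a \<inter> sline m k \<noteq> {}" "sline m k \<inter> vline a \<noteq> {}"
  using P_mem_sline[of a "m * a + k" m k] P_mem_vline[of a "m * a + k" a] by blast+

lemma sline_disjoint: "sline m k \<inter> sline m' k' = {} \<longleftrightarrow> m = m' \<and> k \<noteq> k'"
proof (cases "m = m'")
  case False
  let ?a = "(k' - k) / (m - m')"
  have "m * ?a + k = m' * ?a + k'" using False by (simp add: field_simps)
  then have "P ?a (m * ?a + k) \<in> sline m k \<inter> sline m' k'" by simp
  then show ?thesis using False by blast
qed (auto simp: sline_def)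

definition vclass :: "'b set set" where
  "vclass = range vline"

definition sclass :: "'k \<Rightarrow> 'b set set" where
  "sclass m = range (sline m)"

lemma parallel_class_vline [simp]: "parallel_class E (vline a) = vclass"
proof -
  have "vline a' = vline a \<or> vline a' \<inter> vline a = {}" for a' by (simp add: vline_disjoint)
  then show ?thesis
    using vline_meets_sline(2) vline_neq_sline(2) unfolding parallel_class_def lns_eq vclass_def by blast
qed

lemma parallel_class_sline [simp]: "parallel_class E (sline m k) = sclass m"
proof -
  have "sline m' k' = sline m k \<or> sline m' k' \<inter> sline m k = {} \<longleftrightarrow> m' = m" for m' k'
    by (auto simp: sline_disjoint)
  then show ?thesis
    using vline_meets_sline(1) vline_neq_sline(1) unfolding parallel_class_def lns_eq sclass_def by blast
qed

lemma vclass_neq_sclass [simp]: "vclass \<noteq> sclass m" "sclass m \<noteq> vclass"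
  unfolding vclass_def sclass_def by (metis rangeI rangeE vline_neq_sline)+

lemma sclass_eq_iff [simp]: "sclass m = sclass m' \<longleftrightarrow> m = m'"
  unfolding sclass_def by (metis rangeI rangeE sline_eq_iff)

lemma points_at_infinity_eq: "points_at_infinity E = insert vclass (range sclass)"
proof -
  have "points_at_infinity E = parallel_class E ` range vline \<union> parallel_class E ` {sline m k | m k. True}"
    unfolding points_at_infinity_def lns_eq by (rule image_Un)
  also have "parallel_class E ` range vline = {vclass}" by (simp add: image_image)
  also have "parallel_class E ` {sline m k | m k. True} = range sclass"
    by (auto simp: image_iff) (metis parallel_class_sline)
  finally show ?thesis by simp
qed

text \<open>These maps turn out to form H(l): \<open>\<alpha>\<close> translates across the vertical
  lines, \<open>d\<close> along them, and \<open>c\<close> is the slope of a shear fixing every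
  vertical line.\<close>

definition aff :: "'k \<Rightarrow> 'k \<Rightarrow> 'k \<Rightarrow> 'b \<Rightarrow> 'b" where
  "aff \<alpha> c d = (\<lambda>X\<in>pts E. THE Y. \<exists>a b. X = P a b \<and> Y = P (a + \<alpha>) (b + c * a + d))"

lemma aff_P [simp]: "aff \<alpha> c d (P a b) = P (a + \<alpha>) (b + c * a + d)"
  unfolding aff_def by (auto intro!: the_equality)

lemma aff_extensional: "aff \<alpha> c d \<in> extensional (pts E)"
  by (simp add: aff_def)

lemma ext_P:
  assumes "g \<in> extensional (pts E)" "h \<in> extensional (pts E)" "\<And>a b. g (P a b) = h (P a b)"
  shows "g = h"
  using assms by (intro extensionalityI[of g "pts E"]) (auto simp: pts_E)

lemma aff_eq_iff [simp]: "aff \<alpha> c d = aff \<alpha>' c' d' \<longleftrightarrow> \<alpha> = \<alpha>' \<and> c = c' \<and> d = d'"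
proof
  assume eq: "aff \<alpha> c d = aff \<alpha>' c' d'"
  have "P \<alpha> d = P \<alpha>' d'" using arg_cong[OF eq, of "\<lambda>g. g (P 0 0)"] by simp
  moreover have "P (1 + \<alpha>) (c + d) = P (1 + \<alpha>') (c' + d')"
    using arg_cong[OF eq, of "\<lambda>g. g (P 1 0)"] by simp
  ultimately show "\<alpha> = \<alpha>' \<and> c = c' \<and> d = d'" by simp
qed simp

text \<open>The cross term \<open>c' * \<alpha>\<close> is the Heisenberg cocycle, the only
  obstruction to commutativity.\<close>

lemma compose_aff:
  "compose (pts E) (aff \<alpha>' c' d') (aff \<alpha> c d) = aff (\<alpha> + \<alpha>') (c + c') (d + d' + c' * \<alpha>)"
  by (rule ext_P) (auto simp: aff_extensional compose_def algebra_simps)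

lemma aff_vline [simp]: "aff \<alpha> c d ` vline a = vline (a + \<alpha>)"
proof -
  have "P (a + \<alpha>) b \<in> aff \<alpha> c d ` vline a" for b
    by (rule image_eqI[of _ _ "P a (b - c * a - d)"]) simp_all
  then show ?thesis by (auto elim!: in_vlineE)
qed

lemma aff_sline [simp]: "aff \<alpha> c d ` sline m k = sline (m + c) (k + d - (m + c) * \<alpha>)"
proof (intro equalityI subsetI)
  fix X assume "X \<in> aff \<alpha> c d ` sline m k"
  then show "X \<in> sline (m + c) (k + d - (m + c) * \<alpha>)"
    by (auto elim!: in_slineE simp: algebra_simps)
next
  fix X assume "X \<in> sline (m + c) (k + d - (m + c) * \<alpha>)"
  then obtain a where "X = P a ((m + c) * a + (k + d - (m + c) * \<alpha>))" by (rule in_slineE)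
  then have "X = aff \<alpha> c d (P (a - \<alpha>) (m * (a - \<alpha>) + k))" by (simp add: algebra_simps)
  moreover have "P (a - \<alpha>) (m * (a - \<alpha>) + k) \<in> sline m k" by simp
  ultimately show "X \<in> aff \<alpha> c d ` sline m k" by (rule image_eqI)
qed

lemma aff_aut: "aff \<alpha> c d \<in> aut E"
\<comment> \<open>The third parameter \<open>c * \<alpha> - d\<close> of the inverse is
  \<open>- d\<close> corrected by the cross term of the composition.\<close>
proof (rule autI[OF lns_sub aff_extensional, where h = "aff (- \<alpha>) (- c) (c * \<alpha> - d)"])
  fix L assume "L \<in> lns E"
  then show "aff \<alpha> c d ` L \<in> lns E" "aff (- \<alpha>) (- c) (c * \<alpha> - d) ` L \<in> lns E"
    by (auto simp: lns_eq)
qed (auto elim!: in_ptsE simp: algebra_simps)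

lemma aff_Bij: "aff \<alpha> c d \<in> Bij (pts E)"
  using aff_aut aut_subset_Bij by blast

lemma aff_mult [simp]:
  "aff \<alpha>' c' d' \<otimes>\<^bsub>perm_group E S\<^esub> aff \<alpha> c d = aff (\<alpha> + \<alpha>') (c + c') (d + d' + c' * \<alpha>)"
  by (simp only: perm_group_mult[OF aff_Bij aff_Bij] compose_aff)

lemma aff_mult_BijGroup [simp]:
  "aff \<alpha>' c' d' \<otimes>\<^bsub>BijGroup (pts E)\<^esub> aff \<alpha> c d = aff (\<alpha> + \<alpha>') (c + c') (d + d' + c' * \<alpha>)"
  using aff_mult by simp

lemma aff_one: "\<one>\<^bsub>perm_group E S\<^esub> = aff 0 0 0"
  by (rule ext_P) (simp_all add: BijGroup_def aff_extensional)

section \<open>Translations and elations with center \<open>vclass\<close> in coordinates\<close>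

lemma aff_translation: "aff \<alpha> 0 d \<in> translation_set E"
proof -
  have inf: "(\<lambda>L. aff \<alpha> 0 d ` L) ` D = D" if D: "D \<in> points_at_infinity E" for D
  proof -
    obtain L where L: "L \<in> lns E" "D = parallel_class E L"
      using D by (auto simp: points_at_infinity_def)
    then show ?thesis
      using image_parallel_class[OF lns_sub aff_aut L(1)] by (auto simp: lns_eq)
  qed
  have cen: "\<exists>C\<in>points_at_infinity E. \<forall>L\<in>lns E. parallel_class E L = C \<longrightarrow> aff \<alpha> 0 d ` L = L"
  \<comment> \<open>The center is the direction of the vector (\<open>\<alpha>\<close>,
    \<open>d\<close>): vertical, or of slope \<open>d / \<alpha>\<close>.\<close>
  proof (cases "\<alpha> = 0")
    case True
    then show ?thesis
      by (intro bexI[of _ vclass]) (auto simp: ball_lns points_at_infinity_eq)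
  next
    case False
    then show ?thesis
      by (intro bexI[of _ "sclass (d / \<alpha>)"]) (auto simp: ball_lns points_at_infinity_eq)
  qed
  show ?thesis
    unfolding translation_set_iff[OF lns_sub] by (intro conjI aff_aut cen ballI inf)
qed

text \<open>Fixing the vertical and the horizontal class makes \<open>g\<close> act on the two
  coordinates separately, by \<open>f\<close> and by \<open>s 0\<close>. The other slopes tie these
  functions together through \<open>line\<close>, and the lines through the center, each stabilized,
  provide the values from which both are seen to be shifts.\<close>

lemma translation_aff:
  assumes g: "g \<in> translation_set E"
  shows "\<exists>\<alpha> d. g = aff \<alpha> 0 d"
proof -
  note iff = g[unfolded translation_set_iff[OF lns_sub]]
  have aut: "g \<in> aut E" by (rule conjunct1[OF iff])
  have inf: "(\<lambda>L. g ` L) ` D = D" if "D \<in> points_at_infinity E" for D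
    by (rule bspec[OF conjunct1[OF conjunct2[OF iff]] that])
  obtain C where C: "C \<in> points_at_infinity E"
    and fixC: "\<And>L. L \<in> lns E \<Longrightarrow> parallel_class E L = C \<Longrightarrow> g ` L = L"
    using conjunct2[OF conjunct2[OF iff]] by (elim bexE) simp
  have inf': "g ` L \<in> D" if "D \<in> points_at_infinity E" "L \<in> D" for D L
    using imageI[OF that(2), of "(`) g"] unfolding inf[OF that(1)] .
  have "\<forall>a. \<exists>a'. g ` vline a = vline a'"
  proof
    fix a
    have "g ` vline a \<in> vclass"
      by (rule inf') (simp_all add: points_at_infinity_eq vclass_def)
    then show "\<exists>a'. g ` vline a = vline a'" by (auto simp: vclass_def)
  qed
  then obtain f where f: "\<And>a. g ` vline a = vline (f a)" by metis
  have "\<forall>m k. \<exists>k'. g ` sline m k = sline m k'"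
  proof (intro allI)
    fix m k
    have "g ` sline m k \<in> sclass m"
      by (rule inf') (simp_all add: points_at_infinity_eq sclass_def)
    then show "\<exists>k'. g ` sline m k = sline m k'" by (auto simp: sclass_def)
  qed
  then obtain s where s: "\<And>m k. g ` sline m k = sline m (s m k)" by metis
  have gP: "g (P a b) = P (f a) (s 0 b)" for a b
  proof -
    have "g (P a b) \<in> vline (f a)" "g (P a b) \<in> sline 0 (s 0 b)"
      unfolding f[symmetric] s[symmetric] by simp_all
    then show ?thesis by (auto elim: in_vlineE)
  qed
  have line: "s 0 (m * a + k) = m * f a + s m k" for m a k
  proof -
    have "g (P a (m * a + k)) \<in> sline m (s m k)" unfolding s[symmetric] by simp
    then show ?thesis by (simp add: gP)
  qed
  have "\<exists>\<alpha> d. (\<forall>a. f a = a + \<alpha>) \<and> (\<forall>b. s 0 b = b + d)"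
  proof (cases "C = vclass")
    case True
    then have fa: "f a = a" for a using fixC[of "vline a"] f[of a] by (simp add: lns_eq)
    have "s 0 b = b + s 1 0" for b
      using line[of 1 b 0] fa[of b] by simp
    then show ?thesis using fa by (metis add_0_right)
  next
    case False
    then obtain m where m: "C = sclass m" using C by (auto simp: points_at_infinity_eq)
    have sm: "s m k = k" for k
      using fixC[of "sline m k"] s[of m k] m by (auto simp: lns_eq)
    \<comment> \<open>The point with coordinates \<open>a\<close> and \<open>(m + 1) * a\<close>
      lies on the stabilized line of slope \<open>m\<close> with intercept \<open>a\<close> and on
      the line of slope \<open>m + 1\<close> through the origin; the two expressions for the second
      coordinate of its image are compared.\<close>
    have fa: "f a = a + (- s (m + 1) 0)" for a
      using line[of m a a] line[of "m + 1" a 0] sm[of a] by (simp add: algebra_simps)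
    moreover have "s 0 b = b + m * (- s (m + 1) 0)" for b
      using line[of m 0 b] sm[of b] fa[of 0] by simp
    ultimately show ?thesis by blast
  qed
  then obtain \<alpha> d where "\<And>a. f a = a + \<alpha>" "\<And>b. s 0 b = b + d" by blast
  then have "g = aff \<alpha> 0 d"
    using aut_extensional[OF aut] aff_extensional by (intro ext_P) (auto simp: gP)
  then show ?thesis by blast
qed

lemma translation_set_eq: "translation_set E = {aff \<alpha> 0 d | \<alpha> d. True}"
  using aff_translation translation_aff by blast

lemma vclass_at_infinity: "vclass \<in> points_at_infinity E"
  by (simp add: points_at_infinity_eq)

lemma aff_central: "aff 0 c d \<in> central_elation_set E vclass"
proof -
  have "\<forall>L\<in>lns E. parallel_class E L = vclass \<longrightarrow> aff 0 c d ` L = L" by (simp add: ball_lns)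
  moreover have "(\<forall>D\<in>points_at_infinity E. (\<lambda>L. aff 0 c d ` L) ` D = D) \<or>
     (\<exists>L\<in>lns E. parallel_class E L = vclass \<and> (\<forall>X\<in>L. aff 0 c d X = X))"
  proof (cases "c = 0")
    case True
    then show ?thesis
      using conjunct1[OF conjunct2[OF aff_translation[of 0 d, unfolded translation_set_iff[OF lns_sub]]]]
      by simp
  next
    case False
    \<comment> \<open>The axis is the vertical line on which the displacement
      \<open>c * a + d\<close> vanishes.\<close>
    then have "\<forall>X\<in>vline (- d / c). aff 0 c d X = X" by (auto elim!: in_vlineE)
    then show ?thesis by (intro disjI2 bexI[of _ "vline (- d / c)"]) (auto simp: lns_eq)
  qed
  ultimately show ?thesis
    unfolding central_elation_set_iff[OF lns_sub vclass_at_infinity] using aff_aut by simp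
qed

text \<open>For an affine axis \<open>a0\<close>, horizontal lines are followed. Their images
  contain points with different first coordinates, so are not vertical; images of disjoint lines are
  disjoint, so all have the same slope; the fixed points on the axis then determine the intercepts.
  The axis at infinity is covered by the translations.\<close>

lemma central_aff:
  assumes g: "g \<in> central_elation_set E vclass"
  shows "\<exists>c d. g = aff 0 c d"
proof -
  have aut: "g \<in> aut E"
    and fixV: "\<And>L. L \<in> lns E \<Longrightarrow> parallel_class E L = vclass \<Longrightarrow> g ` L = L"
    and axis: "(\<forall>D\<in>points_at_infinity E. (\<lambda>L. g ` L) ` D = D) \<or>
     (\<exists>L\<in>lns E. parallel_class E L = vclass \<and> (\<forall>X\<in>L. g X = X))"
    using g unfolding central_elation_set_iff[OF lns_sub vclass_at_infinity] by blast+
  have vl: "g ` vline a = vline a" for a using fixV[of "vline a"] by (simp add: lns_eq)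
  have "\<forall>a b. \<exists>b'. g (P a b) = P a b'"
  proof (intro allI)
    fix a b
    have "g (P a b) \<in> g ` vline a" by (rule imageI) simp
    then have "g (P a b) \<in> vline a" unfolding vl .
    then show "\<exists>b'. g (P a b) = P a b'" by (auto elim: in_vlineE)
  qed
  then obtain h where h: "\<And>a b. g (P a b) = P a (h a b)" by metis
  from axis show ?thesis
  proof
    assume inf: "\<forall>D\<in>points_at_infinity E. (\<lambda>L. g ` L) ` D = D"
    then have "g \<in> translation_set E"
      unfolding translation_set_iff[OF lns_sub]
      by (intro conjI bexI[OF _ vclass_at_infinity] ballI impI aut fixV inf)
    then obtain \<alpha> d where eq: "g = aff \<alpha> 0 d" using translation_aff by blast
    then have "\<alpha> = 0" using h[of 0 0] by simp
    then show ?thesis using eq by blast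
  next
    assume "\<exists>L\<in>lns E. parallel_class E L = vclass \<and> (\<forall>X\<in>L. g X = X)"
    then obtain a0 where "\<forall>X\<in>vline a0. g X = X" by (auto simp: lns_eq)
    then have a0: "h a0 b = b" for b using h[of a0 b] by simp
    have "\<forall>k. \<exists>m k'. g ` sline 0 k = sline m k'"
    proof
      fix k
      have "P 0 (h 0 k) \<in> g ` sline 0 k" "P 1 (h 1 k) \<in> g ` sline 0 k"
        unfolding h[symmetric] by simp_all
      then have "g ` sline 0 k \<noteq> vline a" for a
        using P_mem_vline[of 0 "h 0 k" a] P_mem_vline[of 1 "h 1 k" a] zero_neq_one by metis
      moreover have "g ` sline 0 k \<in> lns E" by (rule aut_line[OF aut]) (auto simp: lns_eq)
      ultimately show "\<exists>m k'. g ` sline 0 k = sline m k'" by (auto simp: lns_eq)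
    qed
    then obtain m s where ms: "\<And>k. g ` sline 0 k = sline (m k) (s k)" by metis
    have hk: "h a k = m k * a + s k" for a k
    proof -
      have "g (P a k) \<in> sline (m k) (s k)" unfolding ms[symmetric] by simp
      then show ?thesis by (simp add: h)
    qed
    have m0: "m k = m 0" for k
    proof (cases "k = 0")
      case False
      have "g ` sline 0 k \<inter> g ` sline 0 0 = g ` (sline 0 k \<inter> sline 0 0)"
        by (rule inj_on_image_Int[OF aut_inj_on[OF aut] sline_sub sline_sub, symmetric])
      also have "\<dots> = {}" using sline_disjoint[of 0 k 0 0] False by simp
      finally show ?thesis by (simp add: ms sline_disjoint)
    qed simp
    have "h a b = b + m 0 * a + (- m 0 * a0)" for a b
      using hk[of a b] hk[of a0 b] a0[of b] m0[of b] by (simp add: algebra_simps)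
    then have "g = aff 0 (m 0) (- m 0 * a0)"
      using aut_extensional[OF aut] aff_extensional by (intro ext_P) (simp_all add: h)
    then show ?thesis by blast
  qed
qed

lemma central_elation_set_eq: "central_elation_set E vclass = {aff 0 c d | c d. True}"
  using aff_central central_aff by blast

section \<open>The group generated by translations and central elations\<close>

abbreviation H :: "('b \<Rightarrow> 'b) monoid" where
  "H \<equiv> H_group E vclass"

lemma carrier_H: "carrier H = {aff \<alpha> c d | \<alpha> c d. True}"
proof -
  let ?A = "{aff \<alpha> c d | \<alpha> c d. True}"
  interpret aut: group "aut_group E" by (rule group_aut_group[OF lns_sub])
  have "subgroup ?A (aut_group E)"
  proof (rule aut.subgroupI)
    show "?A \<subseteq> carrier (aut_group E)" using aff_aut by auto
    show "?A \<noteq> {}" by blast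
    fix g assume "g \<in> ?A"
    then obtain \<alpha> c d where g: "g = aff \<alpha> c d" by blast
    have "inv\<^bsub>aut_group E\<^esub> g = aff (- \<alpha>) (- c) (c * \<alpha> - d)"
      unfolding g by (rule aut.inv_equality) (use aff_aut aff_one in auto)
    then show "inv\<^bsub>aut_group E\<^esub> g \<in> ?A" by blast
  next
    fix g h assume "g \<in> ?A" "h \<in> ?A"
    then show "g \<otimes>\<^bsub>aut_group E\<^esub> h \<in> ?A" by auto
  qed
  moreover have "translation_set E \<union> central_elation_set E vclass \<subseteq> ?A"
    by (auto simp: translation_set_eq central_elation_set_eq)
  ultimately have "generate (aut_group E) (translation_set E \<union> central_elation_set E vclass) \<subseteq> ?A"
    by (rule aut.generate_subgroup_incl[rotated])
  moreover have "aff \<alpha> c d \<in> generate (aut_group E) (translation_set E \<union> central_elation_set E vclass)"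
    for \<alpha> c d
  proof -
    have "aff \<alpha> 0 0 \<otimes>\<^bsub>aut_group E\<^esub> aff 0 c d
        \<in> generate (aut_group E) (translation_set E \<union> central_elation_set E vclass)"
      by (rule generate.eng; rule generate.incl) (simp_all add: aff_translation aff_central)
    then show ?thesis by simp
  qed
  ultimately show ?thesis by (auto simp: H_group_def)
qed

lemma H_mult [simp]:
  "aff \<alpha>' c' d' \<otimes>\<^bsub>H\<^esub> aff \<alpha> c d = aff (\<alpha> + \<alpha>') (c + c') (d + d' + c' * \<alpha>)"
  unfolding H_group_def by (rule aff_mult)

lemma center_H: "center H = {aff 0 0 d | d. True}"
proof -
  have "\<alpha> = 0 \<and> c = 0" if "aff \<alpha> c d \<in> center H" for \<alpha> c d
  proof -
    \<comment> \<open>Commuting with a pure shear forces \<open>\<alpha>\<close> to vanish, and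
      commuting with a translation across the vertical lines forces \<open>c\<close> to
      vanish.\<close>
    have "aff 0 1 0 \<otimes>\<^bsub>H\<^esub> aff \<alpha> c d = aff \<alpha> c d \<otimes>\<^bsub>H\<^esub> aff 0 1 0"
      "aff 1 0 0 \<otimes>\<^bsub>H\<^esub> aff \<alpha> c d = aff \<alpha> c d \<otimes>\<^bsub>H\<^esub> aff 1 0 0"
      using that carrier_H unfolding center_def by blast+
    then show ?thesis by simp
  qed
  moreover have "center H \<subseteq> carrier H" by (auto simp: center_def)
  ultimately have "center H \<subseteq> {aff 0 0 d | d. True}"
    unfolding carrier_H by blast
  moreover have "aff 0 0 d \<in> center H" for d
    by (auto simp: center_def carrier_H add.commute)
  ultimately show ?thesis by blast
qed

section \<open>The quotient of H(l) by its center, coordinatized by pairs (\<open>\<alpha>\<close>,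
  \<open>c\<close>) under addition\<close>

definition coset :: "'k \<Rightarrow> 'k \<Rightarrow> ('b \<Rightarrow> 'b) set" where
  "coset \<alpha> c = range (aff \<alpha> c)"

lemma coset_eq_iff [simp]: "coset \<alpha> c = coset \<alpha>' c' \<longleftrightarrow> \<alpha> = \<alpha>' \<and> c = c'"
proof
  assume eq: "coset \<alpha> c = coset \<alpha>' c'"
  have "aff \<alpha> c 0 \<in> coset \<alpha> c" by (auto simp: coset_def)
  then show "\<alpha> = \<alpha>' \<and> c = c'" unfolding eq by (auto simp: coset_def)
qed simp

text \<open>The carrier \<open>S\<close> is left arbitrary because cosets are formed both in H(l)
  and in the group of translations contained in T, with the same multiplication.\<close>

lemma r_coset_aff: "coset 0 0 #>\<^bsub>perm_group E S\<^esub> aff \<alpha> c d = coset \<alpha> c"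
proof -
  have "coset 0 0 #>\<^bsub>perm_group E S\<^esub> aff \<alpha> c d = range (\<lambda>d'. aff \<alpha> c (d + d'))"
    unfolding r_coset_def coset_def by auto
  moreover have "aff \<alpha> c d' = aff \<alpha> c (d + (d' - d))" for d' by simp
  ultimately show ?thesis unfolding coset_def by blast
qed

lemma set_mult_coset:
  "coset \<alpha> c <#>\<^bsub>perm_group E S\<^esub> coset \<alpha>' c' = coset (\<alpha> + \<alpha>') (c + c')"
proof (intro equalityI subsetI)
  fix x assume "x \<in> coset \<alpha> c <#>\<^bsub>perm_group E S\<^esub> coset \<alpha>' c'"
  then show "x \<in> coset (\<alpha> + \<alpha>') (c + c')"
    by (auto simp: set_mult_def coset_def add.commute)
next
  fix x assume "x \<in> coset (\<alpha> + \<alpha>') (c + c')"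
  then obtain d where "x = aff (\<alpha> + \<alpha>') (c + c') d" by (auto simp: coset_def)
  then have "x = aff \<alpha> c 0 \<otimes>\<^bsub>perm_group E S\<^esub> aff \<alpha>' c' (d - c * \<alpha>')"
    by (simp add: add.commute)
  then show "x \<in> coset \<alpha> c <#>\<^bsub>perm_group E S\<^esub> coset \<alpha>' c'"
    unfolding set_mult_def coset_def by blast
qed

lemma center_H_coset: "center H = coset 0 0"
  by (auto simp: center_H coset_def)

lemma r_coset_H: "coset 0 0 #>\<^bsub>H\<^esub> aff \<alpha> c d = coset \<alpha> c"
  unfolding H_group_def by (rule r_coset_aff)

lemma set_mult_H: "coset \<alpha> c <#>\<^bsub>H\<^esub> coset \<alpha>' c' = coset (\<alpha> + \<alpha>') (c + c')"
  unfolding H_group_def by (rule set_mult_coset)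

lemma carrier_H_Mod: "carrier (H Mod coset 0 0) = {coset \<alpha> c | \<alpha> c. True}"
proof -
  have "carrier (H Mod coset 0 0) = {coset 0 0 #>\<^bsub>H\<^esub> aff \<alpha> c d | \<alpha> c d. True}"
    unfolding carrier_FactGroup carrier_H by blast
  then show ?thesis unfolding r_coset_H by blast
qed

lemma group_H_Mod: "group (H Mod coset 0 0)"
proof (rule groupI)
  fix x assume "x \<in> carrier (H Mod coset 0 0)"
  then obtain \<alpha> c where "x = coset \<alpha> c" using carrier_H_Mod by blast
  then show "\<exists>y\<in>carrier (H Mod coset 0 0). y \<otimes>\<^bsub>H Mod coset 0 0\<^esub> x = \<one>\<^bsub>H Mod coset 0 0\<^esub>"
    unfolding carrier_H_Mod by (intro bexI[of _ "coset (- \<alpha>) (- c)"]) (auto simp: set_mult_H)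
qed (auto simp: carrier_H_Mod set_mult_H add.assoc)

text \<open>As a set \<open>R\<close> of pairs, \<open>U\<close> meets the image of the central
  elations trivially exactly when no pair (0, \<open>c\<close>) with nonzero \<open>c\<close>
  occurs; differences then show that \<open>\<alpha>\<close> determines \<open>c\<close>. Having
  \<open>q\<close> elements, \<open>R\<close> reaches every \<open>\<alpha>\<close>, so it is the
  graph of a function, and closure under the group operation makes that function additive.\<close>

lemma BB_graph:
  assumes "U \<in> BB (CARD('k)) E vclass"
  shows "\<exists>g. (\<forall>a b. g (a + b) = g a + g b) \<and>
    H_preimage E vclass U = {aff \<alpha> (g \<alpha>) d | \<alpha> d. True}"
proof -
  interpret Q: group "H Mod coset 0 0" by (rule group_H_Mod)
  have sub: "subgroup U (H Mod coset 0 0)" and cardU: "card U = CARD('k)"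
    and meet: "U \<inter> (\<lambda>b. coset 0 0 #>\<^bsub>H\<^esub> b) ` central_elation_set E vclass = {coset 0 0}"
    using assms by (auto simp: BB_def Let_def center_H_coset)
  define R where "R = {(\<alpha>, c). coset \<alpha> c \<in> U}"
  have "U = (\<lambda>(\<alpha>, c). coset \<alpha> c) ` R"
    using subgroup.subset[OF sub] by (auto simp: R_def carrier_H_Mod)
  moreover have "inj_on (\<lambda>(\<alpha>, c). coset \<alpha> c) R" by (auto simp: inj_on_def)
  ultimately have cardR: "card R = CARD('k)" using cardU by (simp add: card_image)
  have add: "(\<alpha> + \<alpha>', c + c') \<in> R" if "(\<alpha>, c) \<in> R" "(\<alpha>', c') \<in> R" for \<alpha> c \<alpha>' c'
    using subgroup.m_closed[OF sub, of "coset \<alpha> c" "coset \<alpha>' c'"] that by (simp add: R_def set_mult_H)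
  have neg: "(- \<alpha>, - c) \<in> R" if "(\<alpha>, c) \<in> R" for \<alpha> c
  proof -
    have "inv\<^bsub>H Mod coset 0 0\<^esub> coset \<alpha> c = coset (- \<alpha>) (- c)"
    proof (rule Q.inv_equality)
      show "coset (- \<alpha>) (- c) \<otimes>\<^bsub>H Mod coset 0 0\<^esub> coset \<alpha> c = \<one>\<^bsub>H Mod coset 0 0\<^esub>"
        by (simp add: set_mult_H)
    qed (unfold carrier_H_Mod, blast+)
    then show ?thesis using subgroup.m_inv_closed[OF sub, of "coset \<alpha> c"] that by (simp add: R_def)
  qed
  have zero: "c = 0" if "(0, c) \<in> R" for c
  proof -
    have "coset 0 c \<in> (\<lambda>b. coset 0 0 #>\<^bsub>H\<^esub> b) ` central_elation_set E vclass"
      by (rule image_eqI[of _ _ "aff 0 c 0"]) (simp_all add: r_coset_H aff_central)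
    then have "coset 0 c = coset 0 0" using that meet by (auto simp: R_def simp del: coset_eq_iff)
    then show ?thesis by simp
  qed
  have unique: "c = c'" if "(\<alpha>, c) \<in> R" "(\<alpha>, c') \<in> R" for \<alpha> c c'
    using zero[of "c - c'"] add[OF that(1) neg[OF that(2)]] by simp
  then have "inj_on fst R" by (auto simp: inj_on_def)
  then have "card (fst ` R) = CARD('k)" using cardR by (simp add: card_image)
  then have "fst ` R = UNIV" by (simp add: card_subset_eq)
  have "\<exists>c. (\<alpha>, c) \<in> R" for \<alpha>
  proof -
    have "\<alpha> \<in> fst ` R" using \<open>fst ` R = UNIV\<close> by simp
    then show ?thesis by auto
  qed
  then obtain g where g: "\<And>\<alpha>. (\<alpha>, g \<alpha>) \<in> R" by metis
  then have Rg: "(\<alpha>, c) \<in> R \<longleftrightarrow> c = g \<alpha>" for \<alpha> c using unique by blast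
  have "g (a + b) = g a + g b" for a b
    using add[OF g[of a] g[of b]] Rg by simp
  moreover have "H_preimage E vclass U = {aff \<alpha> (g \<alpha>) d | \<alpha> d. True}"
  proof -
    have "center H #>\<^bsub>H\<^esub> aff \<alpha> c d \<in> U \<longleftrightarrow> c = g \<alpha>" for \<alpha> c d
      using Rg[of \<alpha> c] by (simp add: center_H_coset r_coset_H R_def)
    then show ?thesis unfolding H_preimage_def Let_def carrier_H by auto
  qed
  ultimately show ?thesis by blast
qed

text \<open>A map in T is a translation if its shear part \<open>g \<alpha>\<close> vanishes;
  dividing out the vertical translations removes \<open>d\<close> and leaves only
  \<open>\<alpha>\<close>.\<close>

lemma nu0_space_iso:
  assumes add: "\<And>a b. g (a + b) = g a + g b"
    and T: "T = {aff \<alpha> (g \<alpha>) d | \<alpha> d. True}"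
  shows "add_group {a. g a = 0} \<cong> nu0_space E vclass T" "monoid (nu0_space E vclass T)"
proof -
  have g0: "g 0 = 0" using add[of 0 0] by (metis add.right_neutral add_left_cancel)
  have TA: "T \<inter> translation_set E = {aff \<alpha> 0 d | \<alpha> d. g \<alpha> = 0}"
    by (auto simp: T translation_set_eq)
  have AB: "translation_set E \<inter> central_elation_set E vclass = coset 0 0"
    by (auto simp: coset_def translation_set_eq central_elation_set_eq)
  have car: "carrier (nu0_space E vclass T) = {coset \<alpha> 0 | \<alpha>. g \<alpha> = 0}"
  proof -
    have "carrier (nu0_space E vclass T) =
        {coset 0 0 #>\<^bsub>perm_group E {aff \<alpha> 0 d | \<alpha> d. g \<alpha> = 0}\<^esub> aff \<alpha> 0 d | \<alpha> d. g \<alpha> = 0}"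
      unfolding nu0_space_def AB carrier_FactGroup TA by auto
    then show ?thesis unfolding r_coset_aff by blast
  qed
  have mul: "coset \<alpha> c \<otimes>\<^bsub>nu0_space E vclass T\<^esub> coset \<alpha>' c' = coset (\<alpha> + \<alpha>') (c + c')"
    for \<alpha> c \<alpha>' c'
    unfolding nu0_space_def mult_FactGroup by (rule set_mult_coset)
  have one: "\<one>\<^bsub>nu0_space E vclass T\<^esub> = coset 0 0" by (simp add: nu0_space_def AB)
  show "monoid (nu0_space E vclass T)"
    by (rule monoidI) (auto simp: car mul one add g0 add.assoc)
  show "add_group {a. g a = 0} \<cong> nu0_space E vclass T"
    by (rule is_isoI[of "\<lambda>\<alpha>. coset \<alpha> 0"])
      (auto simp: iso_def hom_def bij_betw_def inj_on_def car mul image_iff)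
qed

end

section \<open>Points and lines of the symplectic quadrangle\<close>

abbreviation point :: "'k::field ^ 4 \<Rightarrow> ('k ^ 4) set" where
  "point v \<equiv> vec.span {v}"

lemma symp_form_add_left: "symp_form (u + v) w = symp_form u w + symp_form v w"
  and symp_form_add_right: "symp_form w (u + v) = symp_form w u + symp_form w v"
  and symp_form_scale_left: "symp_form (k *s u) w = k * symp_form u w"
  and symp_form_scale_right: "symp_form w (k *s u) = k * symp_form w u"
  by (simp_all add: symp_form_def algebra_simps)

lemma symp_form_diff_left: "symp_form (u - v) w = symp_form u w - symp_form v w"
  and symp_form_diff_right: "symp_form w (u - v) = symp_form w u - symp_form w v"
  by (simp_all add: symp_form_def algebra_simps)

lemma symp_form_self [simp]: "symp_form v v = 0"
  by (simp add: symp_form_def algebra_simps)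

lemma symp_form_swap: "symp_form v w = - symp_form w v"
  by (simp add: symp_form_def algebra_simps)

lemma symp_form_zero [simp]: "symp_form 0 v = 0" "symp_form v 0 = 0"
  by (simp_all add: symp_form_def)

lemma symp_form_nondegenerate:
  fixes v :: "'k::field ^ 4"
  assumes "v \<noteq> 0"
  shows "\<exists>w. symp_form w v = 1"
proof -
  have "\<exists>w. symp_form w v \<noteq> 0"
  proof (rule ccontr)
    assume "\<not> ?thesis"
    then have z: "symp_form w v = 0" for w by blast
    have "v $ i = 0" for i
      using z[of "axis 1 1"] z[of "axis 2 1"] z[of "axis 3 1"] z[of "axis 4 1"] exhaust_4[of i]
      by (auto simp: symp_form_def axis_def)
    then show False using assms by (simp add: vec_eq_iff)
  qed
  then obtain w where "symp_form w v \<noteq> 0" by blast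
  then show ?thesis by (intro exI[of _ "(1 / symp_form w v) *s w"]) (simp add: symp_form_scale_left)
qed

lemma mem_point_iff: "w \<in> point v \<longleftrightarrow> (\<exists>k. w = k *s v)"
  by (auto simp: vec.span_singleton)

lemma point_subset_iff: "vec.subspace V \<Longrightarrow> point v \<subseteq> V \<longleftrightarrow> v \<in> V"
  using vec.span_minimal[of "{v}" V] vec.span_base[of v "{v}"] by auto

lemma point_scale: "k \<noteq> 0 \<Longrightarrow> point (k *s v) = point v"
proof -
  assume "k \<noteq> 0"
  then have "v = (1 / k) *s (k *s v)" by (simp add: vec.scale_scale)
  then have "v \<in> point (k *s v)" unfolding mem_point_iff by blast
  moreover have "k *s v \<in> point v" unfolding mem_point_iff by blast
  ultimately show ?thesis by (simp add: point_subset_iff antisym)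
qed

lemma point_eqD: "point v = point w \<Longrightarrow> \<exists>k. v = k *s w"
  using vec.span_base[of v "{v}"] mem_point_iff[of v w] by simp

lemma W_points_eq: "W_points = {point v | v :: 'k::field ^ 4. v \<noteq> 0}"
proof (intro equalityI subsetI)
  fix P :: "('k ^ 4) set" assume "P \<in> W_points"
  then have P: "vec.subspace P" "vec.dim P = 1" by (simp_all add: W_points_def)
  obtain B where B: "B \<subseteq> P" "vec.independent B" "P \<subseteq> vec.span B" "card B = vec.dim P"
    using vec.basis_exists[of P] by blast
  then obtain v where v: "B = {v}" using P by (auto simp: card_1_singleton_iff)
  then have "v \<noteq> 0" using B vec.dependent_zero by blast
  moreover have "P = point v" using B v P point_subset_iff[of P v] by auto
  ultimately show "P \<in> {point v | v. v \<noteq> 0}" by blast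
next
  fix P :: "('k ^ 4) set" assume "P \<in> {point v | v. v \<noteq> 0}"
  then show "P \<in> W_points" by (auto simp: W_points_def)
qed

lemma pts_W [simp]: "pts W_quadrangle = W_points"
  by (simp add: W_quadrangle_def)

lemma point_mem_W_points [simp]: "point v \<in> W_points \<longleftrightarrow> v \<noteq> 0"
  by (simp add: W_points_def)

lemma lns_W_sub: "lns W_quadrangle \<subseteq> Pow (pts W_quadrangle)"
  by (auto simp: W_quadrangle_def)

section \<open>Totally isotropic planes and collinearity in terms of the form\<close>

definition points_of :: "('k::field ^ 4) set \<Rightarrow> ('k ^ 4) set set" where
  "points_of V = {P \<in> W_points. P \<subseteq> V}"

definition ti_plane :: "('k::field ^ 4) set \<Rightarrow> bool" where
  "ti_plane V \<longleftrightarrow>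
    vec.subspace V \<and> vec.dim V = 2 \<and> (\<forall>u\<in>V. \<forall>v\<in>V. symp_form u v = 0)"

lemma lns_W: "lns W_quadrangle = {points_of V | V. ti_plane V}"
  by (simp add: W_quadrangle_def points_of_def ti_plane_def)

lemma points_of_eq: "vec.subspace V \<Longrightarrow> points_of V = {point v | v. v \<noteq> 0 \<and> v \<in> V}"
  unfolding points_of_def W_points_eq using point_subset_iff by blast

lemma point_mem_points_of:
  "vec.subspace V \<Longrightarrow> point v \<in> points_of V \<longleftrightarrow> v \<noteq> 0 \<and> v \<in> V"
  by (simp add: points_of_def point_subset_iff)

lemma ti_plane_span:
  assumes "v \<noteq> 0" "w \<notin> point v" "symp_form v w = 0"
  shows "ti_plane (vec.span {w, v})"
proof -
  have "vec.independent {w, v}"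
    using assms by (intro vec.independent_insertI) (simp_all add: vec.independent_empty)
  moreover have "w \<noteq> v" using assms(2) vec.span_base[of v "{v}"] by auto
  ultimately have "vec.dim (vec.span {w, v}) = 2"
    by (simp add: vec.dim_eq_card_independent)
  moreover have "symp_form x y = 0" if xy: "x \<in> vec.span {w, v}" "y \<in> vec.span {w, v}" for x y
  proof -
    have ex: "\<exists>a b. x = a *s w + b *s v" if "x \<in> vec.span {w, v}" for x
    proof -
      have "\<exists>k. x - k *s w \<in> vec.span {v}" using that vec.span_breakdown_eq[of x w "{v}"] by simp
      then obtain k where "x - k *s w \<in> vec.span {v}" by (elim exE)
      then obtain j where "x - k *s w = j *s v" unfolding mem_point_iff by blast
      then have "x = k *s w + j *s v" by (simp add: algebra_simps)
      then show ?thesis by blast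
    qed
    obtain a b where x: "x = a *s w + b *s v" using ex[OF xy(1)] by blast
    obtain c d where y: "y = c *s w + d *s v" using ex[OF xy(2)] by blast
    show ?thesis
      unfolding x y using assms(3) symp_form_swap[of w v]
      by (simp add: symp_form_add_left symp_form_add_right symp_form_scale_left symp_form_scale_right)
  qed
  ultimately show ?thesis by (simp add: ti_plane_def)
qed

text \<open>Collinearity asks for a common line even when the two points coincide, so every point
  must lie on some line. If \<open>v\<close> has nonzero components in both hyperbolic pairs, its
  truncation to the first pair is orthogonal to \<open>v\<close> without being a multiple of it;
  otherwise a basis vector of the pair in which \<open>v\<close> vanishes will do.\<close>

lemma ex_orthogonal:
  fixes v :: "'k::field ^ 4"
  shows "\<exists>w. w \<notin> point v \<and> symp_form v w = 0"
proof -
  consider "v $ 1 = 0 \<and> v $ 2 = 0" | "v $ 3 = 0 \<and> v $ 4 = 0"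
    | "(v $ 1 \<noteq> 0 \<or> v $ 2 \<noteq> 0) \<and> (v $ 3 \<noteq> 0 \<or> v $ 4 \<noteq> 0)" by blast
  then show ?thesis
  proof cases
    case 1
    then have "axis 1 1 \<notin> point v" by (auto simp: mem_point_iff vec_eq_iff axis_def)
    then show ?thesis using 1 by (intro exI[of _ "axis 1 1"]) (simp add: symp_form_def axis_def)
  next
    case 2
    then have "axis 3 1 \<notin> point v" by (auto simp: mem_point_iff vec_eq_iff axis_def)
    then show ?thesis using 2 by (intro exI[of _ "axis 3 1"]) (simp add: symp_form_def axis_def)
  next
    case 3
    define w :: "'k ^ 4" where "w = (\<chi> i. if i = 1 \<or> i = 2 then v $ i else 0)"
    have w: "w $ 1 = v $ 1" "w $ 2 = v $ 2" "w $ 3 = 0" "w $ 4 = 0" by (simp_all add: w_def)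
    have "w \<notin> point v"
    proof
      assume "w \<in> point v"
      then obtain k where "w = k *s v" unfolding mem_point_iff by blast
      then have "w $ i = k * v $ i" for i by simp
      then have "k * v $ 3 = 0" "k * v $ 4 = 0" "v $ 1 = k * v $ 1" "v $ 2 = k * v $ 2"
        using w by metis+
      then show False using 3 by auto
    qed
    moreover have "symp_form v w = 0" by (simp add: symp_form_def w)
    ultimately show ?thesis by blast
  qed
qed

lemma collin_W:
  fixes v w :: "'k::field ^ 4"
  assumes v: "v \<noteq> 0" and w: "w \<noteq> 0"
  shows "collin W_quadrangle (point v) (point w) \<longleftrightarrow> symp_form v w = 0"
proof
  assume "collin W_quadrangle (point v) (point w)"
  then obtain V where V: "ti_plane V" "point v \<in> points_of V" "point w \<in> points_of V"
    by (auto simp: collin_def lns_W)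
  then have "v \<in> V" "w \<in> V" by (simp_all add: ti_plane_def point_mem_points_of)
  then show "symp_form v w = 0" using V(1) by (simp add: ti_plane_def)
next
  assume 0: "symp_form v w = 0"
  have line: "\<exists>L\<in>lns W_quadrangle. point v \<in> L \<and> point u \<in> L"
    if "u \<notin> point v" "symp_form v u = 0" for u
  proof -
    have "u \<noteq> 0" using that(1) vec.span_zero by metis
    then have "point v \<in> points_of (vec.span {u, v})" "point u \<in> points_of (vec.span {u, v})"
      using v by (simp_all add: point_mem_points_of vec.span_base)
    then show ?thesis using ti_plane_span[OF v that] unfolding lns_W by blast
  qed
  show "collin W_quadrangle (point v) (point w)"
  proof (cases "w \<in> point v")
    case True
    then obtain k where k: "w = k *s v" unfolding mem_point_iff by blast
    then have "point w = point v" using w point_scale[of k v] by (cases "k = 0") auto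
    then show ?thesis using ex_orthogonal[of v] line unfolding collin_def by metis
  next
    case False
    then show ?thesis using line[OF False 0] by (simp add: collin_def)
  qed
qed

lemma point_mem_perp:
  assumes "\<And>u. u \<in> X \<Longrightarrow> u \<noteq> 0" and "v \<noteq> 0"
  shows "point v \<in> perp W_quadrangle (point ` X) \<longleftrightarrow> (\<forall>u\<in>X. symp_form u v = 0)"
  using assms collin_W by (auto simp: perp_def)

lemma perp_W_sub: "perp W_quadrangle X \<subseteq> W_points"
  by (auto simp: perp_def)

section \<open>Symplectic coordinates\<close>

text \<open>The vector \<open>e\<close> spans the center of the Payne derivation, \<open>f\<close> spans the point chosen as
  origin, and \<open>w\<close> spans a line of the affine plane in the chosen parallel class.\<close>

locale symplectic_frame =
  fixes e f u w :: "'k::{field,finite} ^ 4"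
  assumes ef: "symp_form e f = 1" and uw: "symp_form u w = 1"
    and eu: "symp_form e u = 0" and ew: "symp_form e w = 0"
    and fu: "symp_form f u = 0" and fw: "symp_form f w = 0"
begin

definition cv :: "'k \<Rightarrow> 'k \<Rightarrow> 'k \<Rightarrow> 'k \<Rightarrow> 'k ^ 4" where
  "cv s y a b = s *s e + y *s f + a *s u + b *s w"

lemma cv_add: "cv s y a b + cv s' y' a' b' = cv (s + s') (y + y') (a + a') (b + b')"
  by (simp add: cv_def vec_eq_iff algebra_simps)

lemma cv_scale: "k *s cv s y a b = cv (k * s) (k * y) (k * a) (k * b)"
  by (simp add: cv_def vec_eq_iff algebra_simps)

lemma cv_e: "cv 1 0 0 0 = e" and cv_f: "cv 0 1 0 0 = f" and cv_u: "cv 0 0 1 0 = u"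
  and cv_w: "cv 0 0 0 1 = w" and cv_zero: "cv 0 0 0 0 = 0"
  by (simp_all add: cv_def)

lemma form_cv: "symp_form (cv s y a b) (cv s' y' a' b') = s * y' - y * s' + a * b' - b * a'"
proof -
  have "symp_form f e = -1" "symp_form w u = -1" "symp_form u e = 0" "symp_form w e = 0"
    "symp_form u f = 0" "symp_form w f = 0"
    using ef uw eu ew fu fw symp_form_swap by (metis minus_zero)+
  then show ?thesis
    by (simp add: cv_def symp_form_add_left symp_form_add_right symp_form_scale_left
        symp_form_scale_right ef uw eu ew fu fw)
qed

lemma cv_eq_iff: "cv s y a b = cv s' y' a' b' \<longleftrightarrow> s = s' \<and> y = y' \<and> a = a' \<and> b = b'"
proof
  assume eq: "cv s y a b = cv s' y' a' b'"
  have "symp_form (cv s y a b) v = symp_form (cv s' y' a' b') v" for v by (simp add: eq)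
  from this[of "cv 0 1 0 0"] this[of "cv 1 0 0 0"] this[of "cv 0 0 0 1"] this[of "cv 0 0 1 0"]
  show "s = s' \<and> y = y' \<and> a = a' \<and> b = b'" by (simp add: form_cv)
qed simp

lemma cv_eq_zero_iff: "cv s y a b = 0 \<longleftrightarrow> s = 0 \<and> y = 0 \<and> a = 0 \<and> b = 0"
  using cv_eq_iff[of s y a b 0 0 0 0] by (simp add: cv_zero)

text \<open>Spanning follows by counting instead of a basis argument: the form recovers the four
  coordinates, so the coordinate map is an injection of the finite space into itself.\<close>

lemma cv_cases:
  obtains s y a b where "v = cv s y a b"
proof -
  define \<psi> where "\<psi> v = cv (v $ 1) (v $ 2) (v $ 3) (v $ 4)" for v :: "'k ^ 4"
  have "inj \<psi>"
  proof (rule injI)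
    fix x y :: "'k ^ 4" assume "\<psi> x = \<psi> y"
    then have "\<forall>i. x $ i = y $ i" unfolding forall_4 \<psi>_def cv_eq_iff by simp
    then show "x = y" by (simp add: vec_eq_iff)
  qed
  then have "surj \<psi>" by (rule finite_UNIV_inj_surj[OF finite])
  then obtain x where "v = \<psi> x" by blast
  then show ?thesis using that by (simp add: \<psi>_def)
qed

lemma form_e: "symp_form e (cv s y a b) = y" and form_f: "symp_form f (cv s y a b) = - s"
  using form_cv[of 1 0 0 0 s y a b] form_cv[of 0 1 0 0 s y a b] by (simp_all add: cv_e cv_f)

lemma e_nonzero [simp]: "e \<noteq> 0" and f_nonzero [simp]: "f \<noteq> 0"
  using ef by auto

abbreviation x :: "('k ^ 4) set" where "x \<equiv> point e"

text \<open>Noncollinearity with \<open>x\<close> means that the coordinate at \<open>f\<close> is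
  nonzero, so it can be normalized to 1.\<close>

definition pt :: "'k \<Rightarrow> 'k \<Rightarrow> 'k \<Rightarrow> ('k ^ 4) set" where
  "pt s a b = point (cv s 1 a b)"

lemma pt_eq_iff [simp]: "pt s a b = pt s' a' b' \<longleftrightarrow> s = s' \<and> a = a' \<and> b = b'"
proof
  assume "pt s a b = pt s' a' b'"
  then obtain k where "cv s 1 a b = k *s cv s' 1 a' b'" unfolding pt_def by (blast dest: point_eqD)
  then show "s = s' \<and> a = a' \<and> b = b'" by (auto simp: cv_scale cv_eq_iff)
qed simp

lemma pt_scale: "y \<noteq> 0 \<Longrightarrow> point (cv s y a b) = pt (s / y) (a / y) (b / y)"
  using point_scale[of "1 / y" "cv s y a b"] by (simp add: pt_def cv_scale)

lemma mem_perp_x: "v \<noteq> 0 \<Longrightarrow> point v \<in> perp W_quadrangle {x} \<longleftrightarrow> symp_form e v = 0"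
  using point_mem_perp[of "{e}" v] by simp

lemma pts_payne: "pts (payne W_quadrangle x) = {pt s a b | s a b. True}"
proof (intro equalityI subsetI)
  fix P assume "P \<in> pts (payne W_quadrangle x)"
  then have P: "P \<in> W_points" "P \<notin> perp W_quadrangle {x}" by (simp_all add: payne_def)
  then obtain v where v: "P = point v" "v \<noteq> 0" by (auto simp: W_points_eq)
  obtain s y a b where c: "v = cv s y a b" by (rule cv_cases)
  have "y \<noteq> 0" using P(2) v mem_perp_x[of v] by (simp add: c form_e)
  then show "P \<in> {pt s a b | s a b. True}" using v pt_scale c by blast
next
  fix P assume "P \<in> {pt s a b | s a b. True}"
  then obtain s a b where P: "P = point (cv s 1 a b)" by (auto simp: pt_def)
  have "cv s 1 a b \<noteq> 0" by (simp add: cv_eq_zero_iff)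
  then show "P \<in> pts (payne W_quadrangle x)"
    using mem_perp_x[of "cv s 1 a b"] by (simp add: P payne_def form_e)
qed

lemma noncollinear_x: "{z \<in> W_points. \<not> collin W_quadrangle x z} = {pt s a b | s a b. True}"
  using pts_payne by (auto simp: payne_def perp_def)

text \<open>Orthogonality to \<open>e\<close> removes the coordinate at \<open>f\<close>, and
  orthogonality to \<open>cv s 1 a b\<close> then forces the coordinate
  \<open>a * \<beta> - b * \<alpha>\<close> at \<open>e\<close>. The parameter \<open>s\<close> does
  not occur: points on one hyperbolic line through \<open>x\<close> give the same point of the
  plane.\<close>

definition PP :: "'k \<Rightarrow> 'k \<Rightarrow> ('k ^ 4) set set" where
  "PP a b = {point (cv (a * \<beta> - b * \<alpha>) 0 \<alpha> \<beta>) | \<alpha> \<beta>. \<alpha> \<noteq> 0 \<or> \<beta> \<noteq> 0}"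

lemma perp_x_pt: "perp W_quadrangle {x, pt s a b} = PP a b"
proof (intro equalityI subsetI)
  fix P assume P: "P \<in> perp W_quadrangle {x, pt s a b}"
  then obtain v where v: "P = point v" "v \<noteq> 0" using perp_W_sub by (auto simp: W_points_eq)
  obtain t y \<alpha> \<beta> where c: "v = cv t y \<alpha> \<beta>" by (rule cv_cases)
  have "u \<noteq> 0" if "u \<in> {e, cv s 1 a b}" for u using that by (auto simp: cv_eq_zero_iff)
  then have "symp_form e v = 0" "symp_form (cv s 1 a b) v = 0"
    using P v(1) point_mem_perp[OF _ v(2), of "{e, cv s 1 a b}"] by (simp_all add: pt_def)
  then have "y = 0" "t = a * \<beta> - b * \<alpha>" by (auto simp: c form_e form_cv algebra_simps)
  moreover have "\<alpha> \<noteq> 0 \<or> \<beta> \<noteq> 0" using v(2) calculation by (auto simp: c cv_eq_zero_iff)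
  ultimately show "P \<in> PP a b" unfolding v c PP_def by blast
next
  fix P assume "P \<in> PP a b"
  then obtain \<alpha> \<beta> where P: "P = point (cv (a * \<beta> - b * \<alpha>) 0 \<alpha> \<beta>)" "\<alpha> \<noteq> 0 \<or> \<beta> \<noteq> 0"
    by (auto simp: PP_def)
  have "u \<noteq> 0" if "u \<in> {e, cv s 1 a b}" for u using that by (auto simp: cv_eq_zero_iff)
  then show "P \<in> perp W_quadrangle {x, pt s a b}"
    using P point_mem_perp[of "{e, cv s 1 a b}" "cv (a * \<beta> - b * \<alpha>) 0 \<alpha> \<beta>"]
    by (simp add: pt_def cv_eq_zero_iff form_e form_cv)
qed

lemma point_mem_PP:
  assumes "\<alpha> \<noteq> 0 \<or> \<beta> \<noteq> 0"
  shows "point (cv t 0 \<alpha> \<beta>) \<in> PP a b \<longleftrightarrow> t = a * \<beta> - b * \<alpha>"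
proof
  assume "point (cv t 0 \<alpha> \<beta>) \<in> PP a b"
  then obtain \<alpha>' \<beta>' where "point (cv t 0 \<alpha> \<beta>) = point (cv (a * \<beta>' - b * \<alpha>') 0 \<alpha>' \<beta>')"
    by (auto simp: PP_def)
  then obtain k where "cv t 0 \<alpha> \<beta> = k *s cv (a * \<beta>' - b * \<alpha>') 0 \<alpha>' \<beta>'" by (blast dest: point_eqD)
  then show "t = a * \<beta> - b * \<alpha>" by (simp add: cv_scale cv_eq_iff algebra_simps)
qed (use assms in \<open>auto simp: PP_def\<close>)

lemma PP_eq_iff [simp]: "PP a b = PP a' b' \<longleftrightarrow> a = a' \<and> b = b'"
proof
  assume eq: "PP a b = PP a' b'"
  have "point (cv a 0 0 1) \<in> PP a b" "point (cv (- b) 0 1 0) \<in> PP a b" by (simp_all add: point_mem_PP)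
  then show "a = a' \<and> b = b'" unfolding eq by (simp add: point_mem_PP)
qed simp

lemma pts_plane: "pts (plane W_quadrangle x) = {PP a b | a b. True}"
proof -
  have "pts (plane W_quadrangle x) = (\<lambda>z. perp W_quadrangle {x, z}) ` {z \<in> W_points. \<not> collin W_quadrangle x z}"
    by (auto simp: plane_def)
  also have "\<dots> = {PP a b | a b. True}"
  proof -
    have "(\<lambda>z. perp W_quadrangle {x, z}) ` {pt s a b | s a b. True} =
        {perp W_quadrangle {x, pt s a b} | s a b. True}" by blast
    then show ?thesis unfolding noncollinear_x perp_x_pt by simp
  qed
  finally show ?thesis .
qed

lemma perp_x_minus: "perp W_quadrangle {x} - {x} = {point (cv t 0 \<alpha> \<beta>) | t \<alpha> \<beta>. \<alpha> \<noteq> 0 \<or> \<beta> \<noteq> 0}"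
proof (intro equalityI subsetI)
  fix P assume P: "P \<in> perp W_quadrangle {x} - {x}"
  then obtain v where v: "P = point v" "v \<noteq> 0" using perp_W_sub by (auto simp: W_points_eq)
  obtain t y \<alpha> \<beta> where c: "v = cv t y \<alpha> \<beta>" by (rule cv_cases)
  have y: "y = 0" using P v mem_perp_x[of v] by (simp add: c form_e)
  have "\<alpha> \<noteq> 0 \<or> \<beta> \<noteq> 0"
  proof (rule ccontr)
    assume "\<not> ?thesis"
    then have "v = t *s e" using y c by (simp add: cv_def)
    then show False using P v point_scale[of t e] by (cases "t = 0") auto
  qed
  then show "P \<in> {point (cv t 0 \<alpha> \<beta>) | t \<alpha> \<beta>. \<alpha> \<noteq> 0 \<or> \<beta> \<noteq> 0}" using v c y by blast
next
  fix P assume "P \<in> {point (cv t 0 \<alpha> \<beta>) | t \<alpha> \<beta>. \<alpha> \<noteq> 0 \<or> \<beta> \<noteq> 0}"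
  then obtain t \<alpha> \<beta> where P: "P = point (cv t 0 \<alpha> \<beta>)" and nz: "\<alpha> \<noteq> 0 \<or> \<beta> \<noteq> 0" by blast
  have "P \<noteq> x"
  proof
    assume "P = x"
    then obtain k where "cv t 0 \<alpha> \<beta> = k *s cv 1 0 0 0" unfolding P by (auto dest: point_eqD simp: cv_e)
    then show False using nz by (simp add: cv_scale cv_eq_iff)
  qed
  then show "P \<in> perp W_quadrangle {x} - {x}"
    using nz mem_perp_x[of "cv t 0 \<alpha> \<beta>"] by (auto simp: P cv_eq_zero_iff form_e)
qed

text \<open>Incidence with the point having coordinates \<open>t\<close>, 0,
  \<open>\<alpha>\<close>, \<open>\<beta>\<close> is the linear equation
  \<open>t = a * \<beta> - b * \<alpha>\<close> in \<open>a\<close> and \<open>b\<close>, which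
  describes a vertical line for \<open>\<alpha> = 0\<close> and a line of slope
  \<open>\<beta> / \<alpha>\<close> otherwise.\<close>

lemma lns_plane:
  "lns (plane W_quadrangle x) =
    {range (PP a) | a. True} \<union> {range (\<lambda>a. PP a (m * a + k)) | m k. True}"
proof -
  have line: "{X \<in> pts (plane W_quadrangle x). point (cv t 0 \<alpha> \<beta>) \<in> X} =
      {PP a b | a b. t = a * \<beta> - b * \<alpha>}" if "\<alpha> \<noteq> 0 \<or> \<beta> \<noteq> 0" for t \<alpha> \<beta>
    using point_mem_PP[OF that] by (auto simp: pts_plane)
  have vert: "{PP a b | a b. t = a * \<beta> - b * 0} = range (PP (t / \<beta>))" if "\<beta> \<noteq> 0" for t \<beta>
    using that by (auto simp: field_simps)
  have slope: "{PP a b | a b. t = a * \<beta> - b * \<alpha>} = range (\<lambda>a. PP a ((\<beta> / \<alpha>) * a + (- t / \<alpha>)))"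
    if "\<alpha> \<noteq> 0" for t \<alpha> \<beta>
  proof -
    have "t = a * \<beta> - b * \<alpha> \<longleftrightarrow> b = (\<beta> / \<alpha>) * a + (- t / \<alpha>)" for a b
      using that by (auto simp: field_simps)
    then show ?thesis by auto
  qed
  have "lns (plane W_quadrangle x) =
      {{X \<in> pts (plane W_quadrangle x). point (cv t 0 \<alpha> \<beta>) \<in> X} | t \<alpha> \<beta>. \<alpha> \<noteq> 0 \<or> \<beta> \<noteq> 0}"
  proof -
    have "lns (plane W_quadrangle x) =
        (\<lambda>y. {X \<in> pts (plane W_quadrangle x). y \<in> X}) ` (perp W_quadrangle {x} - {x})"
      by (auto simp: plane_def Let_def)
    then show ?thesis unfolding perp_x_minus by auto
  qed
  also have "\<dots> = {{PP a b | a b. t = a * \<beta> - b * \<alpha>} | t \<alpha> \<beta>. \<alpha> \<noteq> 0 \<or> \<beta> \<noteq> 0}"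
  proof (intro Collect_cong iff_exI)
    fix L t \<alpha> \<beta>
    show "(L = {X \<in> pts (plane W_quadrangle x). point (cv t 0 \<alpha> \<beta>) \<in> X} \<and> (\<alpha> \<noteq> 0 \<or> \<beta> \<noteq> 0)) \<longleftrightarrow>
        (L = {PP a b | a b. t = a * \<beta> - b * \<alpha>} \<and> (\<alpha> \<noteq> 0 \<or> \<beta> \<noteq> 0))"
      by (cases "\<alpha> \<noteq> 0 \<or> \<beta> \<noteq> 0") (simp_all add: line)
  qed
  also have "\<dots> = {range (PP a) | a. True} \<union> {range (\<lambda>a. PP a (m * a + k)) | m k. True}" (is "?A = ?B")
  proof (intro equalityI subsetI)
    fix L assume "L \<in> ?A"
    then obtain t \<alpha> \<beta> where L: "L = {PP a b | a b. t = a * \<beta> - b * \<alpha>}" "\<alpha> \<noteq> 0 \<or> \<beta> \<noteq> 0" by blast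
    show "L \<in> ?B"
    proof (cases "\<alpha> = 0")
      case True
      then have "L = range (PP (t / \<beta>))" using L vert[of \<beta> t] by simp
      then show ?thesis by (intro UnI1 CollectI exI conjI TrueI)
    next
      case False
      have "L = range (\<lambda>a. PP a ((\<beta> / \<alpha>) * a + (- t / \<alpha>)))"
        using L(1) slope[OF False, of t \<beta>] by (rule trans)
      then show ?thesis by (intro UnI2 CollectI exI conjI TrueI)
    qed
  next
    fix L assume "L \<in> ?B"
    then consider a where "L = range (PP a)" | m k where "L = range (\<lambda>a. PP a (m * a + k))" by blast
    then show "L \<in> ?A"
    proof cases
      case 1
      have "L = {PP a' b | a' b. a = a' * 1 - b * 0}" using vert[of 1 a] 1 by simp
      then show ?thesis by (intro CollectI exI[of _ a] exI[of _ 0] exI[of _ 1]) simp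
    next
      case 2
      have "L = {PP a b | a b. - k = a * m - b * 1}" using slope[of 1 "- k" m] 2 by simp
      then show ?thesis by (intro CollectI exI[of _ "- k"] exI[of _ 1] exI[of _ m]) simp
    qed
  qed
  finally show ?thesis .
qed

sublocale plane: coordinatized_plane "plane W_quadrangle x" PP
  by unfold_locales (auto simp: PP_eq_iff pts_plane lns_plane)

section \<open>Automorphisms of the quadrangle inducing affine maps\<close>

text \<open>The isometry fixing \<open>e\<close> and sending \<open>f\<close> to
  \<open>\<sigma> e + f + \<alpha> u + d w\<close>, \<open>u\<close> to
  \<open>(\<alpha> c - d) e + u + c w\<close> and \<open>w\<close> to \<open>\<alpha> e + w\<close>.
  The coefficients of \<open>e\<close> in the last two images are forced by orthogonality to the
  image of \<open>f\<close>; \<open>\<sigma>\<close> remains free and accounts for the symmetries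
  with center \<open>x\<close>. Coordinates are read off with the form.\<close>

definition \<tau> :: "'k \<Rightarrow> 'k \<Rightarrow> 'k \<Rightarrow> 'k \<Rightarrow> 'k ^ 4 \<Rightarrow> 'k ^ 4" where
  "\<tau> \<sigma> \<alpha> c d v =
    (let s = symp_form v f; y = symp_form e v; a = symp_form v w; b = symp_form u v
     in cv (s + y * \<sigma> + a * (\<alpha> * c - d) + b * \<alpha>) y (a + y * \<alpha>) (b + c * a + y * d))"

lemma \<tau>_cv: "\<tau> \<sigma> \<alpha> c d (cv s y a b) =
    cv (s + y * \<sigma> + a * (\<alpha> * c - d) + b * \<alpha>) y (a + y * \<alpha>) (b + c * a + y * d)"
proof -
  have "symp_form (cv s y a b) f = s" "symp_form (cv s y a b) w = a" "symp_form u (cv s y a b) = b"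
    using form_cv[of s y a b 0 1 0 0] form_cv[of s y a b 0 0 0 1] form_cv[of 0 0 1 0 s y a b]
    by (simp_all add: cv_f cv_w cv_u)
  then show ?thesis by (simp add: \<tau>_def form_e)
qed

lemma \<tau>_linear: "Vector_Spaces.linear (*s) (*s) (\<tau> \<sigma> \<alpha> c d)"
proof -
  have "\<tau> \<sigma> \<alpha> c d (v + v') = \<tau> \<sigma> \<alpha> c d v + \<tau> \<sigma> \<alpha> c d v'" for v v'
    by (rule cv_cases[of v], rule cv_cases[of v']) (simp add: cv_add \<tau>_cv cv_eq_iff algebra_simps)
  moreover have "\<tau> \<sigma> \<alpha> c d (k *s v) = k *s \<tau> \<sigma> \<alpha> c d v" for k v
    by (rule cv_cases[of v]) (simp add: cv_scale \<tau>_cv cv_eq_iff algebra_simps)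
  ultimately show ?thesis by (simp add: Vector_Spaces.linear_iff vec.vector_space_axioms)
qed

lemma form_\<tau>: "symp_form (\<tau> \<sigma> \<alpha> c d v) (\<tau> \<sigma> \<alpha> c d v') = symp_form v v'"
  by (rule cv_cases[of v], rule cv_cases[of v']) (simp add: \<tau>_cv form_cv algebra_simps)

lemma \<tau>_inverse:
  "\<tau> (- \<sigma>) (- \<alpha>) (- c) (\<alpha> * c - d) (\<tau> \<sigma> \<alpha> c d v) = v"
  "\<tau> \<sigma> \<alpha> c d (\<tau> (- \<sigma>) (- \<alpha>) (- c) (\<alpha> * c - d) v) = v"
  by (rule cv_cases[of v], simp add: \<tau>_cv cv_eq_iff algebra_simps)+

lemma inj_\<tau>: "inj (\<tau> \<sigma> \<alpha> c d)"
  using \<tau>_inverse(1) by (metis injI)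

lemma \<tau>_point: "\<tau> \<sigma> \<alpha> c d ` point v = point (\<tau> \<sigma> \<alpha> c d v)"
  using vec.linear_span_image[OF \<tau>_linear, of \<sigma> \<alpha> c d "{v}"] by simp

lemma \<tau>_ti_plane:
  assumes "ti_plane V"
  shows "ti_plane (\<tau> \<sigma> \<alpha> c d ` V)"
proof -
  have "vec.subspace (\<tau> \<sigma> \<alpha> c d ` V)"
    using assms by (intro vec.linear_subspace_image[OF \<tau>_linear]) (simp add: ti_plane_def)
  moreover have "vec.dim (\<tau> \<sigma> \<alpha> c d ` V) = 2"
    using vec.dim_image_eq[OF \<tau>_linear inj_on_subset[OF inj_\<tau> subset_UNIV]] assms
    by (simp add: ti_plane_def)
  ultimately show ?thesis using assms by (auto simp: ti_plane_def form_\<tau>)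
qed

definition g\<tau> :: "'k \<Rightarrow> 'k \<Rightarrow> 'k \<Rightarrow> 'k \<Rightarrow> ('k ^ 4) set \<Rightarrow> ('k ^ 4) set" where
  "g\<tau> \<sigma> \<alpha> c d = (\<lambda>P\<in>W_points. \<tau> \<sigma> \<alpha> c d ` P)"

lemma \<tau>_eq_zero_iff: "\<tau> \<sigma> \<alpha> c d v = 0 \<longleftrightarrow> v = 0"
proof -
  have "\<tau> \<sigma> \<alpha> c d 0 = 0" using \<tau>_cv[of \<sigma> \<alpha> c d 0 0 0 0] by (simp add: cv_zero)
  then show ?thesis using inj_\<tau> by (metis injD)
qed

lemma g\<tau>_point: "v \<noteq> 0 \<Longrightarrow> g\<tau> \<sigma> \<alpha> c d (point v) = point (\<tau> \<sigma> \<alpha> c d v)"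
  by (simp add: g\<tau>_def \<tau>_point)

lemma g\<tau>_points_of:
  assumes "ti_plane V"
  shows "g\<tau> \<sigma> \<alpha> c d ` points_of V = points_of (\<tau> \<sigma> \<alpha> c d ` V)"
proof -
  have V: "vec.subspace V" "vec.subspace (\<tau> \<sigma> \<alpha> c d ` V)"
    using assms \<tau>_ti_plane by (auto simp: ti_plane_def)
  have "g\<tau> \<sigma> \<alpha> c d ` points_of V = {point (\<tau> \<sigma> \<alpha> c d v) | v. v \<noteq> 0 \<and> v \<in> V}"
    unfolding points_of_eq[OF V(1)] using g\<tau>_point by force
  also have "\<dots> = points_of (\<tau> \<sigma> \<alpha> c d ` V)"
    unfolding points_of_eq[OF V(2)] using \<tau>_eq_zero_iff by blast
  finally show ?thesis .
qed

lemma g\<tau>_line: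
  assumes "L \<in> lns W_quadrangle"
  shows "g\<tau> \<sigma> \<alpha> c d ` L \<in> lns W_quadrangle"
proof -
  obtain V where V: "L = points_of V" "ti_plane V" using assms by (auto simp: lns_W)
  show ?thesis
    unfolding lns_W V(1) g\<tau>_points_of[OF V(2)]
    by (intro CollectI exI[of _ "\<tau> \<sigma> \<alpha> c d ` V"] conjI refl \<tau>_ti_plane V(2))
qed

lemma g\<tau>_aut: "g\<tau> \<sigma> \<alpha> c d \<in> aut W_quadrangle"
proof (rule autI[OF lns_W_sub, where h = "g\<tau> (- \<sigma>) (- \<alpha>) (- c) (\<alpha> * c - d)"])
  show "g\<tau> \<sigma> \<alpha> c d \<in> extensional (pts W_quadrangle)" by (simp add: g\<tau>_def)
  fix P :: "('k ^ 4) set" assume "P \<in> pts W_quadrangle"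
  then obtain v where v: "P = point v" "v \<noteq> 0" by (auto simp: W_points_eq)
  then show "g\<tau> \<sigma> \<alpha> c d P \<in> pts W_quadrangle"
    "g\<tau> (- \<sigma>) (- \<alpha>) (- c) (\<alpha> * c - d) P \<in> pts W_quadrangle"
    "g\<tau> (- \<sigma>) (- \<alpha>) (- c) (\<alpha> * c - d) (g\<tau> \<sigma> \<alpha> c d P) = P"
    "g\<tau> \<sigma> \<alpha> c d (g\<tau> (- \<sigma>) (- \<alpha>) (- c) (\<alpha> * c - d) P) = P"
    by (simp_all add: g\<tau>_point \<tau>_eq_zero_iff \<tau>_inverse)
qed (rule g\<tau>_line, assumption)+

lemma g\<tau>_x: "g\<tau> \<sigma> \<alpha> c d x = x"
  using \<tau>_cv[of \<sigma> \<alpha> c d 1 0 0 0] by (simp add: g\<tau>_point cv_e)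

lemma g\<tau>_pt: "g\<tau> \<sigma> \<alpha> c d (pt s a b) = pt (s + \<sigma> + a * (\<alpha> * c - d) + b * \<alpha>) (a + \<alpha>) (b + c * a + d)"
  by (simp add: pt_def g\<tau>_point cv_eq_zero_iff \<tau>_cv)

text \<open>One inclusion, proved for all parameters, yields the other when applied to the
  parameters of the inverse.\<close>

lemma g\<tau>_PP: "g\<tau> \<sigma> \<alpha> c d ` PP a b = PP (a + \<alpha>) (b + c * a + d)"
proof -
  have sub: "g\<tau> \<sigma> \<alpha> c d ` PP a b \<subseteq> PP (a + \<alpha>) (b + c * a + d)" for \<sigma> \<alpha> c d a b
  proof
    fix P assume "P \<in> g\<tau> \<sigma> \<alpha> c d ` PP a b"
    then obtain \<alpha>' \<beta>' where nz: "\<alpha>' \<noteq> 0 \<or> \<beta>' \<noteq> 0"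
      and P: "P = g\<tau> \<sigma> \<alpha> c d (point (cv (a * \<beta>' - b * \<alpha>') 0 \<alpha>' \<beta>'))" by (auto simp: PP_def)
    have "P = point (cv (a * \<beta>' - b * \<alpha>' + \<alpha>' * (\<alpha> * c - d) + \<beta>' * \<alpha>) 0 \<alpha>' (\<beta>' + c * \<alpha>'))"
      unfolding P using nz by (simp add: g\<tau>_point cv_eq_zero_iff \<tau>_cv)
    moreover have "\<alpha>' \<noteq> 0 \<or> \<beta>' + c * \<alpha>' \<noteq> 0" using nz by auto
    ultimately show "P \<in> PP (a + \<alpha>) (b + c * a + d)"
      by (simp add: point_mem_PP algebra_simps)
  qed
  have "PP (a + \<alpha>) (b + c * a + d) \<subseteq> g\<tau> \<sigma> \<alpha> c d ` PP a b"
  proof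
    fix P assume P: "P \<in> PP (a + \<alpha>) (b + c * a + d)"
    let ?P = "g\<tau> (- \<sigma>) (- \<alpha>) (- c) (\<alpha> * c - d) P"
    have "?P \<in> PP a b"
      using sub[of "- \<sigma>" "- \<alpha>" "- c" "\<alpha> * c - d" "a + \<alpha>" "b + c * a + d"] P
      by (auto simp: algebra_simps)
    moreover have "P \<in> W_points" using P by (auto simp: PP_def cv_eq_zero_iff)
    then obtain v where "P = point v" "v \<noteq> 0" by (auto simp: W_points_eq)
    then have "P = g\<tau> \<sigma> \<alpha> c d ?P" by (simp add: g\<tau>_point \<tau>_eq_zero_iff \<tau>_inverse)
    ultimately show "P \<in> g\<tau> \<sigma> \<alpha> c d ` PP a b" by blast
  qed
  then show ?thesis by (intro equalityI sub)
qed

text \<open>The parameter \<open>\<sigma>\<close> is invisible on the plane, so varying it gives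
  \<open>q\<close> lifts of each affine map. With \<open>\<alpha>\<close> and \<open>d\<close> free
  and \<open>c = g \<alpha>\<close> this produces as many lifts of T as there are points
  \<open>pt s a b\<close>.\<close>

lemma plane_action_g\<tau>: "plane_action W_quadrangle x (g\<tau> \<sigma> \<alpha> c d) = plane.aff \<alpha> c d"
  by (rule plane.ext_P) (simp_all add: plane_action_def plane.aff_extensional g\<tau>_PP)

section \<open>Lines through the origin of the Payne derivation\<close>

definition oline :: "'k \<Rightarrow> 'k \<Rightarrow> ('k ^ 4) set set" where
  "oline a b = {pt 0 (j * a) (j * b) | j. True}"

lemma oline_scale: "k \<noteq> 0 \<Longrightarrow> oline (k * a) (k * b) = oline a b"
proof -
  assume k: "k \<noteq> 0"
  have "pt 0 (j * a) (j * b) = pt 0 (j / k * (k * a)) (j / k * (k * b))" for j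
    using k by simp
  moreover have "pt 0 (j * (k * a)) (j * (k * b)) = pt 0 (j * k * a) (j * k * b)" for j
    by (simp add: mult.assoc)
  ultimately show ?thesis unfolding oline_def by blast
qed

lemma span_f: "v \<in> vec.span {cv 0 0 a b, f} \<longleftrightarrow> (\<exists>j y. v = cv 0 y (j * a) (j * b))"
proof -
  have "v - j *s cv 0 0 a b = y *s f \<longleftrightarrow> v = cv 0 y (j * a) (j * b)" for j y
  proof -
    have "cv 0 y (j * a) (j * b) = y *s f + j *s cv 0 0 a b" by (simp add: cv_def vec_eq_iff algebra_simps)
    then show ?thesis by (simp add: diff_eq_eq)
  qed
  then show ?thesis unfolding vec.span_breakdown_eq[of v "cv 0 0 a b"] mem_point_iff by auto
qed

lemma cv_notin_point_f: "a \<noteq> 0 \<or> b \<noteq> 0 \<Longrightarrow> cv 0 0 a b \<notin> point f"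
proof
  assume nz: "a \<noteq> 0 \<or> b \<noteq> 0" and "cv 0 0 a b \<in> point f"
  then obtain k where "cv 0 0 a b = k *s cv 0 1 0 0" unfolding mem_point_iff cv_f by blast
  then show False using nz by (simp add: cv_scale cv_eq_iff)
qed

lemma oline_eq:
  "points_of (vec.span {cv 0 0 a b, f}) - perp W_quadrangle {x} = oline a b"
proof (intro equalityI subsetI)
  fix P assume "P \<in> points_of (vec.span {cv 0 0 a b, f}) - perp W_quadrangle {x}"
  then obtain v where v: "P = point v" "v \<noteq> 0" "v \<in> vec.span {cv 0 0 a b, f}"
    and np: "point v \<notin> perp W_quadrangle {x}" unfolding points_of_eq[OF vec.subspace_span] by blast
  obtain j y where c: "v = cv 0 y (j * a) (j * b)" using v(3) unfolding span_f by blast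
  have "y \<noteq> 0" using np mem_perp_x[OF v(2)] by (simp add: c form_e)
  then have "P = pt 0 (j / y * a) (j / y * b)" using pt_scale v c by simp
  then show "P \<in> oline a b" unfolding oline_def by blast
next
  fix P assume "P \<in> oline a b"
  then obtain j where P: "P = point (cv 0 1 (j * a) (j * b))" by (auto simp: oline_def pt_def)
  have nz: "cv 0 1 (j * a) (j * b) \<noteq> 0" by (simp add: cv_eq_zero_iff)
  show "P \<in> points_of (vec.span {cv 0 0 a b, f}) - perp W_quadrangle {x}"
    unfolding P using nz mem_perp_x[OF nz] span_f[of "cv 0 1 (j * a) (j * b)" a b]
    by (auto simp: point_mem_points_of form_e)
qed

lemma e_notin_span: "e \<notin> vec.span {cv 0 0 a b, f}"
proof
  assume "e \<in> vec.span {cv 0 0 a b, f}"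
  then obtain j y where "cv 1 0 0 0 = cv 0 y (j * a) (j * b)" unfolding span_f cv_e by blast
  then show False by (simp add: cv_eq_iff)
qed

lemma pt_000: "pt 0 0 0 = point f"
  by (simp add: pt_def cv_f)

text \<open>Orthogonality to \<open>f\<close> removes the coordinate at \<open>e\<close>, and
  subtracting a multiple of \<open>f\<close> removes the coordinate at \<open>f\<close>, so a second
  spanning vector can be taken in the span of \<open>u\<close> and \<open>w\<close>.\<close>

lemma ti_plane_through_f:
  assumes V: "ti_plane V" and f: "f \<in> V"
  obtains a b where "a \<noteq> 0 \<or> b \<noteq> 0" "V = vec.span {cv 0 0 a b, f}"
proof -
  have sub: "vec.subspace V" and dim: "vec.dim V = 2" using V by (simp_all add: ti_plane_def)
  have "\<not> V \<subseteq> point f"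
  proof
    assume "V \<subseteq> point f"
    then have "vec.dim V \<le> card {f}" by (intro vec.dim_le_card) auto
    then show False using dim by simp
  qed
  then obtain v where v: "v \<in> V" "v \<notin> point f" by blast
  obtain s y a b where c: "v = cv s y a b" by (rule cv_cases)
  have "symp_form f v = 0" using V f v(1) by (simp add: ti_plane_def)
  then have s: "s = 0" by (simp add: c form_f)
  have eq: "cv 0 0 a b = v - y *s f" unfolding c s by (simp add: cv_def)
  have mem: "cv 0 0 a b \<in> V"
    unfolding eq using sub v(1) f by (simp add: vec.subspace_diff vec.subspace_scale)
  have nz: "a \<noteq> 0 \<or> b \<noteq> 0"
  proof (rule ccontr)
    assume "\<not> ?thesis"
    then have "v = y *s f" using c s by (simp add: cv_def)
    then show False using v(2) unfolding mem_point_iff by blast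
  qed
  have ind: "vec.independent {cv 0 0 a b, f}"
    using cv_notin_point_f[OF nz] by (intro vec.independent_insertI) (simp_all add: vec.independent_empty)
  have "card {cv 0 0 a b, f} = 2" using cv_notin_point_f[OF nz] vec.span_base[of f "{f}"] by (cases "cv 0 0 a b = f") auto
  then have "V \<subseteq> vec.span {cv 0 0 a b, f}"
    using mem f ind dim by (intro vec.card_ge_dim_independent) auto
  moreover have "vec.span {cv 0 0 a b, f} \<subseteq> V" using mem f sub by (intro vec.span_minimal) auto
  ultimately show ?thesis using that nz by blast
qed

text \<open>The left side is the Payne line of the second kind given by \<open>r = pt 0 0 0\<close>:
  the hyperbolic line spanned by \<open>e\<close> and \<open>f\<close>, without
  \<open>x\<close>.\<close>

lemma hyperbolic_line: "perp W_quadrangle (PP 0 0) - {x} = {pt s 0 0 | s. True}"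
proof -
  have PP0: "PP 0 0 = point ` {cv 0 0 \<alpha> \<beta> | \<alpha> \<beta>. \<alpha> \<noteq> 0 \<or> \<beta> \<noteq> 0}" by (auto simp: PP_def)
  have mem: "point (cv s y a b) \<in> perp W_quadrangle (PP 0 0) \<longleftrightarrow> a = 0 \<and> b = 0"
    if "cv s y a b \<noteq> 0" for s y a b
  proof -
    have "point (cv s y a b) \<in> perp W_quadrangle (PP 0 0) \<longleftrightarrow>
        (\<forall>\<alpha> \<beta>. \<alpha> \<noteq> 0 \<or> \<beta> \<noteq> 0 \<longrightarrow> \<alpha> * b - \<beta> * a = 0)"
    proof -
      have "u \<noteq> 0" if "u \<in> {cv 0 0 \<alpha> \<beta> | \<alpha> \<beta>. \<alpha> \<noteq> 0 \<or> \<beta> \<noteq> 0}" for u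
        using that by (auto simp: cv_eq_zero_iff)
      then have "point (cv s y a b) \<in> perp W_quadrangle (PP 0 0) \<longleftrightarrow>
          (\<forall>u\<in>{cv 0 0 \<alpha> \<beta> | \<alpha> \<beta>. \<alpha> \<noteq> 0 \<or> \<beta> \<noteq> 0}. symp_form u (cv s y a b) = 0)"
        unfolding PP0 by (rule point_mem_perp[OF _ that])
      also have "\<dots> \<longleftrightarrow> (\<forall>\<alpha> \<beta>. \<alpha> \<noteq> 0 \<or> \<beta> \<noteq> 0 \<longrightarrow> symp_form (cv 0 0 \<alpha> \<beta>) (cv s y a b) = 0)"
        by blast
      finally show ?thesis by (simp add: form_cv)
    qed
    also have "\<dots> \<longleftrightarrow> a = 0 \<and> b = 0"
    proof
      assume h: "\<forall>\<alpha> \<beta>. \<alpha> \<noteq> 0 \<or> \<beta> \<noteq> 0 \<longrightarrow> \<alpha> * b - \<beta> * a = 0"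
      show "a = 0 \<and> b = 0" using h[rule_format, of 0 1] h[rule_format, of 1 0] by simp
    qed simp
    finally show ?thesis .
  qed
  show ?thesis
  proof (intro equalityI subsetI)
    fix P assume P: "P \<in> perp W_quadrangle (PP 0 0) - {x}"
    then obtain v where v: "P = point v" "v \<noteq> 0" using perp_W_sub by (auto simp: W_points_eq)
    obtain s y a b where c: "v = cv s y a b" by (rule cv_cases)
    have ab: "a = 0" "b = 0" using P v mem by (auto simp: c)
    have "y \<noteq> 0"
    proof
      assume "y = 0"
      then have "v = s *s e" using ab c by (simp add: cv_def)
      then show False using P v point_scale[of s e] by (cases "s = 0") auto
    qed
    then show "P \<in> {pt s 0 0 | s. True}" using pt_scale[of y s a b] v c ab by auto
  next
    fix P assume "P \<in> {pt s 0 0 | s. True}"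
    then obtain s where P: "P = point (cv s 1 0 0)" by (auto simp: pt_def)
    have nz: "cv s 1 0 0 \<noteq> 0" by (simp add: cv_eq_zero_iff)
    have "x \<in> perp W_quadrangle {x}" using mem_perp_x[of e] by simp
    moreover have "P \<notin> perp W_quadrangle {x}" using mem_perp_x[OF nz] by (simp add: P form_e)
    ultimately have "P \<noteq> x" by blast
    then show "P \<in> perp W_quadrangle (PP 0 0) - {x}" using mem[OF nz] by (simp add: P)
  qed
qed

text \<open>Guarantees that only one line of the second kind passes through the origin. The points
  of \<open>PP a b\<close> with directions (0, 1) and (1, 0) have \<open>a\<close> and
  \<open>- b\<close> as coordinates at \<open>e\<close>, and orthogonality to \<open>f\<close> makes
  these vanish.\<close>

lemma pt_mem_hyperbolic: "pt 0 0 0 \<in> perp W_quadrangle (PP a b) \<Longrightarrow> a = 0 \<and> b = 0"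
proof -
  assume h: "pt 0 0 0 \<in> perp W_quadrangle (PP a b)"
  have form0: "t = 0" if "point (cv t 0 \<alpha> \<beta>) \<in> PP a b" "\<alpha> \<noteq> 0 \<or> \<beta> \<noteq> 0" for t \<alpha> \<beta>
  proof -
    have "cv t 0 \<alpha> \<beta> \<noteq> 0" using that by (simp add: cv_eq_zero_iff)
    moreover have "collin W_quadrangle (point (cv t 0 \<alpha> \<beta>)) (point f)"
      using h that(1) by (simp add: perp_def pt_000)
    ultimately have "symp_form (cv t 0 \<alpha> \<beta>) (cv 0 1 0 0) = 0" by (simp add: collin_W cv_f)
    then show "t = 0" by (simp add: form_cv)
  qed
  show ?thesis using form0[of a 0 1] form0[of "- b" 1 0] by (simp add: point_mem_PP)
qed

text \<open>Removing \<open>x\<close> from a hyperbolic line through it already removes everything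
  collinear with \<open>x\<close>, so the Payne lines of the second kind consist of points of the
  Payne derivation.\<close>

lemma hyperbolic_line_meets_perp: "perp W_quadrangle (PP a b) \<inter> perp W_quadrangle {x} \<subseteq> {x}"
proof
  fix P assume P: "P \<in> perp W_quadrangle (PP a b) \<inter> perp W_quadrangle {x}"
  then obtain v where v: "P = point v" "v \<noteq> 0" using perp_W_sub by (auto simp: W_points_eq)
  obtain s y a' b' where c: "v = cv s y a' b'" by (rule cv_cases)
  have y: "y = 0" using P v mem_perp_x[of v] by (simp add: c form_e)
  have form0: "symp_form (cv (a * \<beta> - b * \<alpha>) 0 \<alpha> \<beta>) v = 0" if "\<alpha> \<noteq> 0 \<or> \<beta> \<noteq> 0" for \<alpha> \<beta>
  proof -
    have "cv (a * \<beta> - b * \<alpha>) 0 \<alpha> \<beta> \<noteq> 0" using that by (simp add: cv_eq_zero_iff)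
    moreover have "collin W_quadrangle (point (cv (a * \<beta> - b * \<alpha>) 0 \<alpha> \<beta>)) (point v)"
      using P v(1) point_mem_PP[OF that] by (simp add: perp_def)
    ultimately show ?thesis using v(2) by (simp add: collin_W)
  qed
  have "a' = 0" "b' = 0" using form0[of 0 1] form0[of 1 0] y by (simp_all add: c form_cv)
  then have "v = s *s e" using y c by (simp add: cv_def)
  then show "P \<in> {x}" using v point_scale[of s e] by (cases "s = 0") auto
qed

lemma lns_payne_sub: "lns (payne W_quadrangle x) \<subseteq> Pow (pts (payne W_quadrangle x))"
proof
  fix M assume "M \<in> lns (payne W_quadrangle x)"
  then consider L where "L \<in> lns W_quadrangle" "M = L - perp W_quadrangle {x}"
    | r where "r \<in> W_points" "\<not> collin W_quadrangle x r"
      "M = perp W_quadrangle (perp W_quadrangle {x, r}) - {x}"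
    by (auto simp: payne_def)
  then show "M \<in> Pow (pts (payne W_quadrangle x))"
  proof cases
    case 1
    then show ?thesis using lns_W_sub by (auto simp: payne_def)
  next
    case 2
    then obtain s a b where "r = pt s a b" using noncollinear_x by blast
    then have "M = perp W_quadrangle (PP a b) - {x}" using 2 by (simp add: perp_x_pt)
    then show ?thesis
      using hyperbolic_line_meets_perp[of a b] perp_W_sub[of "PP a b"] by (auto simp: payne_def)
  qed
qed

text \<open>A line of the first kind is given by a direction (\<open>a\<close>, \<open>b\<close>) up
  to scalars, normalized to (0, 1) or (1, \<open>m\<close>). With the single hyperbolic line this
  makes \<open>q + 2\<close> lines.\<close>

lemma payne_lines_through_origin:
  "lines_through (payne W_quadrangle x) (pt 0 0 0) =
    insert {pt s 0 0 | s. True} (insert {pt 0 0 b | b. True} (range (\<lambda>m. {pt 0 a (m * a) | a. True})))"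
proof -
  have vert: "oline 0 1 = {pt 0 0 b | b. True}" by (simp add: oline_def)
  have slope: "oline 1 m = {pt 0 a (m * a) | a. True}" for m
    by (simp add: oline_def mult.commute)
  have norm: "oline a b = oline 0 1 \<or> (\<exists>m. oline a b = oline 1 m)" if "a \<noteq> 0 \<or> b \<noteq> 0" for a b
  proof (cases "a = 0")
    case True
    then show ?thesis using oline_scale[of b 0 1] that by simp
  next
    case False
    then show ?thesis using oline_scale[of a 1 "b / a"] by auto
  qed
  have line1: "oline a b \<in> lns (payne W_quadrangle x)" if nz: "a \<noteq> 0 \<or> b \<noteq> 0" for a b
  proof -
    have "symp_form f (cv 0 0 a b) = 0" by (simp add: form_f)
    then have "ti_plane (vec.span {cv 0 0 a b, f})"
      by (intro ti_plane_span f_nonzero cv_notin_point_f nz)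
    moreover have "x \<notin> points_of (vec.span {cv 0 0 a b, f})"
      using e_notin_span by (simp add: point_mem_points_of)
    ultimately show ?thesis unfolding oline_eq[symmetric] payne_def lns_W by auto
  qed
  have line2: "{pt s 0 0 | s. True} \<in> lns (payne W_quadrangle x)"
  proof -
    have "pt 0 0 0 \<in> W_points" "\<not> collin W_quadrangle x (pt 0 0 0)" using noncollinear_x by blast+
    then show ?thesis
      unfolding hyperbolic_line[symmetric] perp_x_pt[of 0 0 0, symmetric] payne_def by auto
  qed
  have origin: "pt 0 0 0 \<in> oline a b" for a b by (auto simp: oline_def intro: exI[of _ 0])
  show ?thesis
  proof (intro equalityI subsetI)
    fix M assume "M \<in> lines_through (payne W_quadrangle x) (pt 0 0 0)"
    then have M: "M \<in> lns (payne W_quadrangle x)" "point f \<in> M" by (simp_all add: lines_through_def pt_000)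
    then consider V where "ti_plane V" "M = points_of V - perp W_quadrangle {x}"
      | r where "r \<in> W_points" "\<not> collin W_quadrangle x r"
        "M = perp W_quadrangle (perp W_quadrangle {x, r}) - {x}"
      by (auto simp: payne_def lns_W)
    then show "M \<in> insert {pt s 0 0 | s. True}
        (insert {pt 0 0 b | b. True} (range (\<lambda>m. {pt 0 a (m * a) | a. True})))"
    proof cases
      case 1
      then have "f \<in> V" using M(2) by (simp add: point_mem_points_of ti_plane_def)
      then obtain a b where "a \<noteq> 0 \<or> b \<noteq> 0" "V = vec.span {cv 0 0 a b, f}"
        using 1(1) ti_plane_through_f by blast
      then have "M = oline 0 1 \<or> (\<exists>m. M = oline 1 m)" using norm oline_eq 1(2) by simp
      then show ?thesis unfolding vert slope by blast
    next
      case 2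
      then obtain s a b where r: "r = pt s a b" using noncollinear_x by blast
      then have "M = perp W_quadrangle (PP a b) - {x}" using 2 by (simp add: perp_x_pt)
      moreover have "a = 0 \<and> b = 0"
        using M(2) calculation pt_mem_hyperbolic[of a b] by (simp add: pt_000)
      ultimately show ?thesis using hyperbolic_line by simp
    qed
  next
    fix M assume "M \<in> insert {pt s 0 0 | s. True}
        (insert {pt 0 0 b | b. True} (range (\<lambda>m. {pt 0 a (m * a) | a. True})))"
    then consider "M = {pt s 0 0 | s. True}" | "M = oline 0 1" | m where "M = oline 1 m"
      unfolding vert slope by blast
    then show "M \<in> lines_through (payne W_quadrangle x) (pt 0 0 0)"
      unfolding lines_through_def using line1 line2 origin by cases auto
  qed
qed

end

section \<open>A symplectic frame adapted to \<open>x\<close>, \<open>z\<close> and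
  \<open>l\<close>\<close>

lemma ex_symplectic_frame:
  fixes x z l
  assumes x: "x \<in> W_points" and z: "z \<in> pts (payne W_quadrangle x)"
    and l: "l \<in> points_at_infinity (plane W_quadrangle x)"
  obtains e f u w :: "'k::{field,finite} ^ 4"
  where "symplectic_frame e f u w" "x = point e" "z = symplectic_frame.pt e f u w 0 0 0"
    "l = coordinatized_plane.vclass (symplectic_frame.PP e f u w)"
proof -
  obtain e where e: "x = point e" "e \<noteq> 0" using x by (auto simp: W_points_eq)
  have zW: "z \<in> W_points" "z \<notin> perp W_quadrangle {x}" using z by (simp_all add: payne_def)
  then obtain f0 where f0: "z = point f0" "f0 \<noteq> 0" by (auto simp: W_points_eq)
  have nz: "symp_form e f0 \<noteq> 0"
    using zW point_mem_perp[of "{e}" f0] e f0 by auto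
  define f where "f = (1 / symp_form e f0) *s f0"
  have ef: "symp_form e f = 1" using nz by (simp add: f_def symp_form_scale_right)
  have zf: "z = point f" using nz by (simp add: f0 f_def point_scale)
  obtain L where L: "L \<in> lns (plane W_quadrangle x)" "l = parallel_class (plane W_quadrangle x) L"
    using l by (auto simp: points_at_infinity_def)
  then obtain y where y: "y \<in> perp W_quadrangle {x}" "y \<noteq> x"
    and Ly: "L = {X \<in> pts (plane W_quadrangle x). y \<in> X}" by (auto simp: plane_def Let_def)
  then obtain y0 where y0: "y = point y0" "y0 \<noteq> 0" using perp_W_sub by (auto simp: W_points_eq)
  have ey: "symp_form e y0 = 0"
    using y(1) point_mem_perp[of "{e}" y0] e y0 by auto
  \<comment> \<open>Since \<open>symp_form f e\<close> is -1, adding \<open>k *s e\<close> makes the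
    vector orthogonal to \<open>f\<close>. Moving \<open>y\<close> along its line with
    \<open>x\<close> only replaces the line of the plane by a parallel one.\<close>
  define k where "k = symp_form f y0"
  define w where "w = y0 + k *s e"
  have ew: "symp_form e w = 0" by (simp add: w_def symp_form_add_right symp_form_scale_right ey)
  have fw: "symp_form f w = 0"
    using ef symp_form_swap[of f e]
    by (simp add: w_def symp_form_add_right symp_form_scale_right k_def)
  have y0w: "y0 = w - k *s e" by (simp add: w_def)
  have "w \<noteq> 0"
  proof
    assume "w = 0"
    then have "y0 = (- k) *s e" using y0w by (simp add: vec_eq_iff)
    then show False using y(2) y0 e point_scale[of "- k" e] by (cases "k = 0") auto
  qed
  then obtain v where v: "symp_form v w = 1" using symp_form_nondegenerate by blast
  \<comment> \<open>The projection of \<open>v\<close> to the orthogonal complement of the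
    hyperbolic pair \<open>e\<close>, \<open>f\<close>; its product with \<open>w\<close> stays 1,
    because \<open>w\<close> lies in that complement.\<close>
  define u where "u = v - symp_form v f *s e - symp_form e v *s f"
  have eu: "symp_form e u = 0"
    by (simp add: u_def symp_form_diff_right symp_form_scale_right ef)
  have fu: "symp_form f u = 0"
    using ef symp_form_swap[of f e] symp_form_swap[of f v]
    by (simp add: u_def symp_form_diff_right symp_form_scale_right)
  have uw: "symp_form u w = 1"
    by (simp add: u_def symp_form_diff_left symp_form_scale_left ew fw v)
  interpret F: symplectic_frame e f u w
    by unfold_locales (rule ef uw eu ew fu fw)+
  have yc: "y = point (F.cv (- k) 0 0 1)"
    unfolding y0(1) y0w by (simp add: F.cv_def vec_eq_iff)
  \<comment> \<open>The incidence equation with direction (0, 1) and \<open>t = - k\<close> leaves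
    \<open>b\<close> free, so \<open>L\<close> is vertical and its class is
    \<open>vclass\<close>.\<close>
  have "L = {F.PP a b | a b. a = - k}"
    unfolding Ly e(1) F.pts_plane yc by (auto simp: F.point_mem_PP)
  then have "L = F.plane.vline (- k)" by (auto simp: F.plane.vline_def)
  then have "l = F.plane.vclass" using L(2) F.plane.parallel_class_vline e(1) by simp
  moreover have "z = F.pt 0 0 0" by (simp add: zf F.pt_000)
  ultimately show ?thesis using that[of e f u w] F.symplectic_frame_axioms e(1) by blast
qed

section \<open>Line stabilizers in the Singer group\<close>

text \<open>Collects what the stabilizers depend on: coordinates for the points, the action of the
  \<open>q^3\<close> group elements, and the lines through the origin. The quadrangle W(q) and the
  isomorphism \<open>\<phi>\<close> no longer appear.\<close>

locale singer_coordinates =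
  fixes \<S> :: "'s geometry" and S :: "('s \<Rightarrow> 's) set"
    and Q :: "'k::{field,finite} \<Rightarrow> 'k \<Rightarrow> 'k \<Rightarrow> 's"
    and \<rho> :: "'k \<Rightarrow> 'k \<Rightarrow> 'k \<Rightarrow> 's \<Rightarrow> 's" and g :: "'k \<Rightarrow> 'k"
  assumes Q_eq_iff [simp]: "Q s a b = Q s' a' b' \<longleftrightarrow> s = s' \<and> a = a' \<and> b = b'"
    and pts_eq: "pts \<S> = {Q s a b | s a b. True}"
    and S_eq: "S = {\<rho> \<sigma> \<alpha> d | \<sigma> \<alpha> d. True}"
    and S_Bij: "S \<subseteq> Bij (pts \<S>)"
    and \<rho>_Q [simp]: "\<rho> \<sigma> \<alpha> d (Q s a b) =
      Q (s + \<sigma> + a * (\<alpha> * g \<alpha> - d) + b * \<alpha>) (a + \<alpha>) (b + g \<alpha> * a + d)"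
    and g_add: "g (a + b) = g a + g b"
    and lines_origin: "lines_through \<S> (Q 0 0 0) =
      insert {Q s 0 0 | s. True} (insert {Q 0 0 b | b. True} (range (\<lambda>m. {Q 0 a (m * a) | a. True})))"
begin

text \<open>The index \<open>None\<close> is the hyperbolic line and \<open>Some None\<close> the line in the direction of \<open>l\<close>.\<close>

definition oline :: "'k option option \<Rightarrow> 's set" where
  "oline i = (case i of None \<Rightarrow> {Q s 0 0 | s. True}
    | Some None \<Rightarrow> {Q 0 0 b | b. True}
    | Some (Some m) \<Rightarrow> {Q 0 a (m * a) | a. True})"

lemma g_zero [simp]: "g 0 = 0"
  using g_add[of 0 0] by (metis add.right_neutral add_left_cancel)

lemma additive_kernel: "additive_subgroup {a. g a = 0}"
proof -
  have "g (a - b) = g a - g b" for a b using g_add[of "a - b" b] by simp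
  then show ?thesis by (simp add: additive_subgroup_def)
qed

lemma oline_bij: "bij_betw oline UNIV (lines_through \<S> (Q 0 0 0))"
proof -
  have mem: "Q 1 0 0 \<in> oline i \<longleftrightarrow> i = None" "Q 0 0 1 \<in> oline i \<longleftrightarrow> i = Some None"
    "Q 0 1 m \<in> oline i \<longleftrightarrow> i = Some (Some m)" for i m
    by (auto simp: oline_def split: option.split)
  have "inj oline"
  proof (rule injI)
    fix i j assume eq: "oline i = oline j"
    consider "i = None" | "i = Some None" | m where "i = Some (Some m)"
      by (metis option.exhaust)
    then show "i = j"
    proof cases
      case 1
      then show ?thesis using mem(1)[of i, unfolded eq] mem(1)[of j] by blast
    next
      case 2
      then show ?thesis using mem(2)[of i, unfolded eq] mem(2)[of j] by blast
    next
      case 3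
      then show ?thesis using mem(3)[of m i, unfolded eq] mem(3)[of m j] by blast
    qed
  qed
  moreover have "range oline = lines_through \<S> (Q 0 0 0)"
    unfolding lines_origin
  proof (intro equalityI subsetI)
    fix L assume "L \<in> range oline"
    then obtain i where "L = oline i" by blast
    then show "L \<in> insert {Q s 0 0 | s. True}
        (insert {Q 0 0 b | b. True} (range (\<lambda>m. {Q 0 a (m * a) | a. True})))"
      unfolding oline_def by (cases i rule: option.exhaust; cases "the i") simp_all
  next
    fix L assume "L \<in> insert {Q s 0 0 | s. True}
        (insert {Q 0 0 b | b. True} (range (\<lambda>m. {Q 0 a (m * a) | a. True})))"
    then consider "L = oline None" | "L = oline (Some None)" | m where "L = oline (Some (Some m))"
      by (auto simp: oline_def)
    then show "L \<in> range oline" by cases blast+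
  qed
  ultimately show ?thesis by (simp add: bij_betw_def)
qed

lemma \<rho>_mem: "\<rho> \<sigma> \<alpha> d \<in> S"
  by (auto simp: S_eq)

lemma \<rho>_eq_iff [simp]: "\<rho> \<sigma> \<alpha> d = \<rho> \<sigma>' \<alpha>' d' \<longleftrightarrow> \<sigma> = \<sigma>' \<and> \<alpha> = \<alpha>' \<and> d = d'"
proof
  assume eq: "\<rho> \<sigma> \<alpha> d = \<rho> \<sigma>' \<alpha>' d'"
  show "\<sigma> = \<sigma>' \<and> \<alpha> = \<alpha>' \<and> d = d'" using arg_cong[OF eq, of "\<lambda>r. r (Q 0 0 0)"] by simp
qed simp

lemma ext_Q:
  assumes "r \<in> Bij (pts \<S>)" "r' \<in> Bij (pts \<S>)" "\<And>s a b. r (Q s a b) = r' (Q s a b)"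
  shows "r = r'"
  using assms Bij_imp_extensional
  by (intro extensionalityI[of r "pts \<S>"]) (auto simp: pts_eq)

lemma \<rho>_mult:
  "\<rho> \<sigma>' \<alpha>' d' \<otimes>\<^bsub>perm_group \<S> M\<^esub> \<rho> \<sigma> \<alpha> d =
    \<rho> (\<sigma> + \<sigma>' + \<alpha> * (\<alpha>' * g \<alpha>' - d') + d * \<alpha>') (\<alpha> + \<alpha>') (d + g \<alpha>' * \<alpha> + d')"
proof -
  have B: "\<rho> \<sigma> \<alpha> d \<in> Bij (pts \<S>)" for \<sigma> \<alpha> d using S_Bij \<rho>_mem by blast
  have "compose (pts \<S>) (\<rho> \<sigma>' \<alpha>' d') (\<rho> \<sigma> \<alpha> d) =
    \<rho> (\<sigma> + \<sigma>' + \<alpha> * (\<alpha>' * g \<alpha>' - d') + d * \<alpha>') (\<alpha> + \<alpha>') (d + g \<alpha>' * \<alpha> + d')"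
  proof (rule ext_Q[OF compose_Bij[OF B B] B])
    fix s a b
    have "Q s a b \<in> pts \<S>" by (auto simp: pts_eq)
    then show "compose (pts \<S>) (\<rho> \<sigma>' \<alpha>' d') (\<rho> \<sigma> \<alpha> d) (Q s a b) =
      \<rho> (\<sigma> + \<sigma>' + \<alpha> * (\<alpha>' * g \<alpha>' - d') + d * \<alpha>') (\<alpha> + \<alpha>') (d + g \<alpha>' * \<alpha> + d') (Q s a b)"
      by (simp add: compose_def g_add algebra_simps)
  qed
  then show ?thesis using perm_group_mult[OF B B] by simp
qed

lemma \<rho>_mult_BijGroup [simp]:
  "\<rho> \<sigma>' \<alpha>' d' \<otimes>\<^bsub>BijGroup (pts \<S>)\<^esub> \<rho> \<sigma> \<alpha> d =
    \<rho> (\<sigma> + \<sigma>' + \<alpha> * (\<alpha>' * g \<alpha>' - d') + d * \<alpha>') (\<alpha> + \<alpha>') (d + g \<alpha>' * \<alpha> + d')"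
  using \<rho>_mult by simp

text \<open>The image of the origin under \<open>\<rho> \<sigma> \<alpha> d\<close> is
  \<open>Q \<sigma> \<alpha> d\<close>, so for a line through the origin stability makes the
  parameters themselves a point of the line. This fixes the form of the stabilizer up to the
  condition checked in \<open>move\<close>.\<close>

lemma stabilizer_eqI:
  assumes "Q 0 0 0 \<in> L" and stable: "\<And>\<sigma> \<alpha> d. P \<sigma> \<alpha> d \<Longrightarrow> \<rho> \<sigma> \<alpha> d ` L = L"
    and move: "\<And>\<sigma> \<alpha> d. \<rho> \<sigma> \<alpha> d ` L \<subseteq> L \<Longrightarrow> Q \<sigma> \<alpha> d \<in> L \<Longrightarrow> P \<sigma> \<alpha> d"
  shows "line_stabilizer S L = {\<rho> \<sigma> \<alpha> d | \<sigma> \<alpha> d. P \<sigma> \<alpha> d}"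
proof -
  have "\<rho> \<sigma> \<alpha> d ` L = L \<longleftrightarrow> P \<sigma> \<alpha> d" for \<sigma> \<alpha> d
  proof
    assume L: "\<rho> \<sigma> \<alpha> d ` L = L"
    have "\<rho> \<sigma> \<alpha> d (Q 0 0 0) \<in> \<rho> \<sigma> \<alpha> d ` L" using assms(1) by (rule imageI)
    then have "Q \<sigma> \<alpha> d \<in> L" unfolding L by simp
    then show "P \<sigma> \<alpha> d" using move[of \<sigma> \<alpha> d] L by simp
  qed (rule stable)
  then show ?thesis unfolding line_stabilizer_def S_eq by blast
qed

lemma shift_surj: "range (\<lambda>a. F (a + c)) = range F" for F :: "'k \<Rightarrow> 's"
proof -
  have "F a = F ((a - c) + c)" for a by simp
  then show ?thesis by (metis (mono_tags, lifting) equalityI image_subset_iff rangeI)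
qed

lemma stabilizer_hyperbolic:
  "line_stabilizer S (oline None) = {\<rho> \<sigma> \<alpha> d | \<sigma> \<alpha> d. \<alpha> = 0 \<and> d = 0}"
proof (rule stabilizer_eqI)
  have L: "oline None = range (\<lambda>s. Q s 0 0)" by (auto simp: oline_def)
  show "Q 0 0 0 \<in> oline None" by (simp add: L)
  fix \<sigma> \<alpha> d
  show "\<rho> \<sigma> \<alpha> d ` oline None = oline None" if "\<alpha> = 0 \<and> d = 0"
    using that shift_surj[of "\<lambda>s. Q s 0 0" \<sigma>] by (simp add: L image_image)
  show "Q \<sigma> \<alpha> d \<in> oline None \<Longrightarrow> \<alpha> = 0 \<and> d = 0" by (auto simp: L)
qed

lemma stabilizer_vertical:
  "line_stabilizer S (oline (Some None)) = {\<rho> \<sigma> \<alpha> d | \<sigma> \<alpha> d. \<sigma> = 0 \<and> \<alpha> = 0}"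
proof (rule stabilizer_eqI)
  have L: "oline (Some None) = range (\<lambda>b. Q 0 0 b)" by (auto simp: oline_def)
  show "Q 0 0 0 \<in> oline (Some None)" by (simp add: L)
  fix \<sigma> \<alpha> d
  show "\<rho> \<sigma> \<alpha> d ` oline (Some None) = oline (Some None)" if "\<sigma> = 0 \<and> \<alpha> = 0"
    using that shift_surj[of "\<lambda>b. Q 0 0 b" d] by (simp add: L image_image)
  show "Q \<sigma> \<alpha> d \<in> oline (Some None) \<Longrightarrow> \<sigma> = 0 \<and> \<alpha> = 0" by (auto simp: L)
qed

text \<open>Once the origin goes to a point of the line, so that \<open>\<sigma> = 0\<close> and
  \<open>d = m * \<alpha>\<close>, the point with \<open>a = 1\<close> goes to a point whose first
  coordinate is \<open>\<alpha> * g \<alpha>\<close>. This must vanish, and either factor being zero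
  gives \<open>g \<alpha> = 0\<close> because \<open>g 0 = 0\<close>.\<close>

lemma stabilizer_slope:
  "line_stabilizer S (oline (Some (Some m))) =
    {\<rho> \<sigma> \<alpha> d | \<sigma> \<alpha> d. \<sigma> = 0 \<and> d = m * \<alpha> \<and> g \<alpha> = 0}"
proof (rule stabilizer_eqI)
  have L: "oline (Some (Some m)) = range (\<lambda>a. Q 0 a (m * a))" by (auto simp: oline_def)
  show "Q 0 0 0 \<in> oline (Some (Some m))" by (auto simp: L image_iff)
  fix \<sigma> \<alpha> d
  show "\<rho> \<sigma> \<alpha> d ` oline (Some (Some m)) = oline (Some (Some m))" if "\<sigma> = 0 \<and> d = m * \<alpha> \<and> g \<alpha> = 0"
    using that shift_surj[of "\<lambda>a. Q 0 a (m * a)" \<alpha>] by (simp add: L image_image algebra_simps)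
  assume stable: "\<rho> \<sigma> \<alpha> d ` oline (Some (Some m)) \<subseteq> oline (Some (Some m))"
    and "Q \<sigma> \<alpha> d \<in> oline (Some (Some m))"
  then have \<sigma>: "\<sigma> = 0" "d = m * \<alpha>" by (auto simp: L)
  have "\<rho> \<sigma> \<alpha> d (Q 0 1 (m * 1)) \<in> \<rho> \<sigma> \<alpha> d ` oline (Some (Some m))"
    unfolding L by (intro imageI rangeI)
  then have "\<rho> \<sigma> \<alpha> d (Q 0 1 (m * 1)) \<in> oline (Some (Some m))" using stable by blast
  then have "\<alpha> * g \<alpha> = 0" using \<sigma> by (auto simp: L)
  then show "\<sigma> = 0 \<and> d = m * \<alpha> \<and> g \<alpha> = 0" using \<sigma> by auto
qed

definition stab_group :: "'k option option \<Rightarrow> 'k set" where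
  "stab_group i = (case i of Some (Some m) \<Rightarrow> {a. g a = 0} | _ \<Rightarrow> UNIV)"

text \<open>A single parameter survives in each case and is additive. For slope \<open>m\<close> the
  mixed terms in the first coordinate cancel: \<open>g\<close> vanishes on both factors, and
  \<open>d\<close> and \<open>d'\<close> are the same multiple of \<open>\<alpha>\<close> and
  \<open>\<alpha>'\<close>.\<close>

lemma stabilizer_iso:
  "add_group (stab_group i) \<cong> perm_group \<S> (line_stabilizer S (oline i))"
proof -
  consider "i = None" | "i = Some None" | m where "i = Some (Some m)"
    by (metis option.exhaust)
  then show ?thesis
  proof cases
    case 1
    have "(\<lambda>k. \<rho> k 0 0) \<in> iso (add_group (stab_group i)) (perm_group \<S> (line_stabilizer S (oline i)))"
      by (auto simp: 1 stab_group_def iso_def hom_def bij_betw_def inj_on_def stabilizer_hyperbolic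
          add.commute)
    then show ?thesis by (rule is_isoI)
  next
    case 2
    have "(\<lambda>k. \<rho> 0 0 k) \<in> iso (add_group (stab_group i)) (perm_group \<S> (line_stabilizer S (oline i)))"
      by (auto simp: 2 stab_group_def iso_def hom_def bij_betw_def inj_on_def stabilizer_vertical
          add.commute)
    then show ?thesis by (rule is_isoI)
  next
    case 3
    have "(\<lambda>k. \<rho> 0 k (m * k)) \<in> iso (add_group (stab_group i)) (perm_group \<S> (line_stabilizer S (oline i)))"
      by (auto simp: 3 stab_group_def iso_def hom_def bij_betw_def inj_on_def stabilizer_slope
          algebra_simps)
    then show ?thesis by (rule is_isoI)
  qed
qed

end

section \<open>Transfer of the coordinates along \<open>\<phi>\<close> and identification of
  \<open>S\<close>\<close>

lemma singer_line_stabilizers: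
  fixes x :: "('k::{field,finite} ^ 4) set" and \<S> :: "'s geometry"
  assumes x: "x \<in> pts W_quadrangle"
    and \<phi>: "\<phi> \<in> geometry_iso (payne W_quadrangle x) \<S>"
    and singer: "singer_group \<S> S"
    and l: "l \<in> points_at_infinity (plane W_quadrangle x)"
    and U: "U \<in> BB (CARD('k)) (plane W_quadrangle x) l"
    and T: "T = H_preimage (plane W_quadrangle x) l U"
    and S: "S = induced W_quadrangle x \<phi> \<S> ` aut_preimage W_quadrangle x T"
    and z: "z \<in> pts \<S>"
  obtains K :: "'k set" and M :: "'k option option \<Rightarrow> 's set" and G :: "'k option option \<Rightarrow> 'k set"
  where "additive_subgroup K" "add_group K \<cong> nu0_space (plane W_quadrangle x) l T"
    "monoid (nu0_space (plane W_quadrangle x) l T)"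
    "bij_betw M UNIV (lines_through \<S> z)"
    "\<forall>i. G i = (case i of Some (Some m) \<Rightarrow> K | _ \<Rightarrow> UNIV)"
    "\<forall>i. add_group (G i) \<cong> perm_group \<S> (line_stabilizer S (M i))"
proof -
  have bij: "bij_betw \<phi> (pts (payne W_quadrangle x)) (pts \<S>)"
    and \<phi>l: "(\<lambda>L. \<phi> ` L) ` lns (payne W_quadrangle x) = lns \<S>"
    using \<phi> by (auto simp: geometry_iso_def)
  \<comment> \<open>The frame is centered at the preimage of \<open>z\<close>, so the lines through
    \<open>z\<close> become the lines through the origin.\<close>
  define z0 where "z0 = inv_into (pts (payne W_quadrangle x)) \<phi> z"
  have z0: "z0 \<in> pts (payne W_quadrangle x)" "\<phi> z0 = z"
    using bij z unfolding z0_def bij_betw_def by (auto intro: inv_into_into f_inv_into_f)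
  have xW: "x \<in> W_points" using x by simp
  obtain e f u w :: "'k ^ 4" where F: "symplectic_frame e f u w" and xe: "x = point e"
    and z0_pt: "z0 = symplectic_frame.pt e f u w 0 0 0"
    and lv: "l = coordinatized_plane.vclass (symplectic_frame.PP e f u w)"
    by (rule ex_symplectic_frame[OF xW z0(1) l])
  interpret F: symplectic_frame e f u w by (rule F)
  obtain g where g: "\<And>a b. g (a + b) = g a + g b"
    and Tg: "T = {F.plane.aff \<alpha> (g \<alpha>) d | \<alpha> d. True}"
    using F.plane.BB_graph[of U] U T unfolding xe lv by blast
  have lns_sub: "lns (payne W_quadrangle x) \<subseteq> Pow (pts (payne W_quadrangle x))"
    unfolding xe by (rule F.lns_payne_sub)
  define Q where "Q s a b = \<phi> (F.pt s a b)" for s a b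
  have pt_mem: "F.pt s a b \<in> pts (payne W_quadrangle x)" for s a b
    unfolding xe F.pts_payne by blast
  have Q_eq_iff: "Q s a b = Q s' a' b' \<longleftrightarrow> s = s' \<and> a = a' \<and> b = b'" for s a b s' a' b'
    using bij pt_mem unfolding Q_def bij_betw_def by (metis F.pt_eq_iff inj_onD)
  have ptsQ: "pts \<S> = {Q s a b | s a b. True}"
  proof -
    have "pts \<S> = \<phi> ` {F.pt s a b | s a b. True}"
      using bij unfolding bij_betw_def xe F.pts_payne by simp
    then show ?thesis unfolding Q_def by blast
  qed
  define \<rho> where "\<rho> \<sigma> \<alpha> d = induced W_quadrangle x \<phi> \<S> (F.g\<tau> \<sigma> \<alpha> (g \<alpha>) d)" for \<sigma> \<alpha> d
  have \<rho>Q: "\<rho> \<sigma> \<alpha> d (Q s a b) =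
      Q (s + \<sigma> + a * (\<alpha> * g \<alpha> - d) + b * \<alpha>) (a + \<alpha>) (b + g \<alpha> * a + d)" for \<sigma> \<alpha> d s a b
  proof -
    have "Q s a b \<in> pts \<S>" using ptsQ by blast
    moreover have "inv_into (pts (payne W_quadrangle x)) \<phi> (Q s a b) = F.pt s a b"
      unfolding Q_def using bij pt_mem by (simp add: bij_betw_inv_into_left)
    ultimately show ?thesis by (simp add: \<rho>_def induced_def F.g\<tau>_pt Q_def)
  qed
  have \<rho>S: "\<rho> \<sigma> \<alpha> d \<in> S" for \<sigma> \<alpha> d
  proof -
    have "F.g\<tau> \<sigma> \<alpha> (g \<alpha>) d \<in> aut_preimage W_quadrangle x T"
      unfolding aut_preimage_def Tg xe
      using F.g\<tau>_aut F.g\<tau>_x F.plane_action_g\<tau> by auto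
    then show ?thesis unfolding S \<rho>_def by (rule imageI)
  qed
  have SB: "S \<subseteq> Bij (pts \<S>)"
    using subgroup.subset[of S "aut_group \<S>"] singer aut_subset_Bij[of \<S>]
    by (auto simp: singer_group_def)
  have Seq: "S = {\<rho> \<sigma> \<alpha> d | \<sigma> \<alpha> d. True}"
  proof (intro equalityI subsetI)
    fix h assume h: "h \<in> S"
    \<comment> \<open>An element \<open>h\<close> of \<open>S\<close> is compared with the
      \<open>\<rho>\<close> that moves the origin to the same point; both lie in \<open>S\<close>,
      where the image of one point determines the element.\<close>
    have "Q 0 0 0 \<in> pts \<S>" using ptsQ by blast
    moreover from this have "h (Q 0 0 0) \<in> pts \<S>" using SB h Bij_imp_funcset by blast
    moreover from this obtain \<sigma> \<alpha> d where d: "h (Q 0 0 0) = Q \<sigma> \<alpha> d" using ptsQ by blast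
    moreover have "\<rho> \<sigma> \<alpha> d (Q 0 0 0) = Q \<sigma> \<alpha> d" by (simp add: \<rho>Q)
    ultimately have "h = \<rho> \<sigma> \<alpha> d" using singer h \<rho>S unfolding singer_group_def by metis
    then show "h \<in> {\<rho> \<sigma> \<alpha> d | \<sigma> \<alpha> d. True}" by blast
  qed (use \<rho>S in blast)
  have zQ: "z = Q 0 0 0" using z0 z0_pt by (simp add: Q_def)
  have lines: "lines_through \<S> (Q 0 0 0) =
      insert {Q s 0 0 | s. True} (insert {Q 0 0 b | b. True} (range (\<lambda>m. {Q 0 a (m * a) | a. True})))"
  proof -
    have "\<phi> (F.pt 0 0 0) \<in> \<phi> ` L \<longleftrightarrow> F.pt 0 0 0 \<in> L" if "L \<in> lns (payne W_quadrangle x)" for L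
      using inj_on_image_mem_iff[of \<phi> "pts (payne W_quadrangle x)" "F.pt 0 0 0" L] that lns_sub bij pt_mem
      unfolding bij_betw_def by blast
    then have "lines_through \<S> (Q 0 0 0) = (\<lambda>L. \<phi> ` L) ` lines_through (payne W_quadrangle x) (F.pt 0 0 0)"
      unfolding lines_through_def \<phi>l[symmetric] Q_def by blast
    also have "\<dots> = insert (\<phi> ` {F.pt s 0 0 | s. True}) (insert (\<phi> ` {F.pt 0 0 b | b. True})
        (range (\<lambda>m. \<phi> ` {F.pt 0 a (m * a) | a. True})))"
      unfolding xe F.payne_lines_through_origin by (simp add: image_image)
    also have "\<phi> ` {F.pt s 0 0 | s. True} = {Q s 0 0 | s. True}" unfolding Q_def by blast
    also have "\<phi> ` {F.pt 0 0 b | b. True} = {Q 0 0 b | b. True}" unfolding Q_def by blast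
    also have "(\<lambda>m. \<phi> ` {F.pt 0 a (m * a) | a. True}) = (\<lambda>m. {Q 0 a (m * a) | a. True})"
      unfolding Q_def by (rule ext) blast
    finally show ?thesis .
  qed
  interpret C: singer_coordinates \<S> S Q \<rho> g
    by unfold_locales (fact Q_eq_iff ptsQ Seq SB \<rho>Q g lines)+
  show ?thesis
  proof (rule that[of "{a. g a = 0}" C.oline C.stab_group])
    show "add_group {a. g a = 0} \<cong> nu0_space (plane W_quadrangle x) l T"
      "monoid (nu0_space (plane W_quadrangle x) l T)"
      unfolding xe lv by (rule F.plane.nu0_space_iso[OF g Tg])+
    show "bij_betw C.oline UNIV (lines_through \<S> z)" unfolding zQ by (rule C.oline_bij)
    show "\<forall>i. add_group (C.stab_group i) \<cong> perm_group \<S> (line_stabilizer S (C.oline i))"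
      by (rule allI, rule C.stabilizer_iso)
  qed (simp_all add: C.additive_kernel C.stab_group_def)
qed

section \<open>Comparison of the two Singer groups by counting\<close>

lemma sum_option_UNIV:
  fixes F :: "'a::finite option \<Rightarrow> 'b::comm_monoid_add"
  shows "(\<Sum>i\<in>UNIV. F i) = F None + (\<Sum>a\<in>UNIV. F (Some a))"
  unfolding UNIV_option_conv by (subst sum.insert) (auto simp: sum.reindex)

theorem proposition9p6:
  fixes p n q :: nat
    and x x' :: "('k::{field,finite} ^ 4) set"
    and \<S> :: "'s geometry" and \<S>' :: "'t geometry"
    and \<phi> :: "('k ^ 4) set \<Rightarrow> 's" and \<phi>' :: "('k ^ 4) set \<Rightarrow> 't"
    and l l' :: "('k ^ 4) set set set set"
    and U U' :: "(('k ^ 4) set set \<Rightarrow> ('k ^ 4) set set) set set"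
    and T T' :: "(('k ^ 4) set set \<Rightarrow> ('k ^ 4) set set) set"
    and S :: "('s \<Rightarrow> 's) set" and S' :: "('t \<Rightarrow> 't) set"
    and z :: 's and z' :: 't
  assumes "prime p" and "n \<ge> 1" and "q = p ^ n" and "CARD('k) = q"
    \<comment> \<open>the Singer group \<open>S\<close> of \<open>\<S>\<close>, arising from \<open>U\<close>\<close>
    and "x \<in> pts W_quadrangle"
    and "\<phi> \<in> geometry_iso (payne W_quadrangle x) \<S>"
    and "linear_singer_group x \<phi> \<S> S"
    and "l \<in> points_at_infinity (plane W_quadrangle x)"
    and "U \<in> BB q (plane W_quadrangle x) l"
    and "T = H_preimage (plane W_quadrangle x) l U"
    and "S = induced W_quadrangle x \<phi> \<S> ` aut_preimage W_quadrangle x T"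
    \<comment> \<open>the Singer group \<open>S'\<close> of \<open>\<S>'\<close>, arising from \<open>U'\<close>\<close>
    and "x' \<in> pts W_quadrangle"
    and "\<phi>' \<in> geometry_iso (payne W_quadrangle x') \<S>'"
    and "linear_singer_group x' \<phi>' \<S>' S'"
    and "l' \<in> points_at_infinity (plane W_quadrangle x')"
    and "U' \<in> BB q (plane W_quadrangle x') l'"
    and "T' = H_preimage (plane W_quadrangle x') l' U'"
    and "S' = induced W_quadrangle x' \<phi>' \<S>' ` aut_preimage W_quadrangle x' T'"
    and "\<not> (classical TYPE('k) (perm_group \<S> S) \<and> classical TYPE('k) (perm_group \<S>' S'))"
    and "z \<in> pts \<S>" and "z' \<in> pts \<S>'"
  shows "(\<exists>f f'. bij_betw f {0..q + 1} (lines_through \<S> z)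
                \<and> bij_betw f' {0..q + 1} (lines_through \<S>' z')
                \<and> (\<forall>j \<in> {0..q + 1}. perm_group \<S> (line_stabilizer S (f j))
                                     \<cong> perm_group \<S>' (line_stabilizer S' (f' j))))
         \<longleftrightarrow> nu0_dim p (plane W_quadrangle x) l T = nu0_dim p (plane W_quadrangle x') l' T'"
proof -
  note cardq = \<open>CARD('k) = q\<close>
  have cardk: "CARD('k) = p ^ n" using cardq \<open>q = p ^ n\<close> by simp
  have singer: "singer_group \<S> S" "singer_group \<S>' S'"
    using \<open>linear_singer_group x \<phi> \<S> S\<close> \<open>linear_singer_group x' \<phi>' \<S>' S'\<close>
    by (simp_all add: linear_singer_group_def)
  have Uq: "U \<in> BB (CARD('k)) (plane W_quadrangle x) l" "U' \<in> BB (CARD('k)) (plane W_quadrangle x') l'"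
    using assms(9,16) cardq by simp_all
  obtain K :: "'k set" and M :: "'k option option \<Rightarrow> 's set" and G :: "'k option option \<Rightarrow> 'k set" where
    K: "additive_subgroup K" "add_group K \<cong> nu0_space (plane W_quadrangle x) l T"
      "monoid (nu0_space (plane W_quadrangle x) l T)"
    and M: "bij_betw M UNIV (lines_through \<S> z)"
    and G: "\<forall>i. G i = (case i of Some (Some m) \<Rightarrow> K | _ \<Rightarrow> UNIV)"
    and iso: "\<forall>i. add_group (G i) \<cong> perm_group \<S> (line_stabilizer S (M i))"
    by (rule singer_line_stabilizers[OF assms(5,6) singer(1) assms(8) Uq(1) assms(10,11,20)])
  obtain K' :: "'k set" and M' :: "'k option option \<Rightarrow> 't set" and G' :: "'k option option \<Rightarrow> 'k set" where
    K': "additive_subgroup K'" "add_group K' \<cong> nu0_space (plane W_quadrangle x') l' T'"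
      "monoid (nu0_space (plane W_quadrangle x') l' T')"
    and M': "bij_betw M' UNIV (lines_through \<S>' z')"
    and G': "\<forall>i. G' i = (case i of Some (Some m) \<Rightarrow> K' | _ \<Rightarrow> UNIV)"
    and iso': "\<forall>i. add_group (G' i) \<cong> perm_group \<S>' (line_stabilizer S' (M' i))"
    by (rule singer_line_stabilizers[OF assms(12,13) singer(2) assms(15) Uq(2) assms(17,18,21)])
  note elem = elementary_abelian_add_group[OF _ \<open>prime p\<close> cardk]
  have dim: "nu0_dim p (plane W_quadrangle x) l T = nu0_dim p (plane W_quadrangle x') l' T' \<longleftrightarrow>
      card K = card K'"
    using Fp_dim_iso_eq[OF elementary_abelian_cong[OF elem[OF K(1)] K(2,3)]
        elementary_abelian_cong[OF elem[OF K'(1)] K'(2,3)]]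
      iso_same_card[OF K(2)] iso_same_card[OF K'(2)]
    by (simp add: nu0_dim_def)
  have sub: "additive_subgroup (G i)" "additive_subgroup (G' i)" for i
    using K(1) K'(1) by (auto simp: G G' additive_subgroup_def split: option.split)
  have card_stab: "card (line_stabilizer S (M i)) = card (G i)"
    "card (line_stabilizer S' (M' i)) = card (G' i)" for i
    using iso_same_card[OF spec[OF iso, of i]] iso_same_card[OF spec[OF iso', of i]] by simp_all
  \<comment> \<open>The indices \<open>None\<close> and \<open>Some None\<close> contribute the full
    field twice, and each of the \<open>q\<close> slopes contributes the kernel.\<close>
  have sum_G: "(\<Sum>i\<in>UNIV. card (G i)) = 2 * q + q * card K"
    "(\<Sum>i\<in>UNIV. card (G' i)) = 2 * q + q * card K'"
    by (simp_all add: sum_option_UNIV G G' cardq)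
  \<comment> \<open>Each \<open>option\<close> adds one index to the \<open>q\<close> slopes, which
    matches the \<open>q + 2\<close> numbers from 0 to \<open>q + 1\<close>.\<close>
  have cardJ: "card {0..q + 1} = CARD('k option option)" by (simp add: card_UNIV_option cardq)
  have "q > 0" using \<open>prime p\<close> \<open>q = p ^ n\<close> by (simp add: prime_gt_0_nat)
  show ?thesis unfolding dim
  proof
    assume "\<exists>f f'. bij_betw f {0..q + 1} (lines_through \<S> z)
                \<and> bij_betw f' {0..q + 1} (lines_through \<S>' z')
                \<and> (\<forall>j \<in> {0..q + 1}. perm_group \<S> (line_stabilizer S (f j))
                                     \<cong> perm_group \<S>' (line_stabilizer S' (f' j)))"
    then obtain f f' where f: "bij_betw f {0..q + 1} (lines_through \<S> z)"
      "bij_betw f' {0..q + 1} (lines_through \<S>' z')"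
      and ff: "\<And>j. j \<in> {0..q + 1} \<Longrightarrow> perm_group \<S> (line_stabilizer S (f j))
                                     \<cong> perm_group \<S>' (line_stabilizer S' (f' j))" by blast
    \<comment> \<open>Both enumerations run over all lines, so the sum of the stabilizer orders is
      the same for \<open>f\<close> as for \<open>M\<close>, and for \<open>f'\<close> as for
      \<open>M'\<close>, whichever lines are paired.\<close>
    have "2 * q + q * card K = (\<Sum>i\<in>UNIV. card (line_stabilizer S (M i)))"
      by (simp add: sum_G card_stab)
    also have "\<dots> = (\<Sum>L\<in>lines_through \<S> z. card (line_stabilizer S L))"
      by (rule sum.reindex_bij_betw[OF M])
    also have "\<dots> = (\<Sum>j\<in>{0..q + 1}. card (line_stabilizer S (f j)))"
      by (rule sum.reindex_bij_betw[OF f(1), symmetric])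
    also have "\<dots> = (\<Sum>j\<in>{0..q + 1}. card (line_stabilizer S' (f' j)))"
    proof (rule sum.cong)
      fix j assume "j \<in> {0..q + 1}"
      then show "card (line_stabilizer S (f j)) = card (line_stabilizer S' (f' j))"
        using iso_same_card[OF ff[of j]] by simp
    qed simp
    also have "\<dots> = (\<Sum>L\<in>lines_through \<S>' z'. card (line_stabilizer S' L))"
      by (rule sum.reindex_bij_betw[OF f(2)])
    also have "\<dots> = (\<Sum>i\<in>UNIV. card (line_stabilizer S' (M' i)))"
      by (rule sum.reindex_bij_betw[OF M', symmetric])
    also have "\<dots> = 2 * q + q * card K'" by (simp add: sum_G card_stab)
    finally show "card K = card K'" using \<open>q > 0\<close> by simp
  next
    assume KK: "card K = card K'"
    obtain \<epsilon> :: "nat \<Rightarrow> 'k option option" where \<epsilon>: "bij_betw \<epsilon> {0..q + 1} UNIV"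
      using finite_same_card_bij[OF _ _ cardJ] by auto
    have "perm_group \<S> (line_stabilizer S (M i)) \<cong> perm_group \<S>' (line_stabilizer S' (M' i))" for i
    proof -
      \<comment> \<open>The index alone decides whether the stabilizer is the full field or the
        kernel, in both quadrangles alike; pairing lines of equal index therefore pairs groups of
        equal order.\<close>
      have "card (G i) = card (G' i)" using KK by (simp add: G G' split: option.split)
      then have "add_group (G i) \<cong> add_group (G' i)"
        by (intro elementary_abelian_iso[OF elem elem] sub) simp
      moreover have "group (add_group (G i))"
        using comm_group_add_group[OF sub(1)] by (simp add: comm_group_def)
      ultimately show ?thesis
        using iso iso' group.iso_sym iso_trans by metis
    qed
    then have "bij_betw (M \<circ> \<epsilon>) {0..q + 1} (lines_through \<S> z) \<and>
        bij_betw (M' \<circ> \<epsilon>) {0..q + 1} (lines_through \<S>' z') \<and>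
        (\<forall>j \<in> {0..q + 1}. perm_group \<S> (line_stabilizer S ((M \<circ> \<epsilon>) j))
                              \<cong> perm_group \<S>' (line_stabilizer S' ((M' \<circ> \<epsilon>) j)))"
      using bij_betw_trans[OF \<epsilon> M] bij_betw_trans[OF \<epsilon> M'] by simp
    then show "\<exists>f f'. bij_betw f {0..q + 1} (lines_through \<S> z)
                \<and> bij_betw f' {0..q + 1} (lines_through \<S>' z')
                \<and> (\<forall>j \<in> {0..q + 1}. perm_group \<S> (line_stabilizer S (f j))
                                     \<cong> perm_group \<S>' (line_stabilizer S' (f' j)))" by blast
  qed
qed

end
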